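(* Let $n\ge 2$, let $G\subset\mathbb{R}^n$ be a domain whose boundary $\partial G$ is of positive capacity, and let $\alpha\in(0,1)$. Then $\partial G$ is uniformly perfect if and only if there exists a constant $s>0$ such that $u_\alpha(x)\ge s$ for all $x\in G$, where $$u_\alpha(x)=\operatorname{cap}\bigl(G,\ \overline{B}^n(x,\alpha\, d(x,\partial G))\bigr).$$
   Context: A condenser is a pair $(A,C)$ with $A\subset\mathbb{R}^n$ open and non-empty and $C\subset A$ compact and non-empty; its (conformal) capacity is $\operatorname{cap}(A,C)=\inf_u\int_{\mathbb{R}^n}|\nabla u|^n\,dm$, the infimum over all non-negative $\mathrm{ACL}^n$ functions $u$ with compact support in $A$ and $u\ge 1$ on $C$. A compact set $C\subset\mathbb{R}^n$ is of capacity zero if $\operatorname{cap}(A,C)=0$ for some bounded domain $A\supset C$ (this does not depend on $A$), and otherwise of positive capacity; by Möbius invariance of conformal capacity, these notions extend to compact subsets of $\overline{\mathbb{R}}^n=\mathbb{R}^n\cup\{\infty\}$. The boundary $\partial G$ is taken in $\overline{\mathbb{R}}^n$ (so $\infty\in\partial G$ if $G$ is unbounded); $d(x,\partial G)$ is the Euclidean distance from $x$ to the finite boundary points; $\overline{B}^n(x,r)$ is the closed Euclidean ball. A compact set $E\subset\overline{\mathbb{R}}^n$ with at least two points is called uniformly perfect if there is $c\in(0,1)$ (and then $E\in\mathrm{UP}_n(c)$) such that $\{x\in E: cr<|x-a|<r\}\ne\emptyset$ for all $a\in E\setminus\{\infty\}$ and all $0<r<d(E)/2$, where $d(E)$ is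 the Euclidean diameter, with $d(E)=+\infty$ if $\infty\in E$ (the point $\infty$ itself is not counted as satisfying $cr<|x-a|<r$). *)

theory Defs
  imports "HOL-Analysis.Analysis"
begin

text \<open>
  The space \<open>\<real>\<^sup>n\<close> is a Euclidean space \<open>'a\<close> with \<open>n = DIM('a)\<close>; its one-point compactification lives on
  \<open>'a option\<close>, where \<open>None\<close> is the point at infinity and \<open>Some x\<close> is the finite point \<open>x\<close>.
\<close>

abbreviation ext_space :: "'a::euclidean_space option topology" where
  "ext_space \<equiv> Alexandroff_compactification euclidean"

definition ext_boundary :: "'a::euclidean_space set \<Rightarrow> 'a option set" where
  "ext_boundary G = ext_space frontier_of (Some ` G)"

abbreviation finite_points :: "'a option set \<Rightarrow> 'a set" where
  "finite_points E \<equiv> Some -` E"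


subsection \<open>Functions of class \<open>ACL\<^sup>n\<close>\<close>

definition abs_continuous_on :: "real set \<Rightarrow> (real \<Rightarrow> real) \<Rightarrow> bool" where
  "abs_continuous_on I f \<longleftrightarrow>
     (\<forall>\<epsilon>>0. \<exists>\<delta>>0. \<forall>P. finite P \<longrightarrow> (\<forall>(p, q)\<in>P. p \<in> I \<and> q \<in> I \<and> p < q) \<longrightarrow>
        disjoint_family_on (\<lambda>(p, q). {p<..<q}) P \<longrightarrow> (\<Sum>(p, q)\<in>P. q - p) < \<delta> \<longrightarrow>
        (\<Sum>(p, q)\<in>P. \<bar>f q - f p\<bar>) < \<epsilon>)"

text \<open>
  A segment in the box \<open>cbox a b\<close> parallel to the basis vector \<open>i\<close> is determined by its remaining
  \<open>n - 1\<close> coordinates \<open>y\<close>; ``almost every segment'' refers to \<open>(n - 1)\<close>-dimensional Lebesgue measure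
  on these coordinates.
\<close>

definition ACL :: "('a::euclidean_space \<Rightarrow> real) \<Rightarrow> bool" where
  "ACL u \<longleftrightarrow> continuous_on UNIV u \<and>
     (\<forall>a b. \<forall>i\<in>Basis. AE y in Pi\<^sub>M (Basis - {i}) (\<lambda>_. lborel).
        (\<forall>j\<in>Basis - {i}. y j \<in> {a \<bullet> j..b \<bullet> j}) \<longrightarrow>
        abs_continuous_on {a \<bullet> i..b \<bullet> i} (\<lambda>t. u (t *\<^sub>R i + (\<Sum>j\<in>Basis - {i}. y j *\<^sub>R j))))"

text \<open>
  Partial derivatives of an ACL function exist almost everywhere; at the remaining points the
  value of \<open>partial_deriv\<close> is irrelevant.
\<close>

definition partial_deriv :: "'a::euclidean_space \<Rightarrow> ('a \<Rightarrow> real) \<Rightarrow> 'a \<Rightarrow> real" where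
  "partial_deriv i u x = deriv (\<lambda>t. u (x + t *\<^sub>R i)) 0"

definition grad :: "('a::euclidean_space \<Rightarrow> real) \<Rightarrow> 'a \<Rightarrow> 'a" where
  "grad u x = (\<Sum>i\<in>Basis. partial_deriv i u x *\<^sub>R i)"

text \<open>
  Local \<open>n\<close>-integrability of the partial derivatives. For functions with compact support this is
  the same as integrability over the whole space.
\<close>

definition ACLn :: "('a::euclidean_space \<Rightarrow> real) \<Rightarrow> bool" where
  "ACLn u \<longleftrightarrow> ACL u \<and>
     (\<forall>i\<in>Basis. \<forall>K. compact K \<longrightarrow> set_integrable lborel K (\<lambda>x. \<bar>partial_deriv i u x\<bar> ^ DIM('a)))"


subsection \<open>Conformal capacity\<close>

definition condenser :: "'a::euclidean_space set \<Rightarrow> 'a set \<Rightarrow> bool" where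
  "condenser A C \<longleftrightarrow> open A \<and> A \<noteq> {} \<and> compact C \<and> C \<noteq> {} \<and> C \<subseteq> A"

definition cap_admissible :: "'a::euclidean_space set \<Rightarrow> 'a set \<Rightarrow> ('a \<Rightarrow> real) set" where
  "cap_admissible A C =
     {u. ACLn u \<and> (\<forall>x. 0 \<le> u x) \<and>
         compact (closure {x. u x \<noteq> 0}) \<and> closure {x. u x \<noteq> 0} \<subseteq> A \<and> (\<forall>x\<in>C. 1 \<le> u x)}"

text \<open>Meaningful when \<open>condenser A C\<close> holds.\<close>

definition cap :: "'a::euclidean_space set \<Rightarrow> 'a set \<Rightarrow> ennreal" where
  "cap A C = (INF u\<in>cap_admissible A C. \<integral>\<^sup>+ x. ennreal (norm (grad u x) ^ DIM('a)) \<partial>lborel)"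

definition cap_zero :: "'a::euclidean_space set \<Rightarrow> bool" where
  "cap_zero C \<longleftrightarrow> (\<exists>A. bounded A \<and> connected A \<and> condenser A C \<and> cap A C = 0)"

text \<open>
  The Moebius group of the compactified space, generated by inversions in spheres and reflections
  in hyperplanes.
\<close>

fun sphere_inversion :: "'a::euclidean_space \<Rightarrow> real \<Rightarrow> 'a option \<Rightarrow> 'a option" where
  "sphere_inversion a r None = Some a"
| "sphere_inversion a r (Some x) =
     (if x = a then None else Some (a + (r\<^sup>2 / (norm (x - a))\<^sup>2) *\<^sub>R (x - a)))"

fun hyperplane_reflection :: "'a::euclidean_space \<Rightarrow> real \<Rightarrow> 'a option \<Rightarrow> 'a option" where
  "hyperplane_reflection v t None = None"
| "hyperplane_reflection v t (Some x) = Some (x - (2 * (x \<bullet> v - t) / (v \<bullet> v)) *\<^sub>R v)"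

inductive ext_moebius :: "('a::euclidean_space option \<Rightarrow> 'a option) \<Rightarrow> bool" where
  "ext_moebius id"
| "0 < r \<Longrightarrow> ext_moebius f \<Longrightarrow> ext_moebius (sphere_inversion a r \<circ> f)"
| "v \<noteq> 0 \<Longrightarrow> ext_moebius f \<Longrightarrow> ext_moebius (hyperplane_reflection v t \<circ> f)"

text \<open>
  A compact set other than the whole compactified space can be moved into the finite part by a
  Moebius transformation. The whole space cannot, and it is of positive capacity.
\<close>

definition ext_cap_zero :: "'a::euclidean_space option set \<Rightarrow> bool" where
  "ext_cap_zero E \<longleftrightarrow> (\<exists>f D. ext_moebius f \<and> f ` E = Some ` D \<and> cap_zero D)"

definition ext_cap_positive :: "'a::euclidean_space option set \<Rightarrow> bool" where
  "ext_cap_positive E \<longleftrightarrow> compactin ext_space E \<and> \<not> ext_cap_zero E"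


subsection \<open>Uniformly perfect sets\<close>

definition ext_diameter :: "'a::euclidean_space option set \<Rightarrow> ereal" where
  "ext_diameter E = (if None \<in> E then \<infinity> else ereal (diameter (finite_points E)))"

definition UP :: "real \<Rightarrow> 'a::euclidean_space option set \<Rightarrow> bool" where
  "UP c E \<longleftrightarrow> compactin ext_space E \<and> (\<exists>x\<in>E. \<exists>y\<in>E. x \<noteq> y) \<and>
     (\<forall>a\<in>finite_points E. \<forall>r>0. ereal r < ext_diameter E / 2 \<longrightarrow>
        {x \<in> finite_points E. c * r < norm (x - a) \<and> norm (x - a) < r} \<noteq> {})"

definition uniformly_perfect :: "'a::euclidean_space option set \<Rightarrow> bool" where
  "uniformly_perfect E \<longleftrightarrow> (\<exists>c. 0 < c \<and> c < 1 \<and> UP c E)"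


definition boundary_dist :: "'a::euclidean_space set \<Rightarrow> 'a \<Rightarrow> real" where
  "boundary_dist G x = infdist x (finite_points (ext_boundary G))"

definition ball_cap :: "real \<Rightarrow> 'a::euclidean_space set \<Rightarrow> 'a \<Rightarrow> ennreal" where
  "ball_cap \<alpha> G x = cap G (cball x (\<alpha> * boundary_dist G x))"

end

theory Submission
  imports Defs
begin

text \<open>
  A function competing for the capacity of \<open>(G, cball x (\<alpha> d))\<close>, where \<open>d\<close> is the distance of \<open>x\<close> from
  the boundary, vanishes on the finite boundary \<open>E\<close> and is at least \<open>1\<close> on the ball. Its
  \<open>n\<close>-energy is invariant under scaling, so one bound can serve all \<open>x\<close>.

  Suppose that the boundary is uniformly perfect. The Poincare inequality compares the means of \<open>u\<close> over
  two cubes of comparable size, with an error that depends on the energy of \<open>u\<close> in a larger cube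
  and not on the scale (\<open>poincare_cubes\<close>). Around a boundary point \<open>p\<close>, uniform perfectness
  supplies a second boundary point \<open>p'\<close> at distance comparable with the scale. Much smaller
  cubes around \<open>p\<close> and \<open>p'\<close> are disjoint, so one of them carries at most half of the
  energy, and the descent continues there (\<open>exists_child_with_half_energy\<close>). The energies met
  on the way decrease geometrically, hence the errors add up to a bounded multiple of
  \<open>\<epsilon> + I / \<epsilon>\<^bsup>n-1\<^esup>\<close>, where \<open>I\<close> is the total energy and \<open>\<epsilon> > 0\<close> is arbitrary, whereas the means tend to
  the boundary value \<open>0\<close> (\<open>cube_mean_le_energy\<close>). As the mean over the first cube, inside the
  ball, is at least \<open>1\<close>, the energy \<open>I\<close> is bounded below (\<open>energy_lower_bound\<close>).

  For functions of class ACL the Poincare inequality is obtained by integrating over lines parallel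
  to the axes. Since the gradient is made of pointwise derivatives, this needs the theorem that an
  absolutely continuous function on an interval is differentiable almost everywhere and is the
  integral of its derivative (\<open>fundamental_theorem_of_calculus_abs_continuous\<close>).

  Suppose conversely that the capacities are at least \<open>s\<close>. If a ring
  \<open>c r < |y - a| < r\<close> around a boundary point \<open>a\<close>, with \<open>r\<close> less than half of the diameter of the
  boundary, contained no boundary point, then it would lie in the connected set \<open>G\<close>. For a point
  \<open>x\<close> of the ring at distance \<open>r \<surd>c\<close> from \<open>a\<close>, a function that depends on \<open>log |y - a|\<close> alone and goes
  from \<open>1\<close> to \<open>0\<close> over \<open>N\<close> dyadic scales on either side has energy of order \<open>1 / N\<close>
  (\<open>logarithmic_cutoff\<close>). There is room for any number \<open>N\<close> of scales when \<open>c\<close> is small,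
  which contradicts the bound \<open>s\<close>.
\<close>

section \<open>Finite families of intervals and Vitali coverings\<close>

definition interval_family :: "real \<Rightarrow> real \<Rightarrow> (real \<times> real) set \<Rightarrow> bool" where
  "interval_family a b P \<longleftrightarrow> finite P \<and> (\<forall>(p, q)\<in>P. a \<le> p \<and> p < q \<and> q \<le> b) \<and>
     disjoint_family_on (\<lambda>(p, q). {p<..<q}) P"

lemma interval_familyD:
  assumes "interval_family a b P"
  shows "finite P" and "(p, q) \<in> P \<Longrightarrow> a \<le> p" and "(p, q) \<in> P \<Longrightarrow> p < q" and "(p, q) \<in> P \<Longrightarrow> q \<le> b"
    and "disjoint_family_on (\<lambda>(p, q). {p<..<q}) P"
  using assms by (auto simp: interval_family_def)

lemma interval_family_disjoint:
  assumes "interval_family a b P" "(p, q) \<in> P" "(p', q') \<in> P" "(p, q) \<noteq> (p', q')"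
  shows "q \<le> p' \<or> q' \<le> p"
proof (rule ccontr)
  assume neg: "\<not> ?thesis"
  have "{p<..<q} \<inter> {p'<..<q'} = {}"
    using interval_familyD(5)[OF assms(1)] assms(2-4) by (fastforce simp: disjoint_family_on_def)
  moreover have "(max p p' + min q q') / 2 \<in> {p<..<q} \<inter> {p'<..<q'}"
    using neg interval_familyD(3)[OF assms(1,2)] interval_familyD(3)[OF assms(1,3)]
    by (auto simp: max_def min_def field_simps)
  ultimately show False by blast
qed

lemma interval_family_subset:
  assumes "interval_family a b P" "Q \<subseteq> P" "\<And>p q. (p, q) \<in> Q \<Longrightarrow> a' \<le> p \<and> q \<le> b'"
  shows "interval_family a' b' Q"
  using assms unfolding interval_family_def
  by (auto intro: finite_subset disjoint_family_on_mono)

text \<open>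
  The rightmost interval is removed first: the others lie to the left of it.
\<close>

lemma sum_increments_le:
  fixes v :: "real \<Rightarrow> real"
  assumes P: "interval_family a b P" and "a \<le> b" and mono: "mono_on {a..b} v"
  shows "(\<Sum>(p, q)\<in>P. v q - v p) \<le> v b - v a"
proof -
  have "finite P" using P by (simp add: interval_family_def)
  then have "a \<le> c \<Longrightarrow> c \<le> b \<Longrightarrow> interval_family a c P \<Longrightarrow> (\<Sum>(p, q)\<in>P. v q - v p) \<le> v c - v a" for c
  proof (induction P arbitrary: c rule: finite_ranking_induct[where f = fst])
    case empty
    then show ?case using monotone_onD[OF mono, of a c] \<open>a \<le> b\<close> by auto
  next
    case (insert I S)
    obtain p q where I: "I = (p, q)" by (cases I)
    have pq: "a \<le> p" "p < q" "q \<le> c"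
      using interval_familyD(2-4)[OF insert.prems(3), of p q] I by auto
    show ?case
    proof (cases "I \<in> S")
      case True
      then show ?thesis using insert.IH insert.prems by (simp add: insert_absorb)
    next
      case False
      have "interval_family a p S"
      proof (rule interval_family_subset[OF insert.prems(3)])
        fix p' q' assume S: "(p', q') \<in> S"
        then have "q \<le> p' \<or> q' \<le> p"
          using interval_family_disjoint[OF insert.prems(3), of p q p' q'] False I by auto
        moreover have "p' \<le> p" using insert.hyps(2)[OF S] I by simp
        ultimately show "a \<le> p' \<and> q' \<le> p"
          using pq interval_familyD(2,3)[OF insert.prems(3)] S by auto
      qed auto
      then have "(\<Sum>(p, q)\<in>S. v q - v p) \<le> v p - v a"
        using insert.IH[of p] pq insert.prems by auto
      moreover have "v q \<le> v c" using mono pq insert.prems by (auto simp: mono_on_def)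
      ultimately show ?thesis using False insert.hyps(1) I by simp
    qed
  qed
  then show ?thesis using assms by auto
qed

text \<open>
  The function \<open>v\<close> is the total variation of \<open>f\<close> on \<open>{a..x}\<close>. Being a supremum over finite families, it is
  captured up to \<open>\<epsilon>\<close> by one of them.
\<close>

lemma variation_function:
  fixes f :: "real \<Rightarrow> real"
  assumes "a \<le> b"
    and bound: "\<And>P. interval_family a b P \<Longrightarrow> (\<Sum>(p, q)\<in>P. \<bar>f q - f p\<bar>) \<le> B"
  obtains v where "mono_on {a..b} v"
    and "\<And>x y. a \<le> x \<Longrightarrow> x \<le> y \<Longrightarrow> y \<le> b \<Longrightarrow> \<bar>f y - f x\<bar> \<le> v y - v x"
    and "\<And>\<epsilon>. 0 < \<epsilon> \<Longrightarrow> \<exists>P. interval_family a b P \<and> v b - v a - \<epsilon> < (\<Sum>(p, q)\<in>P. \<bar>f q - f p\<bar>)"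
proof -
  define var where "var P = (\<Sum>(p, q)\<in>P. \<bar>f q - f p\<bar>)" for P
  define v where "v x = (SUP P \<in> {P. interval_family a x P}. var P)" for x
  have widen: "interval_family a y P" if "interval_family a x P" "x \<le> y" for x y P
    using that by (force simp: interval_family_def)
  have empty: "interval_family a x {}" for x
    by (simp add: interval_family_def disjoint_family_on_def)
  have bdd: "bdd_above (var ` {P. interval_family a x P})" if "x \<le> b" for x
    unfolding bdd_above_def using bound widen that by (fastforce simp: var_def)
  have upper: "var P \<le> v x" if "interval_family a x P" "x \<le> b" for P x
    unfolding v_def using that bdd[of x] by (intro cSUP_upper) auto
  have incr: "\<bar>f y - f x\<bar> \<le> v y - v x" if "a \<le> x" "x \<le> y" "y \<le> b" for x y
  proof (cases "x = y")
    case False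
    then have "x < y" using that by simp
    have "v x \<le> v y - \<bar>f y - f x\<bar>"
      unfolding v_def[of x]
    proof (rule cSUP_least)
      show "{P. interval_family a x P} \<noteq> {}" using empty by blast
      fix P assume "P \<in> {P. interval_family a x P}"
      then have P: "interval_family a x P" by simp
      have notin: "(x, y) \<notin> P" using interval_familyD(4)[OF P, of x y] \<open>x < y\<close> by auto
      have "interval_family a y (insert (x, y) P)"
        unfolding interval_family_def
      proof (intro conjI)
        show "finite (insert (x, y) P)" using interval_familyD(1)[OF P] by simp
        show "\<forall>(p, q)\<in>insert (x, y) P. a \<le> p \<and> p < q \<and> q \<le> y"
          using interval_familyD(2-4)[OF P] that \<open>x < y\<close> by fastforce
        show "disjoint_family_on (\<lambda>(p, q). {p<..<q}) (insert (x, y) P)"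
          using notin interval_familyD(5)[OF P] interval_familyD(4)[OF P]
          by (subst disjoint_family_on_insert) (force)+
      qed
      then have "var (insert (x, y) P) \<le> v y" using upper that by blast
      then show "var P \<le> v y - \<bar>f y - f x\<bar>"
        using notin interval_familyD(1)[OF P] by (simp add: var_def)
    qed
    then show ?thesis by simp
  qed simp
  show thesis
  proof
    show "mono_on {a..b} v"
      using incr by (force intro!: mono_onI)
    show "\<bar>f y - f x\<bar> \<le> v y - v x" if "a \<le> x" "x \<le> y" "y \<le> b" for x y
      using incr that .
    show "\<exists>P. interval_family a b P \<and> v b - v a - \<epsilon> < (\<Sum>(p, q)\<in>P. \<bar>f q - f p\<bar>)" if "0 < \<epsilon>" for \<epsilon>
    proof -
      have "0 \<le> v a" using upper[OF empty, of a] \<open>a \<le> b\<close> by (simp add: var_def)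
      then have "v b - v a - \<epsilon> < v b" using that by simp
      then obtain P where "interval_family a b P" "v b - v a - \<epsilon> < var P"
        unfolding v_def[of b] using less_cSUP_iff[OF _ bdd[of b]] empty by blast
      then show ?thesis by (auto simp: var_def)
    qed
  qed
qed

text \<open>
  A criterion for null sets that hides the covering theorem. The set \<open>K\<close> of intervals is a Vitali
  cover of \<open>E\<close> up to the finitely many exceptional points \<open>F\<close>, so disjoint intervals from \<open>K\<close> cover
  almost all of \<open>E\<close>; the last hypothesis bounds their total length.
\<close>

lemma negligible_by_fine_intervals:
  fixes E :: "real set"
  assumes "\<And>\<epsilon>. 0 < \<epsilon> \<Longrightarrow> \<exists>K F. finite F \<and> (\<forall>(y, z)\<in>K. y < z) \<and>
      (\<forall>x\<in>E - F. \<forall>d>0. \<exists>(y, z)\<in>K. x \<in> {y..z} \<and> z - y < d) \<and>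
      (\<forall>C\<subseteq>K. finite C \<longrightarrow> disjoint_family_on (\<lambda>(y, z). {y<..<z}) C \<longrightarrow> (\<Sum>(y, z)\<in>C. z - y) \<le> \<epsilon>)"
  shows "negligible E"
  unfolding negligible_outer_le
proof (intro allI impI)
  fix \<epsilon> :: real assume "0 < \<epsilon>"
  from assms[OF this] obtain K F where "finite F" and K': "\<forall>(y, z)\<in>K. y < z"
    and fine': "\<forall>x\<in>E - F. \<forall>d>0. \<exists>(y, z)\<in>K. x \<in> {y..z} \<and> z - y < d"
    and len': "\<forall>C\<subseteq>K. finite C \<longrightarrow> disjoint_family_on (\<lambda>(y, z). {y<..<z}) C \<longrightarrow> (\<Sum>(y, z)\<in>C. z - y) \<le> \<epsilon>"
    by (elim exE conjE) (rule that)
  have K: "\<And>y z. (y, z) \<in> K \<Longrightarrow> y < z"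
    and fine: "\<And>x d. x \<in> E - F \<Longrightarrow> d > 0 \<Longrightarrow> \<exists>(y, z)\<in>K. x \<in> {y..z} \<and> z - y < d"
    and len: "\<And>C. C \<subseteq> K \<Longrightarrow> finite C \<Longrightarrow> disjoint_family_on (\<lambda>(y, z). {y<..<z}) C \<Longrightarrow> (\<Sum>(y, z)\<in>C. z - y) \<le> \<epsilon>"
    using K' fine' len' by auto
  define c where "c = (\<lambda>(y, z). (y + z) / 2 :: real)"
  define r where "r = (\<lambda>(y, z). (z - y) / 2 :: real)"
  have cb: "cball (c I) (r I) = (case I of (y, z) \<Rightarrow> {y..z})" for I
    by (cases I) (auto simp: c_def r_def cball_eq_atLeastAtMost field_simps)
  obtain C where C: "countable C" "C \<subseteq> K" "pairwise (\<lambda>i j. disjnt (cball (c i) (r i)) (cball (c j) (r j))) C"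
    "negligible ((E - F) - (\<Union>i\<in>C. cball (c i) (r i)))"
  proof (rule Vitali_covering_theorem_cballs[of K r "E - F" c])
    fix i assume "i \<in> K" then show "0 < r i" using K by (cases i) (auto simp: r_def)
  next
    fix x d :: real assume "x \<in> E - F" "0 < d"
    then obtain y z where "(y, z) \<in> K" "x \<in> {y..z}" "z - y < d" using fine[of x d] by blast
    then show "\<exists>i. i \<in> K \<and> x \<in> cball (c i) (r i) \<and> r i < d"
      using K[of y z] cb[of "(y, z)"] by (intro exI[of _ "(y, z)"]) (auto simp: r_def field_simps)
  qed
  define U where "U = (\<Union>i\<in>C. cball (c i) (r i))"
  have bound: "measure lebesgue (\<Union>i\<in>D. cball (c i) (r i)) \<le> \<epsilon>" if "D \<subseteq> C" "finite D" for D
  proof -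
    have "measure lebesgue (\<Union>i\<in>D. cball (c i) (r i)) \<le> (\<Sum>i\<in>D. measure lebesgue (cball (c i) (r i)))"
      using that by (intro measure_UNION_le) auto
    also have "\<dots> = (\<Sum>(y, z)\<in>D. z - y)"
      using that C(2) K by (intro sum.cong) (auto simp: cb less_imp_le split: prod.splits)
    also have "\<dots> \<le> \<epsilon>"
    proof (rule len)
      show "disjoint_family_on (\<lambda>(y, z). {y<..<z}) D"
        unfolding disjoint_family_on_def
      proof (intro ballI impI)
        fix i j assume "i \<in> D" "j \<in> D" "i \<noteq> j"
        then have "cball (c i) (r i) \<inter> cball (c j) (r j) = {}"
          using C(3) that unfolding pairwise_def disjnt_def by blast
        then show "(case i of (y, z) \<Rightarrow> {y<..<z}) \<inter> (case j of (y, z) \<Rightarrow> {y<..<z}) = {}"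
          unfolding cb by (cases i; cases j) force
      qed
    qed (use that C in auto)
    finally show ?thesis .
  qed
  have U: "U \<in> lmeasurable" "measure lebesgue U \<le> \<epsilon>"
    unfolding U_def using fmeasurable_UN_bound[OF C(1) _ bound] measure_UN_bound[OF C(1) _ bound]
    by auto
  define N where "N = ((E - F) - U) \<union> F"
  have N: "negligible N" unfolding N_def using C(4) \<open>finite F\<close> by (auto simp: U_def)
  show "\<exists>T. E \<subseteq> T \<and> T \<in> lmeasurable \<and> measure lebesgue T \<le> \<epsilon>"
  proof (intro exI conjI)
    show "E \<subseteq> U \<union> N" by (auto simp: N_def)
    show "U \<union> N \<in> lmeasurable"
      using U(1) N by (simp add: fmeasurable.Un negligible_imp_measurable)
    show "measure lebesgue (U \<union> N) \<le> \<epsilon>"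
      using U N by (simp add: measure_Un_null_set negligible_iff_null_sets fmeasurableD)
  qed
qed

section \<open>Almost everywhere differentiability\<close>

text \<open>
  Arbitrarily short intervals of \<open>{a..b}\<close> that contain \<open>x\<close> have the property \<open>R\<close>. The point \<open>x\<close>
  may lie anywhere in these intervals, so that they can be used in a Vitali cover.
\<close>

definition small_intervals_at :: "real \<Rightarrow> real \<Rightarrow> (real \<Rightarrow> real \<Rightarrow> bool) \<Rightarrow> real \<Rightarrow> bool" where
  "small_intervals_at a b R x \<longleftrightarrow>
     (\<forall>d>0. \<exists>y z. a \<le> y \<and> y \<le> x \<and> x \<le> z \<and> z \<le> b \<and> y < z \<and> z - y < d \<and> R y z)"

text \<open>
  Botsko's argument. Choose a finite family \<open>P\<close> of intervals that captures the variation of \<open>f\<close> up to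
  \<open>\<delta> \<epsilon>\<close>. Near a point of the set that lies inside \<open>(p, q) \<in> P\<close>, there are short intervals on which \<open>f\<close>
  moves, with slope at least \<open>\<delta>\<close>, against the sign of \<open>f q - f p\<close>. Each of them
  contributes variation that \<open>P\<close> has missed, and so do intervals in the gaps of \<open>P\<close>. Hence
  \<open>\<delta>\<close> times the total length of disjoint intervals of these two kinds is at most \<open>\<delta> \<epsilon>\<close>.
\<close>

lemma negligible_oscillating_slopes:
  fixes f :: "real \<Rightarrow> real"
  assumes "a \<le> b" "0 < \<delta>"
    and bound: "\<And>P. interval_family a b P \<Longrightarrow> (\<Sum>(p, q)\<in>P. \<bar>f q - f p\<bar>) \<le> B"
  shows "negligible {x. small_intervals_at a b (\<lambda>y z. \<delta> * (z - y) \<le> f z - f y) x \<and>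
                        small_intervals_at a b (\<lambda>y z. f z - f y \<le> - \<delta> * (z - y)) x}"
    (is "negligible ?E")
proof (rule negligible_by_fine_intervals)
  fix \<epsilon> :: real assume "0 < \<epsilon>"
  obtain v where mono: "mono_on {a..b} v"
    and v: "\<And>x y. a \<le> x \<Longrightarrow> x \<le> y \<Longrightarrow> y \<le> b \<Longrightarrow> \<bar>f y - f x\<bar> \<le> v y - v x"
    and opt: "\<And>\<epsilon>. 0 < \<epsilon> \<Longrightarrow> \<exists>P. interval_family a b P \<and> v b - v a - \<epsilon> < (\<Sum>(p, q)\<in>P. \<bar>f q - f p\<bar>)"
    using variation_function[OF \<open>a \<le> b\<close> bound] by blast
  obtain P where P: "interval_family a b P"
    and Popt: "v b - v a - \<delta> * \<epsilon> < (\<Sum>(p, q)\<in>P. \<bar>f q - f p\<bar>)"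
    using opt[of "\<delta> * \<epsilon>"] \<open>0 < \<delta>\<close> \<open>0 < \<epsilon>\<close> by auto
  define against where "against p q y z \<longleftrightarrow> p \<le> y \<and> z \<le> q \<and>
      (if f p \<le> f q then f z - f y \<le> - \<delta> * (z - y) else \<delta> * (z - y) \<le> f z - f y)" for p q y z
  define gap where "gap y z \<longleftrightarrow> (\<forall>(p, q)\<in>P. z \<le> p \<or> q \<le> y) \<and> \<delta> * (z - y) \<le> \<bar>f z - f y\<bar>" for y z
  \<comment> \<open>Moving the end points of \<open>P\<close> to the exceptional set leaves only points inside an interval of \<open>P\<close> or in a gap.\<close>
  define K where "K = {(y, z). a \<le> y \<and> y < z \<and> z \<le> b \<and> ((\<exists>(p, q)\<in>P. against p q y z) \<or> gap y z)}"
  define F where "F = fst ` P \<union> snd ` P"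
  have "finite F" unfolding F_def using interval_familyD(1)[OF P] by simp
  have cover: "\<exists>(y, z)\<in>K. x \<in> {y..z} \<and> z - y < d" if x: "x \<in> ?E - F" and "d > 0" for x d
  proof -
    have "open (- F)" using \<open>finite F\<close> finite_imp_closed by blast
    then obtain e where e: "0 < e" "ball x e \<subseteq> - F" using x open_contains_ball by blast
    have off: "p \<notin> {y..z} \<and> q \<notin> {y..z}" if "(p, q) \<in> P" "y \<le> x" "x \<le> z" "z - y < e" for p q y z
    proof -
      have "p \<in> F" "q \<in> F" unfolding F_def using that(1) by force+
      moreover have "{y..z} \<subseteq> ball x e" using that by (auto simp: dist_real_def)
      ultimately show ?thesis using e by blast
    qed
    obtain y z where up: "a \<le> y" "y \<le> x" "x \<le> z" "z \<le> b" "y < z" "z - y < min d e" "\<delta> * (z - y) \<le> f z - f y"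
      using x e \<open>d > 0\<close> unfolding small_intervals_at_def by (auto dest!: spec[of _ "min d e"])
    obtain y' z' where dn: "a \<le> y'" "y' \<le> x" "x \<le> z'" "z' \<le> b" "y' < z'" "z' - y' < min d e"
        "f z' - f y' \<le> - \<delta> * (z' - y')"
      using x e \<open>d > 0\<close> unfolding small_intervals_at_def by (auto dest!: spec[of _ "min d e"])
    show ?thesis
    proof (cases "\<exists>(p, q)\<in>P. p < x \<and> x < q")
      case True
      then obtain p q where pq: "(p, q) \<in> P" "p < x" "x < q" by blast
      have in_pq: "p \<le> s \<and> t \<le> q" if "s \<le> x" "x \<le> t" "t - s < e" for s t
        using off[OF pq(1) that] pq that by auto
      show ?thesis
      proof (cases "f p \<le> f q")
        case True
        then have "against p q y' z'" unfolding against_def using in_pq dn by auto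
        then have "(y', z') \<in> K" using dn pq(1) by (auto simp: K_def)
        then show ?thesis using dn by auto
      next
        case False
        then have "against p q y z" unfolding against_def using in_pq up by auto
        then have "(y, z) \<in> K" using up pq(1) by (auto simp: K_def)
        then show ?thesis using up by auto
      qed
    next
      case False
      have "gap y z"
        unfolding gap_def
      proof (intro conjI ballI)
        fix I assume "I \<in> P"
        moreover obtain p q where "I = (p, q)" by (cases I)
        ultimately show "case I of (p, q) \<Rightarrow> z \<le> p \<or> q \<le> y"
          using off[of p q y z] False up by force
      qed (use up in auto)
      then have "(y, z) \<in> K" using up by (auto simp: K_def)
      then show ?thesis using up by auto
    qed
  qed
  have total: "(\<Sum>(y, z)\<in>C. z - y) \<le> \<epsilon>"
    if C: "C \<subseteq> K" "finite C" and dis: "disjoint_family_on (\<lambda>(y, z). {y<..<z}) C" for C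
  proof -
    have famC: "interval_family a b C"
      unfolding interval_family_def using C dis by (auto simp: K_def)
    define C0 where "C0 = {(y, z)\<in>C. gap y z}"
    define C1 where "C1 = (\<lambda>(p, q). {(y, z)\<in>C. against p q y z})"
    have C_split: "C \<subseteq> C0 \<union> (\<Union>I\<in>P. C1 I)"
    proof
      fix I assume "I \<in> C"
      moreover obtain y z where "I = (y, z)" by (cases I)
      ultimately show "I \<in> C0 \<union> (\<Union>I\<in>P. C1 I)"
        using C(1) by (force simp: C0_def C1_def K_def)
    qed
    have fin: "finite P" "finite C0" "\<And>I. finite (C1 I)"
      using interval_familyD(1)[OF P] C(2)
      by (auto simp: C0_def C1_def intro!: finite_subset[OF _ C(2)] split: prod.splits)
    have len_nonneg: "0 \<le> (case I of (y, z) \<Rightarrow> z - y)" if "I \<in> C" for I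
      using that interval_familyD(3)[OF famC] by (cases I) force
    have "(\<Sum>(y, z)\<in>C. z - y) \<le> (\<Sum>(y, z)\<in>C0 \<union> (\<Union>I\<in>P. C1 I). z - y)"
      using C_split fin len_nonneg by (intro sum_mono2) (auto simp: C0_def C1_def)
    also have "\<dots> \<le> (\<Sum>(y, z)\<in>C0. z - y) + (\<Sum>(y, z)\<in>(\<Union>I\<in>P. C1 I). z - y)"
    proof -
      have "0 \<le> (\<Sum>(y, z)\<in>C0 \<inter> (\<Union>I\<in>P. C1 I). z - y)"
        by (rule sum_nonneg) (use len_nonneg in \<open>auto simp: C0_def\<close>)
      then show ?thesis using fin by (subst sum_Un) auto
    qed
    also have "(\<Sum>(y, z)\<in>(\<Union>I\<in>P. C1 I). z - y) \<le> (\<Sum>I\<in>P. \<Sum>(y, z)\<in>C1 I. z - y)"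
    proof -
      have "sum (\<lambda>(y, z). z - y) (\<Union>(C1 ` Q)) \<le> (\<Sum>I\<in>Q. sum (\<lambda>(y, z). z - y) (C1 I))" if "Q \<subseteq> P" for Q
        using finite_subset[OF that fin(1)] that
      proof (induction Q rule: finite_induct)
        case (insert I Q)
        have "0 \<le> (\<Sum>(y, z)\<in>C1 I \<inter> \<Union>(C1 ` Q). z - y)"
          by (rule sum_nonneg) (use len_nonneg in \<open>auto simp: C1_def\<close>)
        then have "sum (\<lambda>(y, z). z - y) (\<Union>(C1 ` insert I Q))
            \<le> sum (\<lambda>(y, z). z - y) (C1 I) + sum (\<lambda>(y, z). z - y) (\<Union>(C1 ` Q))"
          using fin insert.hyps(1) by (simp add: sum_Un)
        then show ?case using insert by simp
      qed simp
      then show ?thesis by blast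
    qed
    finally have split: "(\<Sum>(y, z)\<in>C. z - y) \<le> (\<Sum>(y, z)\<in>C0. z - y) + (\<Sum>I\<in>P. \<Sum>(y, z)\<in>C1 I. z - y)"
      by simp
    have inside: "\<delta> * (\<Sum>(y, z)\<in>C1 (p, q). z - y) \<le> (v q - v p) - \<bar>f q - f p\<bar>" if "(p, q) \<in> P" for p q
    proof -
      have pq: "a \<le> p" "p < q" "q \<le> b" using interval_familyD(2-4)[OF P that] by auto
      \<comment> \<open>Subtracting the dominant direction of \<open>f\<close> leaves an increasing function with small total
      increment, which grows by at least \<open>\<delta> * (z - y)\<close> on every interval that goes against \<open>f q - f p\<close>.\<close>
      define w where "w = (if f p \<le> f q then (\<lambda>t. v t - f t) else (\<lambda>t. v t + f t))"
      have wmono: "mono_on {p..q} w"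
      proof (rule mono_onI)
        fix s t assume "s \<in> {p..q}" "t \<in> {p..q}" "s \<le> t"
        then show "w s \<le> w t" using v[of s t] pq by (auto simp: w_def)
      qed
      have "\<delta> * (\<Sum>(y, z)\<in>C1 (p, q). z - y) = (\<Sum>(y, z)\<in>C1 (p, q). \<delta> * (z - y))"
        by (simp add: sum_distrib_left case_prod_unfold)
      also have "\<dots> \<le> (\<Sum>(y, z)\<in>C1 (p, q). w z - w y)"
      proof (rule sum_mono)
        fix I assume "I \<in> C1 (p, q)"
        moreover obtain y z where "I = (y, z)" by (cases I)
        ultimately have ag: "against p q y z" and yz: "(y, z) \<in> C" by (auto simp: C1_def)
        have "\<bar>f z - f y\<bar> \<le> v z - v y"
          using v[of y z] interval_familyD(2-4)[OF famC yz] by auto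
        then have "\<delta> * (z - y) \<le> w z - w y"
          using ag unfolding against_def w_def by (cases "f p \<le> f q") auto
        then show "(case I of (y, z) \<Rightarrow> \<delta> * (z - y)) \<le> (case I of (y, z) \<Rightarrow> w z - w y)"
          using \<open>I = (y, z)\<close> by simp
      qed
      also have "\<dots> \<le> w q - w p"
      proof (rule sum_increments_le)
        show "interval_family p q (C1 (p, q))"
          by (rule interval_family_subset[OF famC]) (auto simp: C1_def against_def)
      qed (use pq wmono in auto)
      also have "\<dots> = (v q - v p) - \<bar>f q - f p\<bar>" by (auto simp: w_def)
      finally show ?thesis .
    qed
    have disj: "C0 \<inter> P = {}"
    proof (rule ccontr)
      assume "C0 \<inter> P \<noteq> {}"
      then obtain p q where "(p, q) \<in> P" "gap p q" by (auto simp: C0_def)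
      then show False using interval_familyD(3)[OF P, of p q] by (force simp: gap_def)
    qed
    have "interval_family a b (C0 \<union> P)"
      unfolding interval_family_def
    proof (intro conjI)
      show "finite (C0 \<union> P)" using fin by simp
      show "\<forall>(p, q)\<in>C0 \<union> P. a \<le> p \<and> p < q \<and> q \<le> b"
        using famC P by (auto simp: interval_family_def C0_def)
      have gapD: "{y<..<z} \<inter> {p<..<q} = {}" if "(y, z) \<in> C0" "(p, q) \<in> P" for y z p q
        using that by (force simp: C0_def gap_def)
      show "disjoint_family_on (\<lambda>(p, q). {p<..<q}) (C0 \<union> P)"
        unfolding disjoint_family_on_def
      proof (intro ballI impI)
        fix I J assume *: "I \<in> C0 \<union> P" "J \<in> C0 \<union> P" "I \<noteq> J"
        obtain y z p q where IJ: "I = (y, z)" "J = (p, q)" by (cases I; cases J)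
        consider "I \<in> C" "J \<in> C" | "I \<in> P" "J \<in> P" | "I \<in> C0" "J \<in> P" | "J \<in> C0" "I \<in> P"
          using * by (auto simp: C0_def)
        then show "(case I of (p, q) \<Rightarrow> {p<..<q}) \<inter> (case J of (p, q) \<Rightarrow> {p<..<q}) = {}"
        proof cases
          case 1 then show ?thesis using interval_family_disjoint[OF famC, of y z p q] * IJ by auto
        next
          case 2 then show ?thesis using interval_family_disjoint[OF P, of y z p q] * IJ by auto
        next
          case 3 then show ?thesis using gapD IJ by auto
        next
          case 4 then show ?thesis using gapD[of p q y z] IJ by auto
        qed
      qed
    qed
    then have "(\<Sum>(p, q)\<in>C0 \<union> P. v q - v p) \<le> v b - v a"
      using sum_increments_le[OF _ \<open>a \<le> b\<close> mono] by blast
    then have CP: "(\<Sum>(p, q)\<in>C0. v q - v p) + (\<Sum>(p, q)\<in>P. v q - v p) \<le> v b - v a"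
      using fin disj by (subst (asm) sum.union_disjoint) auto
    have "\<delta> * (\<Sum>(y, z)\<in>C0. z - y) = (\<Sum>(y, z)\<in>C0. \<delta> * (z - y))"
      by (simp add: sum_distrib_left case_prod_unfold)
    also have "\<dots> \<le> (\<Sum>(y, z)\<in>C0. v z - v y)"
    proof (rule sum_mono)
      fix I assume "I \<in> C0"
      moreover obtain y z where "I = (y, z)" by (cases I)
      ultimately have "gap y z" "(y, z) \<in> C" by (auto simp: C0_def)
      then show "(case I of (y, z) \<Rightarrow> \<delta> * (z - y)) \<le> (case I of (y, z) \<Rightarrow> v z - v y)"
        using v[of y z] interval_familyD(2-4)[OF famC, of y z] \<open>I = (y, z)\<close> by (auto simp: gap_def)
    qed
    finally have g: "\<delta> * (\<Sum>(y, z)\<in>C0. z - y) \<le> (\<Sum>(y, z)\<in>C0. v z - v y)" .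
    have i: "\<delta> * (\<Sum>I\<in>P. \<Sum>(y, z)\<in>C1 I. z - y) \<le> (\<Sum>(p, q)\<in>P. v q - v p) - (\<Sum>(p, q)\<in>P. \<bar>f q - f p\<bar>)"
      unfolding sum_distrib_left sum_subtractf[symmetric]
      using inside by (intro sum_mono) (auto simp: sum_distrib_left)
    have "\<delta> * (\<Sum>(y, z)\<in>C. z - y) \<le> \<delta> * ((\<Sum>(y, z)\<in>C0. z - y) + (\<Sum>I\<in>P. \<Sum>(y, z)\<in>C1 I. z - y))"
      using split \<open>0 < \<delta>\<close> by simp
    also have "\<dots> \<le> \<delta> * \<epsilon>" using g i CP Popt by (simp add: distrib_left)
    finally show ?thesis using \<open>0 < \<delta>\<close> by simp
  qed
  have "\<forall>(y, z)\<in>K. y < z" by (auto simp: K_def)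
  then show "\<exists>K F. finite F \<and> (\<forall>(y, z)\<in>K. y < z) \<and>
      (\<forall>x\<in>?E - F. \<forall>d>0. \<exists>(y, z)\<in>K. x \<in> {y..z} \<and> z - y < d) \<and>
      (\<forall>C\<subseteq>K. finite C \<longrightarrow> disjoint_family_on (\<lambda>(y, z). {y<..<z}) C \<longrightarrow> (\<Sum>(y, z)\<in>C. z - y) \<le> \<epsilon>)"
    using \<open>finite F\<close> cover total by (intro exI[of _ K] exI[of _ F] conjI ballI allI impI) blast+
qed

text \<open>
  On disjoint intervals with slope at least \<open>M\<close> in absolute value, \<open>f\<close> has variation at least \<open>M\<close>
  times their length, so this length is at most \<open>B / M\<close>.
\<close>

lemma negligible_unbounded_slopes:
  fixes f :: "real \<Rightarrow> real"
  assumes "a \<le> b"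
    and bound: "\<And>P. interval_family a b P \<Longrightarrow> (\<Sum>(p, q)\<in>P. \<bar>f q - f p\<bar>) \<le> B"
  shows "negligible {x. \<forall>M. small_intervals_at a b (\<lambda>y z. M * (z - y) \<le> \<bar>f z - f y\<bar>) x}"
    (is "negligible ?E")
proof (rule negligible_by_fine_intervals)
  fix \<epsilon> :: real assume "0 < \<epsilon>"
  define M where "M = (\<bar>B\<bar> + 1) / \<epsilon>"
  have "0 < M" using \<open>0 < \<epsilon>\<close> by (simp add: M_def)
  define K where "K = {(y, z). a \<le> y \<and> y < z \<and> z \<le> b \<and> M * (z - y) \<le> \<bar>f z - f y\<bar>}"
  have cover: "\<exists>(y, z)\<in>K. x \<in> {y..z} \<and> z - y < d" if x: "x \<in> ?E - {}" and "d > 0" for x d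
  proof -
    have "small_intervals_at a b (\<lambda>y z. M * (z - y) \<le> \<bar>f z - f y\<bar>) x" using x by simp
    then show ?thesis using \<open>d > 0\<close> unfolding small_intervals_at_def K_def by fastforce
  qed
  have total: "(\<Sum>(y, z)\<in>C. z - y) \<le> \<epsilon>"
    if C: "C \<subseteq> K" "finite C" and dis: "disjoint_family_on (\<lambda>(y, z). {y<..<z}) C" for C
  proof -
    have famC: "interval_family a b C"
      unfolding interval_family_def using C dis by (auto simp: K_def)
    have "M * (\<Sum>(y, z)\<in>C. z - y) \<le> (\<Sum>(y, z)\<in>C. \<bar>f z - f y\<bar>)"
      unfolding sum_distrib_left using C(1) by (intro sum_mono) (auto simp: K_def)
    also have "\<dots> \<le> M * \<epsilon>" using bound[OF famC] \<open>0 < \<epsilon>\<close> by (simp add: M_def)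
    finally show ?thesis using \<open>0 < M\<close> by simp
  qed
  have "\<forall>(y, z)\<in>K. y < z" by (auto simp: K_def)
  then show "\<exists>K F. finite F \<and> (\<forall>(y, z)\<in>K. y < z) \<and>
      (\<forall>x\<in>?E - F. \<forall>d>0. \<exists>(y, z)\<in>K. x \<in> {y..z} \<and> z - y < d) \<and>
      (\<forall>C\<subseteq>K. finite C \<longrightarrow> disjoint_family_on (\<lambda>(y, z). {y<..<z}) C \<longrightarrow> (\<Sum>(y, z)\<in>C. z - y) \<le> \<epsilon>)"
    using cover total by (intro exI[of _ K] exI[of _ "{}"] conjI ballI allI impI) blast+
qed

text \<open>
  At a point where \<open>f\<close> is not differentiable, either the slopes are unbounded or two numbers \<open>h < k\<close>
  separate slopes that occur at arbitrarily small scales. With \<open>m\<close> the midpoint and \<open>\<delta>\<close> half the length of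
  \<open>(h, k)\<close>, the slopes of \<open>f t - m t\<close> then oscillate between \<open>-\<delta>\<close> and \<open>\<delta>\<close>. Rational
  \<open>h\<close> and \<open>k\<close> suffice, which leaves a countable union of null sets.
\<close>

lemma differentiable_ae_of_bounded_variation:
  fixes f :: "real \<Rightarrow> real"
  assumes "a \<le> b"
    and bound: "\<And>P. interval_family a b P \<Longrightarrow> (\<Sum>(p, q)\<in>P. \<bar>f q - f p\<bar>) \<le> B"
  shows "negligible {x. a < x \<and> x < b \<and> \<not> f field_differentiable (at x)}"
proof -
  define U where "U = {x. \<forall>M. small_intervals_at a b (\<lambda>y z. M * (z - y) \<le> \<bar>f z - f y\<bar>) x}"
  define E where "E m \<delta> = {x. small_intervals_at a b (\<lambda>y z. \<delta> * (z - y) \<le> (f z - m * z) - (f y - m * y)) x \<and>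
      small_intervals_at a b (\<lambda>y z. (f z - m * z) - (f y - m * y) \<le> - \<delta> * (z - y)) x}" for m \<delta>
  have negE: "negligible (E m \<delta>)" if "0 < \<delta>" for m \<delta>
    unfolding E_def
  proof (rule negligible_oscillating_slopes[OF \<open>a \<le> b\<close> that, of "\<lambda>t. f t - m * t" "B + \<bar>m\<bar> * (b - a)"])
    fix P assume P: "interval_family a b P"
    have "(\<Sum>(p, q)\<in>P. \<bar>(f q - m * q) - (f p - m * p)\<bar>) \<le> (\<Sum>(p, q)\<in>P. \<bar>f q - f p\<bar> + \<bar>m\<bar> * (q - p))"
    proof (rule sum_mono)
      fix I assume "I \<in> P"
      moreover obtain p q where I: "I = (p, q)" by (cases I)
      ultimately have "p < q" using interval_familyD(3)[OF P] by simp
      have "(f q - m * q) - (f p - m * p) = (f q - f p) - m * (q - p)" by (simp add: algebra_simps)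
      moreover have "\<bar>m * (q - p)\<bar> = \<bar>m\<bar> * (q - p)" using \<open>p < q\<close> by (simp add: abs_mult)
      ultimately have "\<bar>(f q - m * q) - (f p - m * p)\<bar> \<le> \<bar>f q - f p\<bar> + \<bar>m\<bar> * (q - p)" by linarith
      then show "(case I of (p, q) \<Rightarrow> \<bar>(f q - m * q) - (f p - m * p)\<bar>)
          \<le> (case I of (p, q) \<Rightarrow> \<bar>f q - f p\<bar> + \<bar>m\<bar> * (q - p))" using I by simp
    qed
    also have "\<dots> = (\<Sum>(p, q)\<in>P. \<bar>f q - f p\<bar>) + \<bar>m\<bar> * (\<Sum>(p, q)\<in>P. q - p)"
      by (simp add: sum.distrib sum_distrib_left case_prod_unfold)
    also have "\<dots> \<le> B + \<bar>m\<bar> * (b - a)"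
      using bound[OF P] sum_increments_le[OF P \<open>a \<le> b\<close>, of "\<lambda>x. x"]
      by (intro add_mono mult_left_mono) (auto simp: mono_on_def)
    finally show "(\<Sum>(p, q)\<in>P. \<bar>(f q - m * q) - (f p - m * p)\<bar>) \<le> B + \<bar>m\<bar> * (b - a)" .
  qed
  define Bad where "Bad = U \<union> (\<Union>m\<in>\<rat>. \<Union>\<delta>\<in>{\<delta>\<in>\<rat>. 0 < \<delta>}. E m \<delta>)"
  have "negligible Bad"
    unfolding Bad_def
  proof (intro negligible_Un negligible_countable_Union countable_image)
    show "negligible U" unfolding U_def by (rule negligible_unbounded_slopes[OF assms])
    show "countable (\<rat> :: real set)" by (rule countable_rat)
    fix s assume "s \<in> (\<lambda>m. \<Union>\<delta>\<in>{\<delta>\<in>\<rat>. 0 < \<delta>}. E m \<delta>) ` \<rat>"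
    then obtain m where s: "s = (\<Union>\<delta>\<in>{\<delta>\<in>\<rat>. 0 < \<delta>}. E m \<delta>)" by blast
    show "negligible s"
      unfolding s
    proof (intro negligible_countable_Union countable_image)
      show "countable {\<delta> \<in> \<rat>. 0 < (\<delta>::real)}"
        using countable_rat by (rule countable_subset[rotated]) auto
    qed (use negE in auto)
  qed
  moreover have "{x. a < x \<and> x < b \<and> \<not> f field_differentiable (at x)} \<subseteq> Bad"
  proof (rule ccontr)
    assume "\<not> ?thesis"
    then obtain x where x: "a < x" "x < b" "\<not> f field_differentiable (at x)" "x \<notin> Bad" by blast
    define below where "below s \<longleftrightarrow> (\<exists>d>0. \<forall>y z. a \<le> y \<longrightarrow> y \<le> x \<longrightarrow> x \<le> z \<longrightarrow> z \<le> b \<longrightarrow> y < z \<longrightarrow> z - y < d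
        \<longrightarrow> f z - f y < s * (z - y))" for s
    define above where "above s \<longleftrightarrow> (\<exists>d>0. \<forall>y z. a \<le> y \<longrightarrow> y \<le> x \<longrightarrow> x \<le> z \<longrightarrow> z \<le> b \<longrightarrow> y < z \<longrightarrow> z - y < d
        \<longrightarrow> s * (z - y) < f z - f y)" for s
    obtain M where M: "\<not> small_intervals_at a b (\<lambda>y z. M * (z - y) \<le> \<bar>f z - f y\<bar>) x"
      using x by (auto simp: Bad_def U_def)
    then obtain d where d: "d > 0" "\<And>y z. a \<le> y \<Longrightarrow> y \<le> x \<Longrightarrow> x \<le> z \<Longrightarrow> z \<le> b \<Longrightarrow> y < z \<Longrightarrow> z - y < d
        \<Longrightarrow> \<bar>f z - f y\<bar> < M * (z - y)"
      unfolding small_intervals_at_def by (metis not_le)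
    have bM: "below M" unfolding below_def using d by (intro exI[of _ d]) fastforce
    have lowM: "- M \<le> s" if "below s" for s
    proof -
      obtain d' where d': "d' > 0" "\<And>y z. a \<le> y \<Longrightarrow> y \<le> x \<Longrightarrow> x \<le> z \<Longrightarrow> z \<le> b \<Longrightarrow> y < z \<Longrightarrow> z - y < d'
        \<Longrightarrow> f z - f y < s * (z - y)" using \<open>below s\<close> unfolding below_def by blast
      define z where "z = min b (x + min d d' / 2)"
      have z: "x < z" "z \<le> b" "z - x < d" "z - x < d'"
        using x d(1) d'(1) by (auto simp: z_def min_def)
      have "- (M * (z - x)) < f z - f x" "f z - f x < s * (z - x)"
        using d(2)[of x z] d'(2)[of x z] z x by auto
      then show ?thesis using mult_strict_right_mono[of s "- M" "z - x"] z by fastforce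
    qed
    \<comment> \<open>The upper derivative of \<open>f\<close> at \<open>x\<close>; the choice of \<open>Bad\<close> makes the lower derivative equal to it.\<close>
    define L where "L = Inf {s. below s}"
    have bdd: "bdd_below {s. below s}" using lowM by (intro bdd_belowI[of _ "- M"]) simp
    have bL: "below (L + \<eta>)" if "0 < \<eta>" for \<eta>
    proof -
      have "Inf {s. below s} < L + \<eta>" using that by (simp add: L_def)
      then obtain s where s: "below s" "s < L + \<eta>"
        using cInf_lessD[of "{s. below s}"] bM by blast
      then obtain d where d: "d > 0" "\<And>y z. a \<le> y \<Longrightarrow> y \<le> x \<Longrightarrow> x \<le> z \<Longrightarrow> z \<le> b \<Longrightarrow> y < z \<Longrightarrow> z - y < d
        \<Longrightarrow> f z - f y < s * (z - y)" unfolding below_def by blast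
      have "f z - f y < (L + \<eta>) * (z - y)"
        if "a \<le> y" "y \<le> x" "x \<le> z" "z \<le> b" "y < z" "z - y < d" for y z
        using d(2)[OF that] mult_strict_right_mono[OF s(2), of "z - y"] that by linarith
      then show ?thesis unfolding below_def using d(1) by blast
    qed
    have aL: "above (L - \<eta>)" if "0 < \<eta>" for \<eta>
    proof -
      obtain h where h: "h \<in> \<rat>" "L - \<eta> < h" "h < L" using Rats_dense_in_real[of "L - \<eta>" L] \<open>0 < \<eta>\<close> by auto
      obtain k where k: "k \<in> \<rat>" "h < k" "k < L" using Rats_dense_in_real[of h L] h by auto
      define m \<delta> where "m = (h + k) / 2" and "\<delta> = (k - h) / 2"
      have m: "m \<in> \<rat>" "\<delta> \<in> \<rat>" "0 < \<delta>" "m - \<delta> = h" "m + \<delta> = k"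
        using h k by (auto simp: m_def \<delta>_def field_simps)
      have "x \<notin> E m \<delta>" using x(4) m unfolding Bad_def by blast
      then consider
          "\<not> small_intervals_at a b (\<lambda>y z. \<delta> * (z - y) \<le> (f z - m * z) - (f y - m * y)) x"
        | "\<not> small_intervals_at a b (\<lambda>y z. (f z - m * z) - (f y - m * y) \<le> - \<delta> * (z - y)) x"
        unfolding E_def by blast
      then show ?thesis
      proof cases
        case 1
        then obtain d where d: "d > 0" "\<And>y z. a \<le> y \<Longrightarrow> y \<le> x \<Longrightarrow> x \<le> z \<Longrightarrow> z \<le> b \<Longrightarrow> y < z \<Longrightarrow> z - y < d
            \<Longrightarrow> (f z - m * z) - (f y - m * y) < \<delta> * (z - y)"
          unfolding small_intervals_at_def by (metis not_le)
        have "f z - f y < k * (z - y)"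
          if "a \<le> y" "y \<le> x" "x \<le> z" "z \<le> b" "y < z" "z - y < d" for y z
          using d(2)[OF that] unfolding m(5)[symmetric] by (simp add: algebra_simps)
        then have "below k" unfolding below_def using d(1) by blast
        then have "L \<le> k" unfolding L_def using bdd by (intro cInf_lower) auto
        then show ?thesis using k by simp
      next
        case 2
        then obtain d where d: "d > 0" "\<And>y z. a \<le> y \<Longrightarrow> y \<le> x \<Longrightarrow> x \<le> z \<Longrightarrow> z \<le> b \<Longrightarrow> y < z \<Longrightarrow> z - y < d
            \<Longrightarrow> - \<delta> * (z - y) < (f z - m * z) - (f y - m * y)"
          unfolding small_intervals_at_def by (metis not_le)
        have "(L - \<eta>) * (z - y) < f z - f y"
          if "a \<le> y" "y \<le> x" "x \<le> z" "z \<le> b" "y < z" "z - y < d" for y z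
        proof -
          have "h * (z - y) < f z - f y"
            using d(2)[OF that] unfolding m(4)[symmetric] by (simp add: algebra_simps)
          then show ?thesis using mult_strict_right_mono[OF h(2), of "z - y"] that by linarith
        qed
        then show ?thesis unfolding above_def using d(1) by blast
      qed
    qed
    have "((\<lambda>t. (f t - f x) / (t - x)) \<longlongrightarrow> L) (at x)"
      unfolding tendsto_iff
    proof (intro allI impI)
      fix \<eta> :: real assume "0 < \<eta>"
      obtain d1 where d1: "d1 > 0" "\<And>y z. a \<le> y \<Longrightarrow> y \<le> x \<Longrightarrow> x \<le> z \<Longrightarrow> z \<le> b \<Longrightarrow> y < z \<Longrightarrow> z - y < d1
          \<Longrightarrow> f z - f y < (L + \<eta>) * (z - y)" using bL[OF \<open>0 < \<eta>\<close>] unfolding below_def by blast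
      obtain d2 where d2: "d2 > 0" "\<And>y z. a \<le> y \<Longrightarrow> y \<le> x \<Longrightarrow> x \<le> z \<Longrightarrow> z \<le> b \<Longrightarrow> y < z \<Longrightarrow> z - y < d2
          \<Longrightarrow> (L - \<eta>) * (z - y) < f z - f y" using aL[OF \<open>0 < \<eta>\<close>] unfolding above_def by blast
      define d where "d = Min {d1, d2, x - a, b - x}"
      have d: "0 < d" "d \<le> d1" "d \<le> d2" "d \<le> x - a" "d \<le> b - x" using d1 d2 x by (auto simp: d_def)
      show "\<forall>\<^sub>F t in at x. dist ((f t - f x) / (t - x)) L < \<eta>"
        unfolding eventually_at
      proof (intro exI[of _ d] conjI ballI impI)
        fix t assume t: "t \<noteq> x \<and> dist t x < d"
        show "dist ((f t - f x) / (t - x)) L < \<eta>"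
        proof (cases "x < t")
          case True
          then have "f t - f x < (L + \<eta>) * (t - x)" "(L - \<eta>) * (t - x) < f t - f x"
            using d1(2)[of x t] d2(2)[of x t] t d x by (auto simp: dist_real_def)
          then have "(f t - f x) / (t - x) < L + \<eta>" "L - \<eta> < (f t - f x) / (t - x)"
            using True by (simp_all add: pos_divide_less_eq pos_less_divide_eq)
          then show ?thesis by (simp add: dist_real_def abs_less_iff)
        next
          case False
          then have "t < x" using t by simp
          then have "f x - f t < (L + \<eta>) * (x - t)" "(L - \<eta>) * (x - t) < f x - f t"
            using d1(2)[of t x] d2(2)[of t x] t d x by (auto simp: dist_real_def)
          then have "(f x - f t) / (x - t) < L + \<eta>" "L - \<eta> < (f x - f t) / (x - t)"
            using \<open>t < x\<close> by (simp_all add: pos_divide_less_eq pos_less_divide_eq)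
          moreover have "(f t - f x) / (t - x) = (f x - f t) / (x - t)"
            by (metis minus_diff_eq minus_divide_divide)
          ultimately show ?thesis by (simp add: dist_real_def abs_less_iff)
        qed
      qed (use d in auto)
    qed
    then have "(f has_field_derivative L) (at x)" by (simp add: has_field_derivative_iff)
    then show False using x(3) by (auto simp: field_differentiable_def)
  qed
  ultimately show ?thesis by (rule negligible_subset)
qed

section \<open>The fundamental theorem of calculus for absolutely continuous functions\<close>

lemma abs_continuous_on_interval_family:
  assumes "abs_continuous_on {a..b} f" "0 < \<epsilon>"
  obtains \<delta> where "0 < \<delta>"
    and "\<And>P. interval_family a b P \<Longrightarrow> (\<Sum>(p, q)\<in>P. q - p) < \<delta> \<Longrightarrow> (\<Sum>(p, q)\<in>P. \<bar>f q - f p\<bar>) < \<epsilon>"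
proof -
  from assms obtain \<delta> where \<delta>: "0 < \<delta>" and
    main: "\<And>P. finite P \<longrightarrow> (\<forall>(p, q)\<in>P. p \<in> {a..b} \<and> q \<in> {a..b} \<and> p < q) \<longrightarrow>
        disjoint_family_on (\<lambda>(p, q). {p<..<q}) P \<longrightarrow> (\<Sum>(p, q)\<in>P. q - p) < \<delta> \<longrightarrow>
        (\<Sum>(p, q)\<in>P. \<bar>f q - f p\<bar>) < \<epsilon>"
    unfolding abs_continuous_on_def by blast
  show thesis
  proof
    fix P assume P: "interval_family a b P" and "(\<Sum>(p, q)\<in>P. q - p) < \<delta>"
    moreover have "\<forall>(p, q)\<in>P. p \<in> {a..b} \<and> q \<in> {a..b} \<and> p < q"
      using P unfolding interval_family_def by fastforce
    ultimately show "(\<Sum>(p, q)\<in>P. \<bar>f q - f p\<bar>) < \<epsilon>"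
      using main[of P] interval_familyD(1,5)[OF P] by blast
  qed (fact \<delta>)
qed

lemma abs_continuous_on_subset:
  assumes "abs_continuous_on I f" "J \<subseteq> I"
  shows "abs_continuous_on J f"
  unfolding abs_continuous_on_def
proof (intro allI impI)
  fix \<epsilon> :: real assume "0 < \<epsilon>"
  then obtain \<delta> where \<delta>: "0 < \<delta>" and
    main: "\<And>P. finite P \<longrightarrow> (\<forall>(p, q)\<in>P. p \<in> I \<and> q \<in> I \<and> p < q) \<longrightarrow>
        disjoint_family_on (\<lambda>(p, q). {p<..<q}) P \<longrightarrow> (\<Sum>(p, q)\<in>P. q - p) < \<delta> \<longrightarrow>
        (\<Sum>(p, q)\<in>P. \<bar>f q - f p\<bar>) < \<epsilon>"
    using assms(1) unfolding abs_continuous_on_def by blast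
  have "\<forall>(p, q)\<in>P. p \<in> I \<and> q \<in> I \<and> p < q" if "\<forall>(p, q)\<in>P. p \<in> J \<and> q \<in> J \<and> p < q" for P
    using that assms(2) by blast
  then show "\<exists>\<delta>>0. \<forall>P. finite P \<longrightarrow> (\<forall>(p, q)\<in>P. p \<in> J \<and> q \<in> J \<and> p < q) \<longrightarrow>
        disjoint_family_on (\<lambda>(p, q). {p<..<q}) P \<longrightarrow> (\<Sum>(p, q)\<in>P. q - p) < \<delta> \<longrightarrow>
        (\<Sum>(p, q)\<in>P. \<bar>f q - f p\<bar>) < \<epsilon>"
    using \<delta> main by (intro exI[of _ \<delta>]) simp
qed

text \<open>
  On an interval shorter than the \<open>\<delta>\<close> that belongs to \<open>\<epsilon> = 1\<close>, the variation is at most \<open>1\<close>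
  by the definition of absolute continuity. Countably many such intervals with rational ends cover the interior.
\<close>

lemma differentiable_ae_of_abs_continuous:
  assumes ac: "abs_continuous_on {a..b} f"
  shows "negligible {x. a < x \<and> x < b \<and> \<not> f field_differentiable (at x)}"
proof -
  obtain \<delta> where "0 < \<delta>" and \<delta>: "\<And>P. interval_family a b P \<Longrightarrow> (\<Sum>(p, q)\<in>P. q - p) < \<delta>
      \<Longrightarrow> (\<Sum>(p, q)\<in>P. \<bar>f q - f p\<bar>) < 1"
    using abs_continuous_on_interval_family[OF ac zero_less_one] by blast
  define N where "N p q = {x. p < x \<and> x < q \<and> \<not> f field_differentiable (at x)}" for p q
  define I where "I = {(p, q) \<in> \<rat> \<times> \<rat>. a \<le> p \<and> p < q \<and> q \<le> b \<and> q - p < \<delta>}"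
  have negN: "negligible (N p q)" if "(p, q) \<in> I" for p q
    unfolding N_def
  proof (rule differentiable_ae_of_bounded_variation)
    have pq: "a \<le> p" "p < q" "q \<le> b" "q - p < \<delta>" using that by (auto simp: I_def)
    then show "p \<le> q" by simp
    fix P assume P: "interval_family p q P"
    have "interval_family a b P"
      using P pq by (force simp: interval_family_def)
    moreover have "(\<Sum>(p, q)\<in>P. q - p) < \<delta>"
      using sum_increments_le[OF P \<open>p \<le> q\<close>, of "\<lambda>x. x"] pq by (auto simp: mono_on_def)
    ultimately show "(\<Sum>(p, q)\<in>P. \<bar>f q - f p\<bar>) \<le> 1" using \<delta>[of P] by simp
  qed
  have "countable I"
    using countable_SIGMA[OF countable_rat countable_rat]
    by (rule countable_subset[rotated]) (auto simp: I_def)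
  then have "negligible (\<Union>(p, q)\<in>I. N p q)"
    using negN by (intro negligible_countable_Union countable_image) auto
  moreover have "{x. a < x \<and> x < b \<and> \<not> f field_differentiable (at x)} \<subseteq> (\<Union>(p, q)\<in>I. N p q)"
  proof
    fix x assume "x \<in> {x. a < x \<and> x < b \<and> \<not> f field_differentiable (at x)}"
    then have x: "a < x" "x < b" "\<not> f field_differentiable (at x)" by auto
    obtain p where p: "p \<in> \<rat>" "max a (x - \<delta> / 2) < p" "p < x"
      using Rats_dense_in_real[of "max a (x - \<delta> / 2)" x] x \<open>0 < \<delta>\<close> by auto
    obtain q where q: "q \<in> \<rat>" "x < q" "q < min b (x + \<delta> / 2)"
      using Rats_dense_in_real[of x "min b (x + \<delta> / 2)"] x \<open>0 < \<delta>\<close> by auto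
    have "(p, q) \<in> I" "x \<in> N p q" using p q x by (auto simp: I_def N_def)
    then show "x \<in> (\<Union>(p, q)\<in>I. N p q)" by blast
  qed
  ultimately show ?thesis by (rule negligible_subset)
qed

text \<open>
  A gauge argument. Cells tagged outside the null set \<open>Z\<close> are controlled by the derivative, as in
  the classical proof. Cells tagged in \<open>Z\<close> are forced by the gauge into an open set \<open>U\<close> of measure less
  than \<open>\<delta>\<close>, so absolute continuity makes the sum of their increments small.
\<close>

lemma fundamental_theorem_of_calculus_abs_continuous:
  assumes ac: "abs_continuous_on {a..b} f" and "a \<le> b"
  shows "(deriv f has_integral f b - f a) {a..b}"
proof -
  define Z where "Z = {x. a < x \<and> x < b \<and> \<not> f field_differentiable (at x)} \<union> {a, b}"
  have Z: "negligible Z"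
    unfolding Z_def using differentiable_ae_of_abs_continuous[OF ac] by (intro negligible_Un) auto
  have der: "(f has_field_derivative deriv f x) (at x)" if "x \<in> {a..b} - Z" for x
    using that by (auto simp: Z_def DERIV_deriv_iff_field_differentiable)
  define g where "g x = (if x \<in> Z then 0 else deriv f x)" for x
  have "(g has_integral f b - f a) (cbox a b)"
    unfolding has_integral
  proof (intro allI impI)
    fix e :: real assume "0 < e"
    \<comment> \<open>The summand \<open>1\<close> keeps the denominator positive when \<open>a = b\<close>.\<close>
    define e' where "e' = e / (2 * (b - a + 1))"
    have "0 < e'" using \<open>0 < e\<close> \<open>a \<le> b\<close> by (simp add: e'_def)
    obtain \<delta> where "0 < \<delta>" and \<delta>: "\<And>P. interval_family a b P \<Longrightarrow> (\<Sum>(p, q)\<in>P. q - p) < \<delta>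
      \<Longrightarrow> (\<Sum>(p, q)\<in>P. \<bar>f q - f p\<bar>) < e / 2"
      using abs_continuous_on_interval_family[OF ac, of "e / 2"] \<open>0 < e\<close> by auto
    obtain U where U: "open U" "Z \<subseteq> U" "emeasure lebesgue (U - Z) < ennreal \<delta>"
      by (rule sets_lebesgue_outer_open[OF negligible_imp_sets[OF Z] \<open>0 < \<delta>\<close>]) (rule that)
    have emU: "emeasure lebesgue U < ennreal \<delta>"
      using U Z by (simp add: emeasure_Diff_null_set negligible_iff_null_sets borel_open)
    have "\<forall>x. \<exists>d. x \<in> {a..b} - Z \<longrightarrow> 0 < d \<and>
        (\<forall>y. norm (y - x) < d \<longrightarrow> norm (f y - f x - deriv f x * (y - x)) \<le> e' * norm (y - x))"
      using der \<open>0 < e'\<close> unfolding has_field_derivative_def has_derivative_at_alt by blast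
    from choice[OF this] obtain d where "\<forall>x. x \<in> {a..b} - Z \<longrightarrow> 0 < d x \<and>
        (\<forall>y. norm (y - x) < d x \<longrightarrow> norm (f y - f x - deriv f x * (y - x)) \<le> e' * norm (y - x))" ..
    then have d: "\<And>x. x \<in> {a..b} - Z \<Longrightarrow> 0 < d x"
      "\<And>x y. x \<in> {a..b} - Z \<Longrightarrow> norm (y - x) < d x
         \<Longrightarrow> norm (f y - f x - deriv f x * (y - x)) \<le> e' * norm (y - x)"
      by blast+
    define \<gamma> where "\<gamma> x = (if x \<in> Z then U else if x \<in> {a..b} then ball x (d x) else UNIV)" for x
    show "\<exists>\<gamma>. gauge \<gamma> \<and> (\<forall>\<D>. \<D> tagged_division_of cbox a b \<and> \<gamma> fine \<D> \<longrightarrow>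
        norm ((\<Sum>(x, k)\<in>\<D>. measure lborel k *\<^sub>R g x) - (f b - f a)) < e)"
    proof (intro exI conjI allI impI)
      show "gauge \<gamma>" using U d by (auto simp: gauge_def \<gamma>_def)
      fix \<D> assume "\<D> tagged_division_of cbox a b \<and> \<gamma> fine \<D>"
      then have tag: "\<D> tagged_division_of {a..b}" and fine: "\<gamma> fine \<D>" by auto
      have fin: "finite \<D>" using tagged_division_ofD(1)[OF tag] .
      have cell: "\<exists>u v. K = {u..v} \<and> u \<le> v \<and> a \<le> u \<and> v \<le> b \<and> Inf K = u \<and> Sup K = v \<and> x \<in> K \<and> K \<subseteq> \<gamma> x"
        if xK: "(x, K) \<in> \<D>" for x K
      proof -
        have "x \<in> K" "K \<subseteq> {a..b}"
          using tagged_division_ofD(2,3)[OF tag xK] by auto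
        moreover obtain u v where "K = cbox u v" using tagged_division_ofD(4)[OF tag xK] by auto
        ultimately show ?thesis using fine xK by (intro exI[of _ u] exI[of _ v]) (auto simp: fine_def)
      qed
      have tot: "f b - f a = (\<Sum>(x, K)\<in>\<D>. f (Sup K) - f (Inf K))"
        "b - a = (\<Sum>(x, K)\<in>\<D>. Sup K - Inf K)"
        using additive_tagged_division_1[OF \<open>a \<le> b\<close> tag, of f]
          additive_tagged_division_1[OF \<open>a \<le> b\<close> tag, of "\<lambda>x. x"] by auto
      \<comment> \<open>Degenerate cells are left out: they contribute nothing and would spoil injectivity of \<open>ends\<close>.\<close>
      define Q where "Q = {(x, K)\<in>\<D>. x \<in> Z \<and> Inf K < Sup K}"
      define ends where "ends = (\<lambda>(x :: real, K :: real set). (Inf K, Sup K))"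
      have QD: "Q \<subseteq> \<D>" by (auto simp: Q_def)
      have disj: "{Inf K<..<Sup K} \<inter> {Inf K'<..<Sup K'} = {}"
        if "(x, K) \<in> Q" "(x', K') \<in> Q" "(x, K) \<noteq> (x', K')" for x K x' K'
      proof -
        have "interior K \<inter> interior K' = {}"
          using tag that QD by (intro tagged_division_ofD(5)[OF tag]) auto
        moreover have "interior K = {Inf K<..<Sup K}" if "(x, K) \<in> Q" for x K
        proof -
          obtain u v where "K = {u..v}" "Inf K = u" "Sup K = v" using cell[of x K] \<open>(x, K) \<in> Q\<close> QD by blast
          then show ?thesis by (simp add: interior_atLeastAtMost_real)
        qed
        ultimately show ?thesis using that by blast
      qed
      have inj: "inj_on ends Q"
      proof (rule inj_onI, rule ccontr)
        fix I J assume IJ: "I \<in> Q" "J \<in> Q" "ends I = ends J" "I \<noteq> J"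
        obtain x K x' K' where "I = (x, K)" "J = (x', K')" by (cases I; cases J)
        then show False using disj[of x K x' K'] IJ by (auto simp: ends_def Q_def dense)
      qed
      have fam: "interval_family a b (ends ` Q)"
        unfolding interval_family_def
      proof (intro conjI)
        show "finite (ends ` Q)" using fin QD finite_subset by blast
        show "\<forall>(p, q)\<in>ends ` Q. a \<le> p \<and> p < q \<and> q \<le> b"
          using cell by (force simp: ends_def Q_def)
        show "disjoint_family_on (\<lambda>(p, q). {p<..<q}) (ends ` Q)"
          unfolding disjoint_family_on_def
        proof (intro ballI impI)
          fix m n assume "m \<in> ends ` Q" "n \<in> ends ` Q" "m \<noteq> n"
          then obtain I J where IJ: "I \<in> Q" "J \<in> Q" "m = ends I" "n = ends J" "I \<noteq> J" by blast
          obtain x K x' K' where "I = (x, K)" "J = (x', K')" by (cases I; cases J)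
          then show "(case m of (p, q) \<Rightarrow> {p<..<q}) \<inter> (case n of (p, q) \<Rightarrow> {p<..<q}) = {}"
            using disj[of x K x' K'] IJ by (auto simp: ends_def)
        qed
      qed
      have "ennreal (\<Sum>(p, q)\<in>ends ` Q. q - p) = (\<Sum>(p, q)\<in>ends ` Q. ennreal (q - p))"
        using interval_familyD(3)[OF fam]
        by (subst sum_ennreal[symmetric]) (auto simp: case_prod_unfold less_imp_le)
      also have "\<dots> = (\<Sum>I\<in>ends ` Q. emeasure lborel (case I of (p, q) \<Rightarrow> {p<..<q}))"
        using interval_familyD(3)[OF fam] by (intro sum.cong) (auto simp: less_imp_le)
      also have "\<dots> = emeasure lborel (\<Union>I\<in>ends ` Q. case I of (p, q) \<Rightarrow> {p<..<q})"
        using interval_familyD(1,5)[OF fam] by (intro sum_emeasure) auto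
      also have "\<dots> \<le> emeasure lborel U"
      proof (rule emeasure_mono)
        show "(\<Union>I\<in>ends ` Q. case I of (p, q) \<Rightarrow> {p<..<q}) \<subseteq> U"
        proof (rule UN_least)
          fix I assume "I \<in> ends ` Q"
          then obtain x K where "(x, K) \<in> Q" "I = (Inf K, Sup K)" by (auto simp: ends_def)
          then show "(case I of (p, q) \<Rightarrow> {p<..<q}) \<subseteq> U"
            using cell[of x K] by (auto simp: Q_def \<gamma>_def)
        qed
      qed (use U in auto)
      also have "\<dots> < ennreal \<delta>" using emU U by (simp add: borel_open)
      finally have "(\<Sum>(p, q)\<in>ends ` Q. q - p) < \<delta>"
        by (meson ennreal_leI leD leI)
      then have "(\<Sum>(p, q)\<in>ends ` Q. \<bar>f q - f p\<bar>) < e / 2" using \<delta>[OF fam] by blast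
      then have small: "(\<Sum>(x, K)\<in>Q. \<bar>f (Sup K) - f (Inf K)\<bar>) < e / 2"
        by (subst (asm) sum.reindex[OF inj]) (simp add: ends_def case_prod_unfold)
      have "norm ((\<Sum>(x, K)\<in>\<D>. measure lborel K *\<^sub>R g x) - (f b - f a))
          = norm (\<Sum>(x, K)\<in>\<D>. measure lborel K *\<^sub>R g x - (f (Sup K) - f (Inf K)))"
        unfolding tot by (simp add: sum_subtractf case_prod_unfold)
      also have "\<dots> \<le> (\<Sum>I\<in>\<D>. (case I of (x, K) \<Rightarrow> e' * (Sup K - Inf K))
           + (if I \<in> Q then (case I of (x, K) \<Rightarrow> \<bar>f (Sup K) - f (Inf K)\<bar>) else 0))"
      proof (rule sum_norm_le)
        fix I assume "I \<in> \<D>"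
        moreover obtain x K where I: "I = (x, K)" by (cases I)
        ultimately obtain u v where uv: "K = {u..v}" "u \<le> v" "a \<le> u" "v \<le> b" "Inf K = u" "Sup K = v"
          "x \<in> K" "K \<subseteq> \<gamma> x" using cell by blast
        have "norm (measure lborel K *\<^sub>R g x - (f v - f u))
            \<le> e' * (v - u) + (if I \<in> Q then \<bar>f v - f u\<bar> else 0)"
        proof (cases "x \<in> Z")
          case True
          have "0 \<le> e' * (v - u)" using uv \<open>0 < e'\<close> by simp
          then show ?thesis using True uv \<open>I \<in> \<D>\<close> I by (cases "u = v") (auto simp: g_def Q_def)
        next
          case False
          then have x: "x \<in> {a..b} - Z" using uv by auto
          have ball: "y \<in> K \<Longrightarrow> norm (y - x) < d x" for y
            using uv x by (auto simp: \<gamma>_def dist_real_def)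
          have "norm (f u - f x - deriv f x * (u - x)) \<le> e' * norm (u - x)"
               "norm (f v - f x - deriv f x * (v - x)) \<le> e' * norm (v - x)"
            using d(2)[OF x ball, of u] d(2)[OF x ball, of v] uv(1,2) by (simp_all only: atLeastAtMost_iff order_refl simp_thms)
          moreover have "e' * norm (u - x) + e' * norm (v - x) = e' * (v - u)"
            using uv by (auto simp: algebra_simps)
          moreover have "(v - u) * deriv f x - (f v - f u)
              = (f u - f x - deriv f x * (u - x)) - (f v - f x - deriv f x * (v - x))"
            by (simp add: algebra_simps)
          ultimately have "norm ((v - u) * deriv f x - (f v - f u)) \<le> e' * (v - u)"
            by (smt (verit) real_norm_def)
          then show ?thesis using False uv by (auto simp: g_def Q_def I)
        qed
        then show "norm (case I of (x, K) \<Rightarrow> measure lborel K *\<^sub>R g x - (f (Sup K) - f (Inf K)))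
          \<le> (case I of (x, K) \<Rightarrow> e' * (Sup K - Inf K))
           + (if I \<in> Q then (case I of (x, K) \<Rightarrow> \<bar>f (Sup K) - f (Inf K)\<bar>) else 0)"
          using I uv by (simp split: if_splits)
      qed
      also have "\<dots> = e' * (b - a) + (\<Sum>(x, K)\<in>Q. \<bar>f (Sup K) - f (Inf K)\<bar>)"
        using fin QD
        by (simp add: sum.distrib tot(2) sum_distrib_left case_prod_unfold sum.If_cases Int_absorb1)
      also have "\<dots> < e / 2 + e / 2"
      proof (rule add_le_less_mono)
        have "e' * (b - a) = (e / 2) * ((b - a) / (b - a + 1))" by (simp add: e'_def)
        also have "\<dots> \<le> (e / 2) * 1"
          using \<open>a \<le> b\<close> \<open>0 < e\<close> by (intro mult_left_mono) (auto simp: field_simps)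
        finally show "e' * (b - a) \<le> e / 2" by simp
      qed (fact small)
      finally show "norm ((\<Sum>(x, K)\<in>\<D>. measure lborel K *\<^sub>R g x) - (f b - f a)) < e" by simp
    qed
  qed
  then have "(g has_integral f b - f a) {a..b}" by simp
  then show ?thesis
    by (rule has_integral_spike[OF Z, rotated]) (auto simp: g_def)
qed

text \<open>
  The form in which the fundamental theorem is used: an inequality of extended nonnegative
  integrals, true also when \<open>deriv f\<close> is not known to be integrable.
\<close>

lemma abs_continuous_increment_le:
  assumes ac: "abs_continuous_on {a..b} f" and st: "s \<in> {a..b}" "t \<in> {a..b}"
    and meas: "(\<lambda>x. indicator {a..b} x * \<bar>deriv f x\<bar>) \<in> borel_measurable borel"
  shows "ennreal \<bar>f t - f s\<bar> \<le> (\<integral>\<^sup>+x. indicator {a..b} x * ennreal \<bar>deriv f x\<bar> \<partial>lborel)"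
proof -
  define h where "h x = indicator {a..b} x * \<bar>deriv f x\<bar>" for x
  have eq: "indicator {a..b} x * ennreal \<bar>deriv f x\<bar> = ennreal (h x)" for x
    by (auto simp: h_def indicator_def)
  define J where "J = {min s t..max s t}"
  have J: "J \<subseteq> {a..b}" using st by (auto simp: J_def)
  have "(deriv f has_integral f (max s t) - f (min s t)) J"
    unfolding J_def using J
    by (intro fundamental_theorem_of_calculus_abs_continuous abs_continuous_on_subset[OF ac]) (auto simp: J_def)
  then have int: "deriv f integrable_on J" "\<bar>f t - f s\<bar> = norm (integral J (deriv f))"
    by (auto simp: integral_unique max_def min_def abs_minus_commute)
  show ?thesis
  proof (cases "(\<integral>\<^sup>+x. ennreal (h x) \<partial>lborel) = \<infinity>")
    case False
    then obtain r where r: "(\<integral>\<^sup>+x. ennreal (h x) \<partial>lborel) = ennreal r" "0 \<le> r"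
      by (metis ennreal_cases infinity_ennreal_def)
    have "h \<in> borel_measurable borel" using meas by (simp add: h_def[abs_def])
    then have "(h has_integral r) UNIV"
      using r by (intro nn_integral_has_integral) (auto simp: h_def)
    then have h: "h integrable_on J" "integral J h \<le> r"
    proof -
      assume hr: "(h has_integral r) UNIV"
      have abs: "h absolutely_integrable_on UNIV"
        using hr by (intro nonnegative_absolutely_integrable_1) (auto simp: h_def integrable_on_def)
      then have "h absolutely_integrable_on J"
        by (rule set_integrable_subset) (auto simp: J_def)
      then show i: "h integrable_on J" by (rule set_lebesgue_integral_eq_integral)
      show "integral J h \<le> r"
        using integral_subset_le[of J UNIV h] i hr by (auto simp: h_def integral_unique integrable_on_def)
    qed
    have "\<bar>f t - f s\<bar> \<le> integral J h"
      unfolding int(2) using int(1) h(1) J by (intro integral_norm_bound_integral) (auto simp: h_def)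
    then show ?thesis unfolding eq r using h(2) by (simp add: ennreal_leI)
  next
    case True
    then show ?thesis unfolding eq by simp
  qed
qed

section \<open>Integration over lines parallel to an axis\<close>

text \<open>
  The parametrisation of lines that occurs in \<open>ACL\<close>.
\<close>

definition line_point :: "'a::euclidean_space \<Rightarrow> ('a \<Rightarrow> real) \<Rightarrow> real \<Rightarrow> 'a" where
  "line_point i y t = t *\<^sub>R i + (\<Sum>j\<in>Basis - {i}. y j *\<^sub>R j)"

lemma line_point_inner:
  assumes "i \<in> Basis" "j \<in> Basis"
  shows "line_point i y t \<bullet> j = (if j = i then t else y j)"
proof -
  have "(\<Sum>k\<in>Basis - {i}. y k *\<^sub>R k) \<bullet> j = (\<Sum>k\<in>Basis - {i}. if k = j then y k else 0)"
    unfolding inner_sum_left using assms by (intro sum.cong) (auto simp: inner_Basis)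
  also have "\<dots> = (if j = i then 0 else y j)" using assms by (simp add: sum.delta)
  finally show ?thesis using assms by (simp add: line_point_def inner_add_left inner_Basis)
qed

lemma measurable_line_point [measurable]: "line_point i y \<in> borel_measurable borel"
  unfolding line_point_def by measurable

lemma line_point_eq_sum:
  assumes "i \<in> Basis"
  shows "(\<Sum>b\<in>Basis. (y(i := t)) b *\<^sub>R b) = line_point i y t"
proof -
  have "(\<Sum>b\<in>Basis. (y(i := t)) b *\<^sub>R b)
      = (y(i := t)) i *\<^sub>R i + (\<Sum>b\<in>Basis - {i}. (y(i := t)) b *\<^sub>R b)"
    using assms by (intro sum.remove) auto
  also have "(\<Sum>b\<in>Basis - {i}. (y(i := t)) b *\<^sub>R b) = (\<Sum>b\<in>Basis - {i}. y b *\<^sub>R b)"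
    by (intro sum.cong) auto
  finally show ?thesis by (simp add: line_point_def)
qed

lemma nn_integral_lborel_lines:
  fixes f :: "'a::euclidean_space \<Rightarrow> ennreal"
  assumes i: "i \<in> Basis" and f [measurable]: "f \<in> borel_measurable borel"
  shows "(\<integral>\<^sup>+x. f x \<partial>lborel)
       = (\<integral>\<^sup>+y. (\<integral>\<^sup>+t. f (line_point i y t) \<partial>lborel) \<partial>Pi\<^sub>M (Basis - {i}) (\<lambda>_. lborel))"
proof -
  interpret product_sigma_finite "\<lambda>_. lborel :: real measure" by standard
  have ins: "insert i (Basis - {i}) = (Basis :: 'a set)" using i by auto
  have m: "(\<lambda>z. f (\<Sum>b\<in>Basis. z b *\<^sub>R b)) \<in> borel_measurable (Pi\<^sub>M Basis (\<lambda>_. lborel))"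
    by measurable
  have "(\<integral>\<^sup>+x. f x \<partial>lborel)
      = (\<integral>\<^sup>+z. f (\<Sum>b\<in>Basis. z b *\<^sub>R b) \<partial>Pi\<^sub>M Basis (\<lambda>_. lborel))"
    by (subst lborel_eq) (simp add: nn_integral_distr)
  also have "\<dots> = (\<integral>\<^sup>+z. f (\<Sum>b\<in>Basis. z b *\<^sub>R b) \<partial>Pi\<^sub>M (insert i (Basis - {i})) (\<lambda>_. lborel))"
    unfolding ins ..
  also have "\<dots> = (\<integral>\<^sup>+y. (\<integral>\<^sup>+t. f (\<Sum>b\<in>Basis. (y(i := t)) b *\<^sub>R b) \<partial>lborel) \<partial>Pi\<^sub>M (Basis - {i}) (\<lambda>_. lborel))"
    using m by (subst product_nn_integral_insert) (auto simp: ins)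
  also have "\<dots> = (\<integral>\<^sup>+y. (\<integral>\<^sup>+t. f (line_point i y t) \<partial>lborel) \<partial>Pi\<^sub>M (Basis - {i}) (\<lambda>_. lborel))"
    unfolding line_point_eq_sum[OF i] ..
  finally show ?thesis .
qed

text \<open>
  This holds also at points without derivative: both sides choose a number satisfying the same predicate.
\<close>

lemma deriv_line_point:
  "deriv (\<lambda>t. u (line_point i y t)) t = partial_deriv i u (line_point i y t)"
proof -
  have "u (line_point i y t + s *\<^sub>R i) = u (line_point i y (s + t))" for s
    by (simp add: line_point_def algebra_simps)
  then have "DERIV (\<lambda>s. u (line_point i y t + s *\<^sub>R i)) 0 :> D \<longleftrightarrow> DERIV (\<lambda>t. u (line_point i y t)) t :> D" for D
    using DERIV_shift[of "\<lambda>t. u (line_point i y t)" D 0 t] by simp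
  then show ?thesis unfolding partial_deriv_def deriv_def by presburger
qed

lemma interval_average_le:
  fixes f :: "real \<Rightarrow> ennreal"
  assumes [measurable]: "f \<in> borel_measurable borel" and "p \<le> q" "p' \<le> q'"
    and le: "\<And>t s. t \<in> {p..q} \<Longrightarrow> s \<in> {p'..q'} \<Longrightarrow> f t \<le> f s + V"
  shows "ennreal (q' - p') * (\<integral>\<^sup>+t. indicator {p..q} t * f t \<partial>lborel)
     \<le> ennreal (q - p) * (\<integral>\<^sup>+s. indicator {p'..q'} s * f s \<partial>lborel) + ennreal ((q - p) * (q' - p')) * V"
proof -
  let ?A = "\<integral>\<^sup>+t. indicator {p..q} t * f t \<partial>lborel"
  have A: "?A \<le> ennreal (q - p) * (f s + V)" if "s \<in> {p'..q'}" for s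
  proof -
    have "?A \<le> (\<integral>\<^sup>+t. (f s + V) * indicator {p..q} t \<partial>lborel)"
      using le[OF _ that] by (intro nn_integral_mono) (auto simp: indicator_def)
    also have "\<dots> = ennreal (q - p) * (f s + V)"
      using \<open>p \<le> q\<close> by (subst nn_integral_cmult_indicator) (auto simp: mult.commute)
    finally show ?thesis .
  qed
  have "ennreal (q' - p') * ?A = (\<integral>\<^sup>+s. ?A * indicator {p'..q'} s \<partial>lborel)"
    using \<open>p' \<le> q'\<close> by (subst nn_integral_cmult_indicator) (auto simp: mult.commute)
  also have "\<dots> \<le> (\<integral>\<^sup>+s. ennreal (q - p) * (indicator {p'..q'} s * f s) + (ennreal (q - p) * V) * indicator {p'..q'} s \<partial>lborel)"
    using A by (intro nn_integral_mono) (auto simp: indicator_def distrib_left)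
  also have "\<dots> = ennreal (q - p) * (\<integral>\<^sup>+s. indicator {p'..q'} s * f s \<partial>lborel) + (ennreal (q - p) * V) * ennreal (q' - p')"
    using \<open>p' \<le> q'\<close> by (simp add: nn_integral_add nn_integral_cmult nn_integral_cmult_indicator)
  also have "(ennreal (q - p) * V) * ennreal (q' - p') = ennreal ((q - p) * (q' - p')) * V"
    using assms by (simp add: ennreal_mult mult_ac)
  finally show ?thesis .
qed

text \<open>
  Two boxes that differ in one coordinate only are made of segments on the same lines. On almost every line, the
  values of \<open>u\<close> at two points differ by at most the integral of its derivative along the line.
  The inequality is one-sided and multiplied through by the side lengths, which avoids subtraction and division of
  extended real numbers.
\<close>

lemma box_integral_change_coordinate:
  fixes u :: "'a::euclidean_space \<Rightarrow> real"
  assumes "ACL u" and nonneg: "\<And>x. 0 \<le> u x" and i: "i \<in> Basis"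
    and meas: "(\<lambda>x. \<bar>partial_deriv i u x\<bar>) \<in> borel_measurable borel"
    and ab: "\<And>j. j \<in> Basis \<Longrightarrow> j \<noteq> i \<Longrightarrow> a \<bullet> j = a' \<bullet> j \<and> b \<bullet> j = b' \<bullet> j"
    and pq: "a \<bullet> i \<le> b \<bullet> i" "a' \<bullet> i \<le> b' \<bullet> i"
    and sub: "\<And>j. j \<in> Basis \<Longrightarrow> A \<bullet> j \<le> a \<bullet> j \<and> A \<bullet> j \<le> a' \<bullet> j \<and> b \<bullet> j \<le> B \<bullet> j \<and> b' \<bullet> j \<le> B \<bullet> j"
  shows "ennreal (b' \<bullet> i - a' \<bullet> i) * (\<integral>\<^sup>+x. indicator (cbox a b) x * ennreal (u x) \<partial>lborel)
     \<le> ennreal (b \<bullet> i - a \<bullet> i) * (\<integral>\<^sup>+x. indicator (cbox a' b') x * ennreal (u x) \<partial>lborel)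
       + ennreal ((b \<bullet> i - a \<bullet> i) * (b' \<bullet> i - a' \<bullet> i)) *
         (\<integral>\<^sup>+x. indicator (cbox A B) x * ennreal \<bar>partial_deriv i u x\<bar> \<partial>lborel)"
proof -
  let ?M = "Pi\<^sub>M (Basis - {i}) (\<lambda>_. lborel) :: ('a \<Rightarrow> real) measure"
  have cont: "continuous_on UNIV u" using \<open>ACL u\<close> by (simp add: ACL_def)
  have u [measurable]: "u \<in> borel_measurable borel"
    using cont by (rule borel_measurable_continuous_onI)
  note meas [measurable]
  have lp: "case_prod (\<lambda>y t. line_point i y t) \<in> borel_measurable (?M \<Otimes>\<^sub>M lborel)"
    unfolding line_point_def by measurable
  have slice_meas [measurable]: "(\<lambda>y. \<integral>\<^sup>+t. g (line_point i y t) \<partial>lborel) \<in> borel_measurable ?M"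
    if [measurable]: "g \<in> borel_measurable borel" for g :: "'a \<Rightarrow> ennreal"
  proof -
    have "(\<lambda>z. g (case_prod (\<lambda>y t. line_point i y t) z)) \<in> borel_measurable (?M \<Otimes>\<^sub>M lborel)"
      using lp by measurable
    then show ?thesis
      by (intro lborel.borel_measurable_nn_integral) (simp add: case_prod_unfold)
  qed
  define Y where "Y = {y. \<forall>j\<in>Basis - {i}. a \<bullet> j \<le> y j \<and> y j \<le> b \<bullet> j}"
  have ind: "indicator (cbox a b) (line_point i y t) = (indicator Y y * indicator {a \<bullet> i..b \<bullet> i} t :: ennreal)" for y t
    using i by (auto simp: indicator_def cbox_def line_point_inner Y_def)
  have ind': "indicator (cbox a' b') (line_point i y t) = (indicator Y y * indicator {a' \<bullet> i..b' \<bullet> i} t :: ennreal)" for y t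
    using i ab by (auto simp: indicator_def cbox_def line_point_inner Y_def)
  have indAB: "line_point i y t \<in> cbox A B \<longleftrightarrow> t \<in> {A \<bullet> i..B \<bullet> i}" if "y \<in> Y" for y t
    using i sub that by (force simp: cbox_def line_point_inner Y_def)
  have ae: "AE y in ?M. (\<forall>j\<in>Basis - {i}. y j \<in> {A \<bullet> j..B \<bullet> j}) \<longrightarrow>
      abs_continuous_on {A \<bullet> i..B \<bullet> i} (\<lambda>t. u (line_point i y t))"
    using \<open>ACL u\<close> i unfolding ACL_def line_point_def by blast
  define F where "F y = (\<integral>\<^sup>+t. indicator (cbox a b) (line_point i y t) * ennreal (u (line_point i y t)) \<partial>lborel)" for y
  define F' where "F' y = (\<integral>\<^sup>+t. indicator (cbox a' b') (line_point i y t) * ennreal (u (line_point i y t)) \<partial>lborel)" for y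
  define W where "W y = (\<integral>\<^sup>+t. indicator (cbox A B) (line_point i y t) * ennreal \<bar>partial_deriv i u (line_point i y t)\<bar> \<partial>lborel)" for y
  let ?L = "b \<bullet> i - a \<bullet> i" and ?L' = "b' \<bullet> i - a' \<bullet> i"
  have "AE y in ?M. ennreal ?L' * F y \<le> ennreal ?L * F' y + ennreal (?L * ?L') * W y"
    using ae
  proof eventually_elim
    case (elim y)
    show ?case
    proof (cases "y \<in> Y")
      case False
      then show ?thesis by (simp add: F_def ind)
    next
      case True
      have "\<forall>j\<in>Basis - {i}. y j \<in> {A \<bullet> j..B \<bullet> j}"
        using True sub by (force simp: Y_def)
      then have ac: "abs_continuous_on {A \<bullet> i..B \<bullet> i} (\<lambda>t. u (line_point i y t))" using elim by blast
      have mder: "(\<lambda>t. indicator {A \<bullet> i..B \<bullet> i} t * \<bar>deriv (\<lambda>t. u (line_point i y t)) t\<bar>) \<in> borel_measurable borel"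
        unfolding deriv_line_point by measurable
      have W: "W y = (\<integral>\<^sup>+t. indicator {A \<bullet> i..B \<bullet> i} t * ennreal \<bar>deriv (\<lambda>t. u (line_point i y t)) t\<bar> \<partial>lborel)"
        unfolding W_def deriv_line_point using indAB[OF True] by (simp add: indicator_def)
      have le: "ennreal (u (line_point i y t)) \<le> ennreal (u (line_point i y s)) + W y"
        if "t \<in> {a \<bullet> i..b \<bullet> i}" "s \<in> {a' \<bullet> i..b' \<bullet> i}" for t s
      proof -
        have "ennreal (u (line_point i y t))
            \<le> ennreal (u (line_point i y s) + \<bar>u (line_point i y t) - u (line_point i y s)\<bar>)"
          by (intro ennreal_leI) auto
        also have "\<dots> = ennreal (u (line_point i y s)) + ennreal \<bar>u (line_point i y t) - u (line_point i y s)\<bar>"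
          using nonneg by (simp add: ennreal_plus)
        also have "\<dots> \<le> ennreal (u (line_point i y s)) + W y"
          unfolding W using that sub[OF i]
          by (intro add_left_mono abs_continuous_increment_le[OF ac _ _ mder]) auto
        finally show ?thesis .
      qed
      have FF: "F y = (\<integral>\<^sup>+t. indicator {a \<bullet> i..b \<bullet> i} t * ennreal (u (line_point i y t)) \<partial>lborel)"
        "F' y = (\<integral>\<^sup>+t. indicator {a' \<bullet> i..b' \<bullet> i} t * ennreal (u (line_point i y t)) \<partial>lborel)"
        using True by (simp_all add: F_def F'_def ind ind')
      show ?thesis
        unfolding FF by (rule interval_average_le) (use pq le in auto)
    qed
  qed
  then have "(\<integral>\<^sup>+y. ennreal ?L' * F y \<partial>?M) \<le> (\<integral>\<^sup>+y. ennreal ?L * F' y + ennreal (?L * ?L') * W y \<partial>?M)"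
    by (rule nn_integral_mono_AE)
  moreover have "F \<in> borel_measurable ?M" "F' \<in> borel_measurable ?M" "W \<in> borel_measurable ?M"
    unfolding F_def F'_def W_def by (intro slice_meas; measurable)+
  ultimately have "ennreal ?L' * (\<integral>\<^sup>+y. F y \<partial>?M)
      \<le> ennreal ?L * (\<integral>\<^sup>+y. F' y \<partial>?M) + ennreal (?L * ?L') * (\<integral>\<^sup>+y. W y \<partial>?M)"
    by (simp add: nn_integral_cmult nn_integral_add)
  then show ?thesis
    unfolding F_def F'_def W_def by (simp add: nn_integral_lborel_lines[OF i])
qed

section \<open>The Poincare inequality on cubes\<close>

text \<open>
  The properties of an admissible function of finite energy, apart from those of its support.
\<close>

locale finite_energy =
  fixes u :: "'a::euclidean_space \<Rightarrow> real"
  assumes ACL: "ACL u" and nonneg: "\<And>x. 0 \<le> u x"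
    and measurable_partial_deriv: "\<And>i. i \<in> Basis \<Longrightarrow> (\<lambda>x. \<bar>partial_deriv i u x\<bar>) \<in> borel_measurable borel"
    and finite_total: "(\<integral>\<^sup>+x. ennreal (norm (grad u x) ^ DIM('a)) \<partial>lborel) < \<infinity>"
begin

definition energy :: "'a set \<Rightarrow> real" where
  "energy A = enn2real (\<integral>\<^sup>+x. indicator A x * ennreal (norm (grad u x) ^ DIM('a)) \<partial>lborel)"

definition box_mean :: "'a \<Rightarrow> 'a \<Rightarrow> real" where
  "box_mean a b = enn2real (\<integral>\<^sup>+x. indicator (cbox a b) x * ennreal (u x) \<partial>lborel)
     / (\<Prod>j\<in>Basis. b \<bullet> j - a \<bullet> j)"

definition partial_deriv_integral :: "'a \<Rightarrow> 'a \<Rightarrow> 'a \<Rightarrow> real" where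
  "partial_deriv_integral A B i = enn2real (\<integral>\<^sup>+x. indicator (cbox A B) x * ennreal \<bar>partial_deriv i u x\<bar> \<partial>lborel)"

lemma continuous: "continuous_on UNIV u"
  using ACL by (simp add: ACL_def)

lemma measurable_u [measurable]: "u \<in> borel_measurable borel"
  using continuous by (rule borel_measurable_continuous_onI)

lemma grad_inner: "i \<in> Basis \<Longrightarrow> grad u x \<bullet> i = partial_deriv i u x"
  unfolding grad_def by (simp add: inner_sum_left inner_Basis if_distrib sum.delta cong: if_cong)

lemma partial_deriv_le_grad: "i \<in> Basis \<Longrightarrow> \<bar>partial_deriv i u x\<bar> \<le> norm (grad u x)"
  using Basis_le_norm[of i "grad u x"] by (simp add: grad_inner)

lemma measurable_norm_grad [measurable]: "(\<lambda>x. norm (grad u x)) \<in> borel_measurable borel"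
proof -
  have "norm (grad u x) = sqrt (\<Sum>i\<in>Basis. \<bar>partial_deriv i u x\<bar>\<^sup>2)" for x
    unfolding norm_eq_sqrt_inner
    by (subst euclidean_inner) (auto intro!: sum.cong simp: grad_inner power2_eq_square)
  moreover have [measurable]: "(\<lambda>x. \<Sum>i\<in>Basis. \<bar>partial_deriv i u x\<bar>\<^sup>2) \<in> borel_measurable borel"
    using measurable_partial_deriv by (intro borel_measurable_sum borel_measurable_power) auto
  moreover have "(\<lambda>x. sqrt (\<Sum>i\<in>Basis. \<bar>partial_deriv i u x\<bar>\<^sup>2)) \<in> borel_measurable borel"
    by measurable
  ultimately show ?thesis by simp
qed

lemma energy_nonneg: "0 \<le> energy A"
  by (simp add: energy_def)

lemma ennreal_energy:
  "ennreal (energy A) = (\<integral>\<^sup>+x. indicator A x * ennreal (norm (grad u x) ^ DIM('a)) \<partial>lborel)"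
proof -
  have "(\<integral>\<^sup>+x. indicator A x * ennreal (norm (grad u x) ^ DIM('a)) \<partial>lborel)
      \<le> (\<integral>\<^sup>+x. ennreal (norm (grad u x) ^ DIM('a)) \<partial>lborel)"
    by (intro nn_integral_mono) (auto simp: indicator_def)
  then show ?thesis unfolding energy_def using finite_total by (simp add: less_top order_le_less_trans)
qed

lemma energy_mono: "A \<subseteq> B \<Longrightarrow> energy A \<le> energy B"
proof -
  assume "A \<subseteq> B"
  then have "ennreal (energy A) \<le> ennreal (energy B)"
    unfolding ennreal_energy by (intro nn_integral_mono) (auto simp: indicator_def)
  then show ?thesis using energy_nonneg by (simp add: ennreal_le_iff)
qed

lemma energy_disjoint:
  assumes "A \<inter> B = {}" "A \<subseteq> C" "B \<subseteq> C" and [measurable]: "A \<in> sets borel" "B \<in> sets borel"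
  shows "energy A + energy B \<le> energy C"
proof -
  have "ennreal (energy A + energy B) = ennreal (energy A) + ennreal (energy B)"
    using energy_nonneg by (simp add: ennreal_plus)
  also have "\<dots> = (\<integral>\<^sup>+x. indicator A x * ennreal (norm (grad u x) ^ DIM('a))
      + indicator B x * ennreal (norm (grad u x) ^ DIM('a)) \<partial>lborel)"
    unfolding ennreal_energy by (subst nn_integral_add) auto
  also have "\<dots> \<le> ennreal (energy C)"
    unfolding ennreal_energy using assms(1-3) by (intro nn_integral_mono) (auto simp: indicator_def)
  finally show ?thesis using energy_nonneg by (subst (asm) ennreal_le_iff) auto
qed

text \<open>
  In place of the inequality of Hoelder: \<open>g \<le> \<tau> + g\<^bsup>n\<^esup> / \<tau>\<^bsup>n-1\<^esup>\<close> for every \<open>\<tau> > 0\<close>, since one of the two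
  terms already dominates \<open>g\<close>. Keeping \<open>\<tau>\<close> free makes roots of the energy unnecessary.
\<close>

lemma partial_deriv_integral_le:
  assumes i: "i \<in> Basis" and "0 < \<tau>" and AB: "\<And>j. j \<in> Basis \<Longrightarrow> A \<bullet> j \<le> B \<bullet> j"
  shows "(\<integral>\<^sup>+x. indicator (cbox A B) x * ennreal \<bar>partial_deriv i u x\<bar> \<partial>lborel)
     \<le> ennreal (\<tau> * (\<Prod>j\<in>Basis. B \<bullet> j - A \<bullet> j) + energy (cbox A B) / \<tau> ^ (DIM('a) - 1))"
proof -
  define n where "n = DIM('a)"
  have n: "n = Suc (n - 1)" unfolding n_def by simp
  have young: "\<bar>w\<bar> \<le> \<tau> + g ^ n / \<tau> ^ (n - 1)" if "\<bar>w\<bar> \<le> g" for w g :: real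
  proof (cases "g \<le> \<tau>")
    case True
    then show ?thesis using that \<open>0 < \<tau>\<close> by (simp add: add_increasing2)
  next
    case False
    have "g * \<tau> ^ (n - 1) \<le> g * g ^ (n - 1)"
      using False \<open>0 < \<tau>\<close> by (intro mult_left_mono power_mono) auto
    also have "\<dots> = g ^ n" by (subst n) simp
    finally have "g \<le> g ^ n / \<tau> ^ (n - 1)" using \<open>0 < \<tau>\<close> by (simp add: pos_le_divide_eq)
    then show ?thesis using that \<open>0 < \<tau>\<close> by simp
  qed
  have "(\<integral>\<^sup>+x. indicator (cbox A B) x * ennreal \<bar>partial_deriv i u x\<bar> \<partial>lborel)
     \<le> (\<integral>\<^sup>+x. ennreal \<tau> * indicator (cbox A B) x
          + ennreal (1 / \<tau> ^ (n - 1)) * (indicator (cbox A B) x * ennreal (norm (grad u x) ^ n)) \<partial>lborel)"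
  proof (rule nn_integral_mono)
    fix x
    have "ennreal \<bar>partial_deriv i u x\<bar> \<le> ennreal (\<tau> + norm (grad u x) ^ n / \<tau> ^ (n - 1))"
      by (intro ennreal_leI young partial_deriv_le_grad i)
    also have "\<dots> = ennreal \<tau> + ennreal (1 / \<tau> ^ (n - 1)) * ennreal (norm (grad u x) ^ n)"
      using \<open>0 < \<tau>\<close> by (simp add: ennreal_plus ennreal_mult' [symmetric])
    finally show "indicator (cbox A B) x * ennreal \<bar>partial_deriv i u x\<bar>
      \<le> ennreal \<tau> * indicator (cbox A B) x
          + ennreal (1 / \<tau> ^ (n - 1)) * (indicator (cbox A B) x * ennreal (norm (grad u x) ^ n))"
      by (simp add: indicator_def)
  qed
  also have "\<dots> = ennreal \<tau> * emeasure lborel (cbox A B) + ennreal (1 / \<tau> ^ (n - 1)) * ennreal (energy (cbox A B))"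
    unfolding ennreal_energy n_def by (subst nn_integral_add) (auto simp: nn_integral_cmult)
  also have "emeasure lborel (cbox A B) = ennreal (\<Prod>j\<in>Basis. B \<bullet> j - A \<bullet> j)"
    using AB by (simp add: emeasure_lborel_cbox inner_diff_left)
  also have "ennreal \<tau> * ennreal (\<Prod>j\<in>Basis. B \<bullet> j - A \<bullet> j) + ennreal (1 / \<tau> ^ (n - 1)) * ennreal (energy (cbox A B))
      = ennreal (\<tau> * (\<Prod>j\<in>Basis. B \<bullet> j - A \<bullet> j) + energy (cbox A B) / \<tau> ^ (n - 1))"
    using \<open>0 < \<tau>\<close> AB energy_nonneg
    by (simp add: ennreal_plus ennreal_mult'[symmetric] prod_nonneg)
  finally show ?thesis unfolding n_def .
qed

lemma ennreal_partial_deriv_integral: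
  assumes "i \<in> Basis" and AB: "\<And>j. j \<in> Basis \<Longrightarrow> A \<bullet> j \<le> B \<bullet> j"
  shows "ennreal (partial_deriv_integral A B i) = (\<integral>\<^sup>+x. indicator (cbox A B) x * ennreal \<bar>partial_deriv i u x\<bar> \<partial>lborel)"
  unfolding partial_deriv_integral_def using partial_deriv_integral_le[OF assms(1) zero_less_one AB]
  by (simp add: less_top le_less_trans[OF _ ennreal_less_top])

lemma ennreal_box_integral:
  "ennreal (enn2real (\<integral>\<^sup>+x. indicator (cbox a b) x * ennreal (u x) \<partial>lborel))
     = (\<integral>\<^sup>+x. indicator (cbox a b) x * ennreal (u x) \<partial>lborel)"
proof -
  have "compact (u ` cbox a b)"
    using continuous by (intro compact_continuous_image) (auto intro: continuous_on_subset)
  then obtain M where M: "\<And>x. x \<in> cbox a b \<Longrightarrow> u x \<le> M"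
    using compact_imp_bounded bounded_real by (metis abs_le_D1 imageI)
  have "(\<integral>\<^sup>+x. indicator (cbox a b) x * ennreal (u x) \<partial>lborel) \<le> (\<integral>\<^sup>+x. ennreal M * indicator (cbox a b) x \<partial>lborel)"
    using M by (intro nn_integral_mono) (auto simp: indicator_def intro: ennreal_leI)
  also have "\<dots> = ennreal M * emeasure lborel (cbox a b)"
    by (simp add: nn_integral_cmult_indicator)
  also have "\<dots> < \<infinity>"
    using emeasure_lborel_cbox_finite[of a b] by (simp add: ennreal_mult_less_top)
  finally show ?thesis by simp
qed

lemma box_mean_change_coordinate:
  assumes i: "i \<in> Basis" and "0 < \<sigma>"
    and ab: "\<And>j. j \<in> Basis \<Longrightarrow> j \<noteq> i \<Longrightarrow> a \<bullet> j = a' \<bullet> j \<and> b \<bullet> j = b' \<bullet> j"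
    and side: "\<And>j. j \<in> Basis \<Longrightarrow> \<sigma> \<le> b \<bullet> j - a \<bullet> j \<and> \<sigma> \<le> b' \<bullet> j - a' \<bullet> j"
    and sub: "\<And>j. j \<in> Basis \<Longrightarrow> A \<bullet> j \<le> a \<bullet> j \<and> A \<bullet> j \<le> a' \<bullet> j \<and> b \<bullet> j \<le> B \<bullet> j \<and> b' \<bullet> j \<le> B \<bullet> j"
  shows "box_mean a b \<le> box_mean a' b' + partial_deriv_integral A B i / \<sigma> ^ (DIM('a) - 1)"
proof -
  define L where "L = b \<bullet> i - a \<bullet> i"
  define L' where "L' = b' \<bullet> i - a' \<bullet> i"
  define P where "P = (\<Prod>j\<in>Basis - {i}. b \<bullet> j - a \<bullet> j)"
  define X where "X = enn2real (\<integral>\<^sup>+x. indicator (cbox a b) x * ennreal (u x) \<partial>lborel)"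
  define X' where "X' = enn2real (\<integral>\<^sup>+x. indicator (cbox a' b') x * ennreal (u x) \<partial>lborel)"
  define D where "D = partial_deriv_integral A B i"
  have L: "0 < L" "0 < L'" using side[OF i] \<open>0 < \<sigma>\<close> by (auto simp: L_def L'_def)
  have AB: "A \<bullet> j \<le> B \<bullet> j" if "j \<in> Basis" for j using sub[OF that] side[OF that] \<open>0 < \<sigma>\<close> by auto
  have D: "0 \<le> D" by (simp add: D_def partial_deriv_integral_def)
  have X: "0 \<le> X" "0 \<le> X'" by (auto simp: X_def X'_def)
  have osc: "ennreal D = (\<integral>\<^sup>+x. indicator (cbox A B) x * ennreal \<bar>partial_deriv i u x\<bar> \<partial>lborel)"
    unfolding D_def using AB by (intro ennreal_partial_deriv_integral i) auto
  have "ennreal L' * ennreal X \<le> ennreal L * ennreal X' + ennreal (L * L') * ennreal D"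
    unfolding X_def X'_def osc ennreal_box_integral L_def L'_def
    by (rule box_integral_change_coordinate[OF ACL nonneg i measurable_partial_deriv[OF i] ab])
       (use L sub in \<open>auto simp: L_def L'_def\<close>)
  then have "ennreal (L' * X) \<le> ennreal (L * X' + L * L' * D)"
    using L X D by (simp add: ennreal_mult'[symmetric] ennreal_plus[symmetric] del: ennreal_plus)
  then have main: "L' * X \<le> L * X' + L * L' * D"
    using L X D by (subst (asm) ennreal_le_iff) auto
  have card: "card (Basis - {i}) = DIM('a) - 1" using i by simp
  have P: "\<sigma> ^ (DIM('a) - 1) \<le> P"
  proof -
    have "\<sigma> ^ (DIM('a) - 1) = (\<Prod>j\<in>Basis - {i}. \<sigma>)" by (simp only: prod_constant card)
    also have "\<dots> \<le> P" unfolding P_def using side \<open>0 < \<sigma>\<close> by (intro prod_mono) auto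
    finally show ?thesis .
  qed
  have "0 < \<sigma> ^ (DIM('a) - 1)" using \<open>0 < \<sigma>\<close> by simp
  then have "0 < P" using P by linarith
  have m: "box_mean a b = X / (L * P)"
    unfolding box_mean_def X_def L_def P_def using i by (subst prod.remove[of Basis i]) auto
  have "(\<Prod>j\<in>Basis - {i}. b' \<bullet> j - a' \<bullet> j) = P"
    unfolding P_def by (intro prod.cong) (auto simp: ab)
  then have m': "box_mean a' b' = X' / (L' * P)"
    unfolding box_mean_def X'_def L'_def using i by (subst prod.remove[of Basis i]) auto
  have "X / (L * P) = (L' * X) / (L * L' * P)" using L by simp
  also have "\<dots> \<le> (L * X' + L * L' * D) / (L * L' * P)"
    using main L \<open>0 < P\<close> by (intro divide_right_mono) auto
  also have "\<dots> = X' / (L' * P) + D / P" using L \<open>0 < P\<close> by (simp add: field_simps)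
  also have "D / P \<le> D / \<sigma> ^ (DIM('a) - 1)"
    using P D \<open>0 < \<sigma> ^ (DIM('a) - 1)\<close> by (intro divide_left_mono) (auto intro: mult_pos_pos less_le_trans)
  finally show ?thesis unfolding m m' D_def by simp
qed

text \<open>
  The boxes are exchanged one coordinate at a time; all intermediate boxes stay in \<open>cbox A B\<close> and keep
  their sides at least \<open>\<sigma>\<close>.
\<close>

lemma box_mean_change_coordinates:
  assumes "finite S" "S \<subseteq> Basis" and "0 < \<sigma>"
    and "\<And>j. j \<in> Basis \<Longrightarrow> j \<notin> S \<Longrightarrow> a \<bullet> j = a' \<bullet> j \<and> b \<bullet> j = b' \<bullet> j"
    and "\<And>j. j \<in> Basis \<Longrightarrow> \<sigma> \<le> b \<bullet> j - a \<bullet> j \<and> \<sigma> \<le> b' \<bullet> j - a' \<bullet> j"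
    and "\<And>j. j \<in> Basis \<Longrightarrow> A \<bullet> j \<le> a \<bullet> j \<and> A \<bullet> j \<le> a' \<bullet> j \<and> b \<bullet> j \<le> B \<bullet> j \<and> b' \<bullet> j \<le> B \<bullet> j"
  shows "box_mean a b \<le> box_mean a' b' + (\<Sum>i\<in>S. partial_deriv_integral A B i) / \<sigma> ^ (DIM('a) - 1)"
  using assms
proof (induction S arbitrary: a' b' rule: finite_induct)
  case empty
  then have "a = a'" "b = b'" by (auto intro: euclidean_eqI)
  then show ?case by simp
next
  case (insert i S)
  then have i: "i \<in> Basis" by simp
  define a'' where "a'' = a' + (a \<bullet> i - a' \<bullet> i) *\<^sub>R i"
  define b'' where "b'' = b' + (b \<bullet> i - b' \<bullet> i) *\<^sub>R i"
  have c: "a'' \<bullet> j = (if j = i then a \<bullet> i else a' \<bullet> j)" "b'' \<bullet> j = (if j = i then b \<bullet> i else b' \<bullet> j)"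
    if "j \<in> Basis" for j
    using that i by (auto simp: a''_def b''_def inner_add_left inner_Basis)
  have "box_mean a b \<le> box_mean a'' b'' + (\<Sum>i\<in>S. partial_deriv_integral A B i) / \<sigma> ^ (DIM('a) - 1)"
  proof (rule insert.IH)
    fix j :: 'a assume j: "j \<in> Basis"
    show "\<sigma> \<le> b \<bullet> j - a \<bullet> j \<and> \<sigma> \<le> b'' \<bullet> j - a'' \<bullet> j" using insert.prems(4)[OF j] by (auto simp: c j)
    show "A \<bullet> j \<le> a \<bullet> j \<and> A \<bullet> j \<le> a'' \<bullet> j \<and> b \<bullet> j \<le> B \<bullet> j \<and> b'' \<bullet> j \<le> B \<bullet> j"
      using insert.prems(5)[OF j] by (auto simp: c j)
    show "a \<bullet> j = a'' \<bullet> j \<and> b \<bullet> j = b'' \<bullet> j" if "j \<notin> S"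
      using insert.prems(3)[OF j] that by (auto simp: c j)
  qed (use insert.prems in auto)
  also have "box_mean a'' b'' \<le> box_mean a' b' + partial_deriv_integral A B i / \<sigma> ^ (DIM('a) - 1)"
  proof (rule box_mean_change_coordinate[OF i \<open>0 < \<sigma>\<close>])
    fix j :: 'a assume j: "j \<in> Basis"
    show "\<sigma> \<le> b'' \<bullet> j - a'' \<bullet> j \<and> \<sigma> \<le> b' \<bullet> j - a' \<bullet> j" using insert.prems(4)[OF j] by (auto simp: c j)
    show "A \<bullet> j \<le> a'' \<bullet> j \<and> A \<bullet> j \<le> a' \<bullet> j \<and> b'' \<bullet> j \<le> B \<bullet> j \<and> b' \<bullet> j \<le> B \<bullet> j"
      using insert.prems(5)[OF j] by (auto simp: c j)
    show "a'' \<bullet> j = a' \<bullet> j \<and> b'' \<bullet> j = b' \<bullet> j" if "j \<noteq> i"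
      using that by (auto simp: c j)
  qed
  finally show ?case using insert.hyps by (simp add: add_divide_distrib)
qed

definition cube :: "'a \<Rightarrow> real \<Rightarrow> 'a set" where
  "cube p r = cbox (p - r *\<^sub>R One) (p + r *\<^sub>R One)"

definition cube_mean :: "'a \<Rightarrow> real \<Rightarrow> real" where
  "cube_mean p r = box_mean (p - r *\<^sub>R One) (p + r *\<^sub>R One)"

lemma mem_cube: "x \<in> cube p r \<longleftrightarrow> (\<forall>j\<in>Basis. \<bar>x \<bullet> j - p \<bullet> j\<bar> \<le> r)"
  unfolding cube_def cbox_def
  by (auto simp: inner_diff_left inner_add_left inner_sum_left_Basis abs_le_iff algebra_simps)

text \<open>
  The error is the same for all scales, as only the ratio \<open>R / s\<close> enters. This is where the
  exponent of the energy has to be the dimension.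
\<close>

lemma poincare_cubes:
  assumes "0 < s" "0 < r" "0 < r'" "0 < R" "0 < \<epsilon>" "s \<le> r" "s \<le> r'"
    and p: "\<And>j. j \<in> Basis \<Longrightarrow> \<bar>p \<bullet> j - z \<bullet> j\<bar> + r \<le> R"
    and q: "\<And>j. j \<in> Basis \<Longrightarrow> \<bar>q \<bullet> j - z \<bullet> j\<bar> + r' \<le> R"
  shows "cube_mean p r \<le> cube_mean q r'
    + DIM('a) * (R / s) ^ (DIM('a) - 1) * (\<epsilon> + energy (cube z R) / \<epsilon> ^ (DIM('a) - 1))"
proof -
  define n where "n = DIM('a)"
  have n: "n = Suc (n - 1)" unfolding n_def by simp
  define A B where "A = z - R *\<^sub>R One" and "B = z + R *\<^sub>R One"
  \<comment> \<open>This choice gives both terms of \<open>partial_deriv_integral_le\<close> the factor \<open>(2 * R) ^ (n - 1)\<close>.\<close>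
  define \<tau> where "\<tau> = \<epsilon> / (2 * R)"
  have "0 < \<tau>" using assms by (simp add: \<tau>_def)
  have AB: "A \<bullet> j \<le> B \<bullet> j" "B \<bullet> j - A \<bullet> j = 2 * R" if "j \<in> Basis" for j
    using that \<open>0 < R\<close> by (auto simp: A_def B_def inner_diff_left inner_add_left)
  have osc: "partial_deriv_integral A B i \<le> (2 * R) ^ (n - 1) * (\<epsilon> + energy (cube z R) / \<epsilon> ^ (n - 1))"
    if i: "i \<in> Basis" for i
  proof -
    have "ennreal (partial_deriv_integral A B i)
        \<le> ennreal (\<tau> * (\<Prod>j\<in>(Basis :: 'a set). B \<bullet> j - A \<bullet> j) + energy (cbox A B) / \<tau> ^ (n - 1))"
      unfolding n_def using partial_deriv_integral_le[OF i \<open>0 < \<tau>\<close>, of A B] ennreal_partial_deriv_integral[OF i, of A B] AB(1) by simp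
    moreover have "(\<Prod>j\<in>(Basis :: 'a set). B \<bullet> j - A \<bullet> j) = (2 * R) ^ n"
      unfolding n_def using AB(2) by simp
    moreover have "0 \<le> \<tau> * (2 * R) ^ n + energy (cbox A B) / \<tau> ^ (n - 1)"
      using \<open>0 < \<tau>\<close> \<open>0 < R\<close> energy_nonneg by simp
    ultimately have "partial_deriv_integral A B i \<le> \<tau> * (2 * R) ^ n + energy (cbox A B) / \<tau> ^ (n - 1)"
      by (simp add: ennreal_le_iff)
    also have "\<tau> * (2 * R) ^ n = (2 * R) ^ (n - 1) * \<epsilon>"
      using \<open>0 < R\<close> by (subst n) (simp add: \<tau>_def)
    also have "energy (cbox A B) / \<tau> ^ (n - 1) = (2 * R) ^ (n - 1) * (energy (cube z R) / \<epsilon> ^ (n - 1))"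
      by (simp add: \<tau>_def power_divide cube_def A_def B_def)
    finally show ?thesis by (simp add: distrib_left)
  qed
  have "cube_mean p r \<le> cube_mean q r' + (\<Sum>i\<in>Basis. partial_deriv_integral A B i) / (2 * s) ^ (n - 1)"
    unfolding cube_mean_def n_def
  proof (rule box_mean_change_coordinates)
    fix j :: 'a assume j: "j \<in> Basis"
    show "2 * s \<le> (p + r *\<^sub>R One) \<bullet> j - (p - r *\<^sub>R One) \<bullet> j \<and> 2 * s \<le> (q + r' *\<^sub>R One) \<bullet> j - (q - r' *\<^sub>R One) \<bullet> j"
      using assms j by (auto simp: inner_diff_left inner_add_left)
    show "A \<bullet> j \<le> (p - r *\<^sub>R One) \<bullet> j \<and> A \<bullet> j \<le> (q - r' *\<^sub>R One) \<bullet> j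
        \<and> (p + r *\<^sub>R One) \<bullet> j \<le> B \<bullet> j \<and> (q + r' *\<^sub>R One) \<bullet> j \<le> B \<bullet> j"
      using p[OF j] q[OF j] j by (auto simp: A_def B_def inner_diff_left inner_add_left)
  qed (use \<open>0 < s\<close> in auto)
  also have "(\<Sum>i\<in>Basis. partial_deriv_integral A B i) / (2 * s) ^ (n - 1)
      \<le> (\<Sum>i\<in>(Basis :: 'a set). (2 * R) ^ (n - 1) * (\<epsilon> + energy (cube z R) / \<epsilon> ^ (n - 1))) / (2 * s) ^ (n - 1)"
    using osc \<open>0 < s\<close> by (intro divide_right_mono sum_mono) auto
  also have "\<dots> = n * (R / s) ^ (n - 1) * (\<epsilon> + energy (cube z R) / \<epsilon> ^ (n - 1))"
    by (simp add: n_def power_divide power_mult_distrib)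
  finally show ?thesis by (simp add: n_def)
qed

lemma cube_integral_bounds:
  assumes "0 < r"
  shows cube_mean_ge: "(\<And>x. x \<in> cube p r \<Longrightarrow> m \<le> u x) \<Longrightarrow> m \<le> cube_mean p r"
    and cube_mean_le: "0 \<le> M \<Longrightarrow> (\<And>x. x \<in> cube p r \<Longrightarrow> u x \<le> M) \<Longrightarrow> cube_mean p r \<le> M"
proof -
  define X where "X = (\<integral>\<^sup>+x. indicator (cube p r) x * ennreal (u x) \<partial>lborel)"
  define V where "V = (2 * r) ^ DIM('a)"
  have V: "0 < V" using assms by (simp add: V_def)
  have vol: "emeasure lborel (cube p r) = ennreal V"
    unfolding cube_def V_def using assms
    by (simp add: emeasure_lborel_cbox inner_diff_left inner_add_left algebra_simps)
  have mean: "cube_mean p r = enn2real X / V"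
    unfolding cube_mean_def box_mean_def X_def cube_def V_def
    by (simp add: inner_diff_left inner_add_left)
  have X: "ennreal (enn2real X) = X"
    unfolding X_def cube_def by (rule ennreal_box_integral)
  have sets: "cube p r \<in> sets lborel" by (simp add: cube_def)
  have const: "(\<integral>\<^sup>+x. ennreal c * indicator (cube p r) x \<partial>lborel) = ennreal (c * V)" if "0 \<le> c" for c
    using that V sets by (simp add: nn_integral_cmult_indicator vol ennreal_mult')
  show "m \<le> cube_mean p r" if "\<And>x. x \<in> cube p r \<Longrightarrow> m \<le> u x"
  proof (cases "0 \<le> m")
    case True
    have "ennreal (m * V) \<le> ennreal (enn2real X)"
      unfolding X const[OF True, symmetric] unfolding X_def using that
      by (intro nn_integral_mono) (auto simp: indicator_def intro: ennreal_leI)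
    then show ?thesis unfolding mean using V by (simp add: ennreal_le_iff pos_le_divide_eq)
  next
    case False
    then show ?thesis unfolding mean using V by (simp add: order_trans[of m 0])
  qed
  show "cube_mean p r \<le> M" if "0 \<le> M" "\<And>x. x \<in> cube p r \<Longrightarrow> u x \<le> M"
  proof -
    have "ennreal (enn2real X) \<le> ennreal (M * V)"
      unfolding X const[OF that(1), symmetric] unfolding X_def using that
      by (intro nn_integral_mono) (auto simp: indicator_def intro: ennreal_leI)
    then show ?thesis unfolding mean using V that by (simp add: ennreal_le_iff pos_divide_le_eq)
  qed
qed

end

section \<open>Descent along a uniformly perfect set\<close>

lemma child_scale_bounds:
  assumes "0 < c" "c < 1" "\<kappa> = c / (4 * DIM('a::euclidean_space))"
  shows "0 < \<kappa>" "\<kappa> \<le> 1 / 4"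
proof -
  have n: "1 \<le> real DIM('a)" using DIM_positive[where 'a='a] by linarith
  then show "0 < \<kappa>" using assms by simp
  have "\<kappa> \<le> c / 4" unfolding assms(3) using n assms by (intro divide_left_mono) auto
  then show "\<kappa> \<le> 1 / 4" using \<open>c < 1\<close> by linarith
qed

context finite_energy
begin

text \<open>
  The coordinates of \<open>p\<close> and \<open>p'\<close> differ by more than \<open>c r / n = 4 \<kappa> r\<close> somewhere, because the
  \<open>l\<^sub>1\<close>-norm dominates the Euclidean norm. Hence the two cubes of half side \<open>2 \<kappa> r\<close> are disjoint and one
  of them has at most half of the energy of the surrounding cube.
\<close>

lemma exists_child_with_half_energy:
  assumes "0 < c" "c < 1" "0 < r" "0 < \<epsilon>"
    and p': "c * r < norm (p' - p)" "norm (p' - p) < r"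
    and \<kappa>: "\<kappa> = c / (4 * DIM('a))"
  shows "\<exists>q\<in>{p, p'}. energy (cube q (2 * (\<kappa> * r))) \<le> energy (cube p (2 * r)) / 2 \<and>
     cube_mean p r \<le> cube_mean q (\<kappa> * r)
       + DIM('a) * (2 / \<kappa>) ^ (DIM('a) - 1) * (\<epsilon> + energy (cube p (2 * r)) / \<epsilon> ^ (DIM('a) - 1))"
proof -
  have n: "1 \<le> real DIM('a)" using DIM_positive[where 'a='a] by linarith
  have \<kappa>0: "0 < \<kappa>" "\<kappa> \<le> 1 / 4"
    using child_scale_bounds[OF assms(1,2) \<kappa>] by auto
  have lr: "0 < \<kappa> * r" "\<kappa> * r \<le> r / 4" using \<kappa>0 \<open>0 < r\<close> by (auto simp: field_simps)
  have coord: "\<bar>p' \<bullet> j - p \<bullet> j\<bar> < r" if "j \<in> Basis" for j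
    using Basis_le_norm[OF that, of "p' - p"] p' by (simp add: inner_diff_left)
  have "\<exists>j\<in>Basis. 4 * (\<kappa> * r) < \<bar>p' \<bullet> j - p \<bullet> j\<bar>"
  proof (rule ccontr)
    assume "\<not> ?thesis"
    then have "(\<Sum>j\<in>(Basis :: 'a set). \<bar>(p' - p) \<bullet> j\<bar>) \<le> (\<Sum>j\<in>(Basis :: 'a set). 4 * (\<kappa> * r))"
      by (intro sum_mono) (auto simp: inner_diff_left not_less)
    also have "\<dots> = c * r" using n by (simp add: \<kappa>)
    finally show False using norm_le_l1[of "p' - p"] p' by simp
  qed
  then obtain j where j: "j \<in> Basis" "4 * (\<kappa> * r) < \<bar>p' \<bullet> j - p \<bullet> j\<bar>" by blast
  have "cube p (2 * (\<kappa> * r)) \<inter> cube p' (2 * (\<kappa> * r)) = {}"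
  proof (rule ccontr)
    assume "\<not> ?thesis"
    then obtain x where "x \<in> cube p (2 * (\<kappa> * r))" "x \<in> cube p' (2 * (\<kappa> * r))" by blast
    then have "\<bar>x \<bullet> j - p \<bullet> j\<bar> \<le> 2 * (\<kappa> * r)" "\<bar>x \<bullet> j - p' \<bullet> j\<bar> \<le> 2 * (\<kappa> * r)"
      using j(1) by (auto simp: mem_cube)
    then show False using j(2) by linarith
  qed
  moreover have "cube p (2 * (\<kappa> * r)) \<subseteq> cube p (2 * r)"
  proof
    fix x assume x: "x \<in> cube p (2 * (\<kappa> * r))"
    show "x \<in> cube p (2 * r)"
      unfolding mem_cube
    proof
      fix k :: 'a assume "k \<in> Basis"
      then have "\<bar>x \<bullet> k - p \<bullet> k\<bar> \<le> 2 * (\<kappa> * r)" using x by (simp add: mem_cube)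
      then show "\<bar>x \<bullet> k - p \<bullet> k\<bar> \<le> 2 * r" using lr \<open>0 < r\<close> by linarith
    qed
  qed
  moreover have "cube p' (2 * (\<kappa> * r)) \<subseteq> cube p (2 * r)"
  proof
    fix x assume x: "x \<in> cube p' (2 * (\<kappa> * r))"
    show "x \<in> cube p (2 * r)"
      unfolding mem_cube
    proof
      fix k :: 'a assume k: "k \<in> Basis"
      then have "\<bar>x \<bullet> k - p' \<bullet> k\<bar> \<le> 2 * (\<kappa> * r)" using x by (simp add: mem_cube)
      then show "\<bar>x \<bullet> k - p \<bullet> k\<bar> \<le> 2 * r"
        using coord[OF k] lr by linarith
    qed
  qed
  moreover have "cube p (2 * (\<kappa> * r)) \<in> sets borel" "cube p' (2 * (\<kappa> * r)) \<in> sets borel"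
    by (simp_all add: cube_def)
  ultimately have "energy (cube p (2 * (\<kappa> * r))) + energy (cube p' (2 * (\<kappa> * r))) \<le> energy (cube p (2 * r))"
    by (rule energy_disjoint)
  then have "energy (cube p (2 * (\<kappa> * r))) \<le> energy (cube p (2 * r)) / 2
      \<or> energy (cube p' (2 * (\<kappa> * r))) \<le> energy (cube p (2 * r)) / 2" by linarith
  then obtain q where q: "q \<in> {p, p'}" "energy (cube q (2 * (\<kappa> * r))) \<le> energy (cube p (2 * r)) / 2"
    by blast
  have "\<bar>q \<bullet> k - p \<bullet> k\<bar> + \<kappa> * r \<le> 2 * r" if "k \<in> Basis" for k
  proof -
    have "\<bar>q \<bullet> k - p \<bullet> k\<bar> < r" using q(1) coord[OF that] \<open>0 < r\<close> by auto
    then show ?thesis using lr by linarith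
  qed
  then have "cube_mean p r \<le> cube_mean q (\<kappa> * r)
      + DIM('a) * (2 * r / (\<kappa> * r)) ^ (DIM('a) - 1) * (\<epsilon> + energy (cube p (2 * r)) / \<epsilon> ^ (DIM('a) - 1))"
    using lr \<open>0 < r\<close> \<open>0 < \<epsilon>\<close> by (intro poincare_cubes) auto
  moreover have "2 * r / (\<kappa> * r) = 2 / \<kappa>" using \<open>0 < r\<close> by simp
  ultimately show ?thesis using q by auto
qed

text \<open>
  When the energy \<open>J\<close> is halved, the free parameter \<open>\<epsilon>\<close> is multiplied by a factor \<open>\<theta> < 1\<close> for
  which \<open>J / \<epsilon>\<^bsup>n-1\<^esup>\<close> still decreases by a fixed factor. Then both \<open>\<epsilon>\<close> and \<open>J / \<epsilon>\<^bsup>n-1\<^esup>\<close> decrease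
  geometrically, and one constant \<open>K\<close> absorbs the errors of all steps.
\<close>

lemma cube_mean_le_by_descent:
  assumes "0 < c" "c < 1"
    and dense: "\<And>p r. p \<in> E \<Longrightarrow> 0 < r \<Longrightarrow> r < d \<Longrightarrow> \<exists>p'\<in>E. c * r < norm (p' - p) \<and> norm (p' - p) < r"
    and \<kappa>: "\<kappa> = c / (4 * DIM('a))"
    and K: "K = 2 * DIM('a) * (DIM('a) * (2 / \<kappa>) ^ (DIM('a) - 1))"
  shows "p \<in> E \<Longrightarrow> 0 < r \<Longrightarrow> r < d \<Longrightarrow> 0 < \<epsilon> \<Longrightarrow>
    \<exists>q\<in>E. cube_mean p r \<le> cube_mean q (\<kappa> ^ m * r) + K * (\<epsilon> + energy (cube p (2 * r)) / \<epsilon> ^ (DIM('a) - 1))"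
proof (induction m arbitrary: p r \<epsilon>)
  case 0
  have "0 \<le> K" using \<open>0 < c\<close> by (simp add: K \<kappa>)
  then have "0 \<le> K * (\<epsilon> + energy (cube p (2 * r)) / \<epsilon> ^ (DIM('a) - 1))"
    using 0 energy_nonneg by simp
  then show ?case using 0 by (intro bexI[of _ p]) auto
next
  case (Suc m)
  define n where "n = DIM('a)"
  define C where "C = n * (2 / \<kappa>) ^ (n - 1)"
  have n: "1 \<le> n" unfolding n_def using DIM_positive[where 'a='a] by linarith
  have \<kappa>0: "0 < \<kappa>" "\<kappa> < 1"
    using child_scale_bounds[OF assms(1,2) \<kappa>] by auto
  have "0 \<le> C" using \<kappa>0 by (simp add: C_def)
  have KC: "K = 2 * n * C" by (simp add: K C_def n_def)
  \<comment> \<open>By Bernoulli's inequality this \<open>\<theta>\<close> satisfies \<open>2 * \<theta> ^ (n - 1) > 1\<close>, with room to spare.\<close>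
  define \<theta> where "\<theta> = 1 - 1 / (2 * n)"
  have \<theta>: "0 < \<theta>" using n by (simp add: \<theta>_def field_simps)
  have "1 + real (n - 1) * (- 1 / (2 * n)) \<le> (1 + (- 1 / (2 * n))) ^ (n - 1)"
    using n by (intro Bernoulli_inequality) (simp add: field_simps)
  moreover have "1 + real (n - 1) * (- 1 / (2 * n)) = (n + 1) / (2 * n)"
    using n by (simp add: field_simps of_nat_diff)
  ultimately have \<theta>n: "(n + 1) / (2 * n) \<le> \<theta> ^ (n - 1)" by (simp add: \<theta>_def)
  define J where "J = energy (cube p (2 * r))"
  have "0 \<le> J" by (simp add: J_def energy_nonneg)
  obtain p' where p': "p' \<in> E" "c * r < norm (p' - p)" "norm (p' - p) < r"
    using dense Suc.prems by blast
  obtain p1 where p1: "p1 \<in> {p, p'}" "energy (cube p1 (2 * (\<kappa> * r))) \<le> J / 2"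
    "cube_mean p r \<le> cube_mean p1 (\<kappa> * r) + C * (\<epsilon> + J / \<epsilon> ^ (n - 1))"
    using exists_child_with_half_energy[OF assms(1,2) Suc.prems(2,4) p'(2,3) \<kappa>]
    unfolding J_def C_def n_def by blast
  have "p1 \<in> E" using p1 p' Suc.prems by auto
  moreover have "\<kappa> * r < r" using \<kappa>0 Suc.prems mult_strict_right_mono[of \<kappa> 1 r] by simp
  then have "\<kappa> * r < d" using Suc.prems(3) by (rule less_trans)
  moreover have "0 < \<kappa> * r" "0 < \<theta> * \<epsilon>"
    using \<kappa>0 \<theta> Suc.prems by auto
  ultimately obtain q where q: "q \<in> E" "cube_mean p1 (\<kappa> * r) \<le> cube_mean q (\<kappa> ^ m * (\<kappa> * r))
      + K * (\<theta> * \<epsilon> + energy (cube p1 (2 * (\<kappa> * r))) / (\<theta> * \<epsilon>) ^ (n - 1))"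
    using Suc.IH[of p1 "\<kappa> * r" "\<theta> * \<epsilon>"] unfolding n_def by blast
  have e1: "C * \<epsilon> + K * (\<theta> * \<epsilon>) = K * \<epsilon>"
    using n by (simp add: KC \<theta>_def field_simps)
  have "energy (cube p1 (2 * (\<kappa> * r))) / (\<theta> * \<epsilon>) ^ (n - 1) \<le> (J / 2) / (\<theta> * \<epsilon>) ^ (n - 1)"
    using p1 \<theta> Suc.prems by (intro divide_right_mono) auto
  also have "\<dots> = (J / \<epsilon> ^ (n - 1)) * (1 / (2 * \<theta> ^ (n - 1)))"
    by (simp add: power_mult_distrib)
  also have "\<dots> \<le> (J / \<epsilon> ^ (n - 1)) * (n / (n + 1))"
  proof (rule mult_left_mono)
    have "1 / (2 * \<theta> ^ (n - 1)) \<le> 1 / (2 * ((n + 1) / (2 * n)))"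
    proof (rule divide_left_mono)
      show "2 * ((n + 1) / (2 * n)) \<le> 2 * \<theta> ^ (n - 1)" using \<theta>n by (rule mult_left_mono) simp
    qed (use n \<theta> in auto)
    also have "\<dots> = n / (n + 1)" using n by (simp add: field_simps)
    finally show "1 / (2 * \<theta> ^ (n - 1)) \<le> n / (n + 1)" .
    show "0 \<le> J / \<epsilon> ^ (n - 1)" using \<open>0 \<le> J\<close> Suc.prems by simp
  qed
  finally have e2: "energy (cube p1 (2 * (\<kappa> * r))) / (\<theta> * \<epsilon>) ^ (n - 1) \<le> (J / \<epsilon> ^ (n - 1)) * (n / (n + 1))" .
  have Kn: "C + K * (n / (n + 1)) \<le> K"
  proof -
    have "K - K * (n / (n + 1)) = K / (n + 1)" by (simp add: field_simps)
    also have "\<dots> \<ge> C"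
      using n \<open>0 \<le> C\<close> mult_right_mono[of "n + 1" "2 * n" C] by (simp add: KC field_simps)
    finally show ?thesis by linarith
  qed
  have "C * (J / \<epsilon> ^ (n - 1)) + K * (energy (cube p1 (2 * (\<kappa> * r))) / (\<theta> * \<epsilon>) ^ (n - 1))
      \<le> C * (J / \<epsilon> ^ (n - 1)) + K * ((J / \<epsilon> ^ (n - 1)) * (n / (n + 1)))"
    using e2 \<open>0 \<le> C\<close> by (intro add_left_mono mult_left_mono) (auto simp: KC)
  also have "\<dots> = (C + K * (n / (n + 1))) * (J / \<epsilon> ^ (n - 1))" by (simp add: algebra_simps)
  also have "\<dots> \<le> K * (J / \<epsilon> ^ (n - 1))"
    using Kn \<open>0 \<le> J\<close> Suc.prems by (intro mult_right_mono) auto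
  finally have e3: "C * (J / \<epsilon> ^ (n - 1)) + K * (energy (cube p1 (2 * (\<kappa> * r))) / (\<theta> * \<epsilon>) ^ (n - 1))
      \<le> K * (J / \<epsilon> ^ (n - 1))" .
  have "cube_mean p r \<le> cube_mean q (\<kappa> ^ Suc m * r) + K * (\<epsilon> + J / \<epsilon> ^ (n - 1))"
    using p1(3) q(2) e1 e3 by (simp add: distrib_left mult_ac)
  then show ?case using q(1) unfolding J_def n_def by blast
qed

text \<open>
  The descent ends in tiny cubes around points of \<open>E\<close>. Uniform continuity makes their means
  small regardless of which points of \<open>E\<close> it has reached.
\<close>

lemma cube_mean_le_energy:
  assumes "0 < c" "c < 1"
    and dense: "\<And>p r. p \<in> E \<Longrightarrow> 0 < r \<Longrightarrow> r < d \<Longrightarrow> \<exists>p'\<in>E. c * r < norm (p' - p) \<and> norm (p' - p) < r"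
    and \<kappa>: "\<kappa> = c / (4 * DIM('a))"
    and K: "K = 2 * DIM('a) * (DIM('a) * (2 / \<kappa>) ^ (DIM('a) - 1))"
    and zero: "\<And>p. p \<in> E \<Longrightarrow> u p = 0" and supp: "compact (closure {x. u x \<noteq> 0})"
    and p: "p \<in> E" "0 < r" "r < d" "0 < \<epsilon>"
  shows "cube_mean p r \<le> K * (\<epsilon> + energy (cube p (2 * r)) / \<epsilon> ^ (DIM('a) - 1))"
proof (rule field_le_epsilon)
  fix \<eta> :: real assume "0 < \<eta>"
  have n: "1 \<le> real DIM('a)" using DIM_positive[where 'a='a] by linarith
  have \<kappa>0: "0 < \<kappa>" "\<kappa> < 1"
    using child_scale_bounds[OF assms(1,2) \<kappa>] by auto
  have "bounded {x. u x \<noteq> 0}"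
    using bounded_subset[OF compact_imp_bounded[OF supp] closure_subset] .
  then obtain R where R: "\<And>x. u x \<noteq> 0 \<Longrightarrow> norm x \<le> R"
    unfolding bounded_iff by auto
  have "uniformly_continuous_on (cball 0 (R + 1)) u"
    using continuous by (intro compact_uniformly_continuous continuous_on_subset[OF continuous]) auto
  then obtain \<delta> where \<delta>: "0 < \<delta>"
    "\<And>x y. x \<in> cball 0 (R + 1) \<Longrightarrow> y \<in> cball 0 (R + 1) \<Longrightarrow> dist y x < \<delta> \<Longrightarrow> dist (u y) (u x) < \<eta>"
    unfolding uniformly_continuous_on_def using \<open>0 < \<eta>\<close> by metis
  define \<rho> where "\<rho> = min \<delta> 1"
  have "0 < \<rho>" using \<delta> by (simp add: \<rho>_def)
  have near_zero: "u x \<le> \<eta>" if "u q = 0" "dist x q < \<rho>" for x q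
  proof (cases "u x = 0")
    case False
    then have "norm x \<le> R" using R by blast
    moreover have "norm q \<le> norm x + dist x q"
      by (metis dist_norm norm_minus_commute norm_triangle_sub)
    ultimately have "dist (u x) (u q) < \<eta>" using that by (intro \<delta>(2)) (auto simp: \<rho>_def)
    then show ?thesis using that by (simp add: dist_real_def)
  qed (use \<open>0 < \<eta>\<close> in auto)
  have "(\<lambda>m. \<kappa> ^ m) \<longlonglongrightarrow> 0" using \<kappa>0 by (intro LIMSEQ_power_zero) auto
  moreover have "0 < \<rho> / (2 * DIM('a) * r)" using \<open>0 < \<rho>\<close> p n by simp
  ultimately have "eventually (\<lambda>m. \<kappa> ^ m < \<rho> / (2 * DIM('a) * r)) sequentially"
    by (rule order_tendstoD(2))
  then obtain m where m: "\<kappa> ^ m < \<rho> / (2 * DIM('a) * r)"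
    using eventually_happens sequentially_bot by blast
  obtain q where q: "q \<in> E" "cube_mean p r \<le> cube_mean q (\<kappa> ^ m * r)
      + K * (\<epsilon> + energy (cube p (2 * r)) / \<epsilon> ^ (DIM('a) - 1))"
    using cube_mean_le_by_descent[OF assms(1,2) dense \<kappa> K p, of m] by blast
  have "cube_mean q (\<kappa> ^ m * r) \<le> \<eta>"
  proof (rule cube_mean_le)
    fix x assume x: "x \<in> cube q (\<kappa> ^ m * r)"
    have "dist x q \<le> (\<Sum>j\<in>(Basis :: 'a set). \<bar>(x - q) \<bullet> j\<bar>)"
      unfolding dist_norm by (rule norm_le_l1)
    also have "\<dots> \<le> (\<Sum>j\<in>(Basis :: 'a set). \<kappa> ^ m * r)"
      using x by (intro sum_mono) (auto simp: mem_cube inner_diff_left)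
    also have "\<dots> = (2 * DIM('a) * r) * \<kappa> ^ m / 2" by simp
    also have "\<dots> < \<rho>"
      using m p n \<open>0 < \<rho>\<close> by (simp add: field_simps)
    finally show "u x \<le> \<eta>" using near_zero zero q(1) by blast
  qed (use \<kappa>0 p \<open>0 < \<eta>\<close> in auto)
  then show "cube_mean p r \<le> K * (\<epsilon> + energy (cube p (2 * r)) / \<epsilon> ^ (DIM('a) - 1)) + \<eta>"
    using q(2) by linarith
qed

text \<open>
  The cube of half side \<open>\<alpha> d / n\<close> around \<open>x\<close> lies in the ball where \<open>u \<ge> 1\<close>. It is compared with an
  equal cube around a nearest point \<open>a\<close> of \<open>E\<close>, where the descent starts. Choosing \<open>\<epsilon> = 1 / (2 K)\<close>
  leaves half of the mean to be paid for by the energy.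
\<close>

lemma energy_lower_bound:
  assumes "0 < c" "c < 1" "0 < \<alpha>" "\<alpha> < 1" "0 < d"
    and dense: "\<And>p r. p \<in> E \<Longrightarrow> 0 < r \<Longrightarrow> r < d \<Longrightarrow> \<exists>p'\<in>E. c * r < norm (p' - p) \<and> norm (p' - p) < r"
    and zero: "\<And>p. p \<in> E \<Longrightarrow> u p = 0" and supp: "compact (closure {x. u x \<noteq> 0})"
    and "a \<in> E" "norm (x - a) = d" and ge1: "\<And>y. y \<in> cball x (\<alpha> * d) \<Longrightarrow> 1 \<le> u y"
    and \<kappa>: "\<kappa> = c / (4 * DIM('a))"
    and K: "K = DIM('a) * (2 * DIM('a) / \<alpha>) ^ (DIM('a) - 1)
                + 2 * DIM('a) * (DIM('a) * (2 / \<kappa>) ^ (DIM('a) - 1))"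
  shows "(1 / (2 * K)) ^ DIM('a) \<le> energy UNIV"
proof -
  define n where "n = DIM('a)"
  have n: "1 \<le> real n" unfolding n_def using DIM_positive[where 'a='a] by linarith
  have nSuc: "n = Suc (n - 1)" unfolding n_def by simp
  define K1 where "K1 = n * (2 * n / \<alpha>) ^ (n - 1)"
  define K2 where "K2 = 2 * n * (n * (2 / \<kappa>) ^ (n - 1))"
  have "0 < \<kappa>" using n assms(1) by (simp add: \<kappa> n_def)
  have K12: "0 < K1" "0 < K2" "K = K1 + K2" using n \<open>0 < \<kappa>\<close> \<open>0 < \<alpha>\<close> by (auto simp: K1_def K2_def K n_def)
  then have "0 < K" by simp
  define \<rho> where "\<rho> = \<alpha> * d / n"
  have "\<alpha> * d < d" using \<open>\<alpha> < 1\<close> \<open>0 < d\<close> by simp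
  have "\<rho> \<le> \<alpha> * d" unfolding \<rho>_def using n \<open>0 < \<alpha>\<close> \<open>0 < d\<close> by (simp add: field_simps)
  then have "\<rho> < d" using \<open>\<alpha> * d < d\<close> by linarith
  moreover have "0 < \<rho>" unfolding \<rho>_def using n \<open>0 < \<alpha>\<close> \<open>0 < d\<close> by simp
  ultimately have \<rho>: "0 < \<rho>" "\<rho> < d" by auto
  define \<epsilon> where "\<epsilon> = 1 / (2 * K)"
  have "0 < \<epsilon>" using \<open>0 < K\<close> by (simp add: \<epsilon>_def)
  define I where "I = energy UNIV"
  have I: "energy A / \<epsilon> ^ (n - 1) \<le> I / \<epsilon> ^ (n - 1)" for A
    unfolding I_def using \<open>0 < \<epsilon>\<close> by (intro divide_right_mono energy_mono) auto
  have "1 \<le> cube_mean x \<rho>"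
  proof (rule cube_mean_ge[OF \<rho>(1)])
    fix y assume y: "y \<in> cube x \<rho>"
    have "dist x y \<le> (\<Sum>j\<in>(Basis :: 'a set). \<bar>(y - x) \<bullet> j\<bar>)"
      unfolding dist_norm norm_minus_commute[of x] by (rule norm_le_l1)
    also have "\<dots> \<le> (\<Sum>j\<in>(Basis :: 'a set). \<rho>)"
      using y by (intro sum_mono) (auto simp: mem_cube inner_diff_left)
    also have "\<dots> = \<alpha> * d" using n by (simp add: \<rho>_def n_def)
    finally show "1 \<le> u y" by (intro ge1) simp
  qed
  also have "\<dots> \<le> cube_mean a \<rho>
      + DIM('a) * (2 * d / \<rho>) ^ (DIM('a) - 1) * (\<epsilon> + energy (cube a (2 * d)) / \<epsilon> ^ (DIM('a) - 1))"
  proof (rule poincare_cubes)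
    fix j :: 'a assume "j \<in> Basis"
    then show "\<bar>x \<bullet> j - a \<bullet> j\<bar> + \<rho> \<le> 2 * d"
      using Basis_le_norm[of j "x - a"] assms(10) \<rho> by (simp add: inner_diff_left)
  qed (use \<rho> \<open>0 < \<epsilon>\<close> \<open>0 < d\<close> in auto)
  also have "DIM('a) * (2 * d / \<rho>) ^ (DIM('a) - 1) = K1"
    using \<open>0 < d\<close> n by (simp add: K1_def n_def \<rho>_def)
  also have "K1 * (\<epsilon> + energy (cube a (2 * d)) / \<epsilon> ^ (DIM('a) - 1)) \<le> K1 * (\<epsilon> + I / \<epsilon> ^ (n - 1))"
    using I K12 by (intro mult_left_mono add_left_mono) (auto simp: n_def)
  also have "cube_mean a \<rho> \<le> K2 * (\<epsilon> + energy (cube a (2 * \<rho>)) / \<epsilon> ^ (DIM('a) - 1))"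
    by (rule cube_mean_le_energy[OF assms(1,2) dense \<kappa> _ zero supp assms(9) \<rho> \<open>0 < \<epsilon>\<close>])
       (auto simp: K2_def n_def)
  also have "K2 * (\<epsilon> + energy (cube a (2 * \<rho>)) / \<epsilon> ^ (DIM('a) - 1)) \<le> K2 * (\<epsilon> + I / \<epsilon> ^ (n - 1))"
    using I K12 by (intro mult_left_mono add_left_mono) (auto simp: n_def)
  finally have "1 \<le> K * (\<epsilon> + I / \<epsilon> ^ (n - 1))" by (simp add: K12(3) distrib_right add.commute)
  then have "\<epsilon> \<le> I / \<epsilon> ^ (n - 1)"
    using \<open>0 < K\<close> by (simp add: \<epsilon>_def field_simps)
  then have "\<epsilon> ^ n \<le> I"
    using \<open>0 < \<epsilon>\<close> by (subst nSuc) (simp add: pos_le_divide_eq)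
  then show ?thesis by (simp add: \<epsilon>_def I_def n_def)
qed

end

section \<open>Uniformly perfect boundaries give a lower bound\<close>

lemma finite_points_ext_boundary: "finite_points (ext_boundary G) = frontier G"
proof -
  have openSome: "openin ext_space (Some ` T) \<longleftrightarrow> open T" for T :: "'a set"
    by simp
  have openV: "open (Some -` W)" if "openin ext_space W" for W :: "'a option set"
    using openin_continuous_map_preimage[OF continuous_map_Some that] by (simp add: vimage_def)
  have "Some x \<in> ext_space closure_of (Some ` G) \<longleftrightarrow> x \<in> closure G" for x
  proof
    assume cl: "Some x \<in> ext_space closure_of (Some ` G)"
    show "x \<in> closure G"
      unfolding closure_iff_nhds_not_empty
    proof (intro allI impI)
      fix A V assume "V \<subseteq> A" "open V" "x \<in> V"
      then obtain y where "y \<in> Some ` G" "y \<in> Some ` V"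
        using cl openSome[of V] unfolding in_closure_of by (metis imageI)
      then show "G \<inter> A \<noteq> {}" using \<open>V \<subseteq> A\<close> by blast
    qed
  next
    assume cl: "x \<in> closure G"
    show "Some x \<in> ext_space closure_of (Some ` G)"
      unfolding in_closure_of
    proof (intro conjI allI impI)
      fix W assume "Some x \<in> W \<and> openin ext_space W"
      then have "open (Some -` W)" "x \<in> Some -` W" using openV by auto
      then have "G \<inter> (Some -` W) \<noteq> {}" using cl open_Int_closure_eq_empty[of "Some -` W" G] by blast
      then show "\<exists>y. y \<in> Some ` G \<and> y \<in> W" by blast
    qed simp
  qed
  moreover have "Some x \<in> ext_space interior_of (Some ` G) \<longleftrightarrow> x \<in> interior G" for x
  proof
    assume "Some x \<in> ext_space interior_of (Some ` G)"
    then obtain W where W: "openin ext_space W" "Some x \<in> W" "W \<subseteq> Some ` G"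
      unfolding interior_of_def by blast
    then have "Some -` W \<subseteq> G" by blast
    then show "x \<in> interior G" using openV[OF W(1)] W(2) by (auto intro: interiorI)
  next
    assume "x \<in> interior G"
    then obtain T where "open T" "x \<in> T" "T \<subseteq> G" by (rule interiorE)
    then show "Some x \<in> ext_space interior_of (Some ` G)"
      unfolding interior_of_def using openSome[of T] by blast
  qed
  ultimately show ?thesis
    by (auto simp: ext_boundary_def frontier_of_def frontier_def)
qed

lemma infinity_in_ext_boundary_iff:
  fixes G :: "'a::euclidean_space set"
  shows "None \<in> ext_boundary G \<longleftrightarrow> \<not> bounded G"
proof -
  have "None \<notin> ext_space interior_of (Some ` G)"
    using interior_of_subset[of ext_space "Some ` G"] by blast
  then have "None \<in> ext_boundary G \<longleftrightarrow> None \<in> ext_space closure_of (Some ` G)"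
    by (auto simp: ext_boundary_def frontier_of_def)
  also have "\<dots> \<longleftrightarrow> \<not> bounded G"
  proof
    assume cl: "None \<in> ext_space closure_of (Some ` G)"
    show "\<not> bounded G"
    proof
      assume "bounded G"
      then have "compact (closure G)" by simp
      then have "openin ext_space (insert None (Some ` (- closure G)))"
        unfolding openin_Alexandroff_compactification
        by (intro disjI2 exI[of _ "closure G"]) (auto simp: Compl_eq_Diff_UNIV)
      then obtain y where "y \<in> Some ` G" "y \<in> insert None (Some ` (- closure G))"
        using cl unfolding in_closure_of by blast
      then show False using closure_subset by blast
    qed
  next
    assume unb: "\<not> bounded G"
    show "None \<in> ext_space closure_of (Some ` G)"
      unfolding in_closure_of
    proof (intro conjI allI impI)
      fix W :: "'a option set" assume W: "None \<in> W \<and> openin ext_space W"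
      then obtain C where C: "compact C" "W = insert None (Some ` (- C))"
        unfolding openin_Alexandroff_compactification by (auto simp: Compl_eq_Diff_UNIV)
      have "\<not> G \<subseteq> C" using unb C(1) bounded_subset compact_imp_bounded by blast
      then show "\<exists>y. y \<in> Some ` G \<and> y \<in> W" using C(2) by blast
    qed simp
  qed
  finally show ?thesis .
qed

lemma compactin_ext_boundary: "compactin ext_space (ext_boundary G)"
  unfolding ext_boundary_def by (intro closedin_compact_space closedin_frontier_of) simp

text \<open>
  Two opposite rays from \<open>x\<close> leave \<open>G\<close> at boundary points whose distances from \<open>x\<close> add up. This makes all
  scales below the distance of \<open>x\<close> from the boundary admissible in the definition of uniform perfectness.
\<close>

lemma twice_boundary_dist_le_diameter:
  fixes G :: "'a::euclidean_space set"
  assumes "open G" "bounded G" "x \<in> G"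
  shows "2 * infdist x (frontier G) \<le> diameter (frontier G)"
proof -
  obtain e :: 'a where e: "e \<in> Basis" using nonempty_Basis by blast
  have "e \<noteq> 0" "- e \<noteq> 0" using e by auto
  have x: "x \<in> interior G" using assms by (simp add: interior_open)
  obtain s where s: "0 < s" "x + s *\<^sub>R e \<in> frontier G"
    using ray_to_frontier[OF assms(2) x \<open>e \<noteq> 0\<close>] by blast
  obtain t where t: "0 < t" "x + t *\<^sub>R (- e) \<in> frontier G"
    using ray_to_frontier[OF assms(2) x \<open>- e \<noteq> 0\<close>] by blast
  have "infdist x (frontier G) \<le> s" "infdist x (frontier G) \<le> t"
    using infdist_le[OF s(2), of x] infdist_le[OF t(2), of x] e s t by (auto simp: dist_norm)
  moreover have "(x + s *\<^sub>R e) - (x + t *\<^sub>R (- e)) = (s + t) *\<^sub>R e" by (simp add: algebra_simps)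
  then have "dist (x + s *\<^sub>R e) (x + t *\<^sub>R (- e)) = s + t"
    unfolding dist_norm using e s t by simp
  moreover have "bounded (frontier G)" using bounded_closure[OF assms(2)] by (rule bounded_subset) (simp add: frontier_def)
  then have "dist (x + s *\<^sub>R e) (x + t *\<^sub>R (- e)) \<le> diameter (frontier G)"
    using s(2) t(2) by (rule diameter_bounded_bound)
  ultimately show ?thesis by linarith
qed

text \<open>
  Local integrability includes measurability of the \<open>n\<close>-th power on every ball.
\<close>

lemma ACLn_measurable_partial_deriv:
  fixes u :: "'a::euclidean_space \<Rightarrow> real"
  assumes "ACLn u" and i: "i \<in> Basis"
  shows "(\<lambda>x. \<bar>partial_deriv i u x\<bar>) \<in> borel_measurable borel"
proof -
  let ?w = "\<lambda>x. \<bar>partial_deriv i u x\<bar> ^ DIM('a)"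
  have cut: "(\<lambda>x. indicator (cball 0 (real m)) x *\<^sub>R ?w x) \<in> borel_measurable lborel" for m
  proof -
    have "set_integrable lborel (cball 0 (real m)) ?w"
      using assms by (simp add: ACLn_def)
    then show ?thesis unfolding set_integrable_def by (rule borel_measurable_integrable)
  qed
  have "?w \<in> borel_measurable lborel"
  proof (rule borel_measurable_LIMSEQ_real[OF _ cut])
    fix x :: 'a
    obtain m0 :: nat where "norm x \<le> m0" using real_arch_simple by blast
    then have "\<forall>\<^sub>F m in sequentially. indicator (cball 0 (real m)) x *\<^sub>R ?w x = ?w x"
      by (intro eventually_sequentiallyI[of m0]) auto
    then show "(\<lambda>m. indicator (cball 0 (real m)) x *\<^sub>R ?w x) \<longlonglongrightarrow> ?w x"
      by (rule tendsto_eventually)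
  qed
  then have [measurable]: "?w \<in> borel_measurable borel" by simp
  have "(\<lambda>x. root DIM('a) (?w x)) \<in> borel_measurable borel" by measurable
  then show ?thesis by (simp add: real_root_power_cancel)
qed

text \<open>
  The constant found in the proof depends only on \<open>\<alpha>\<close>, the dimension and the constant of uniform perfectness.
\<close>

theorem ball_cap_lower_bound:
  fixes G :: "'a::euclidean_space set"
  assumes "open G" "uniformly_perfect (ext_boundary G)" "0 < \<alpha>" "\<alpha> < 1"
  shows "\<exists>s>0. \<forall>x\<in>G. ennreal s \<le> ball_cap \<alpha> G x"
proof -
  obtain c where c: "0 < c" "c < 1" "UP c (ext_boundary G)"
    using assms(2) by (auto simp: uniformly_perfect_def)
  define E where "E = frontier G"
  note fp = finite_points_ext_boundary[of G, folded E_def]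
  have "E \<noteq> {}"
  proof -
    obtain y z where "y \<in> ext_boundary G" "z \<in> ext_boundary G" "y \<noteq> z"
      using c(3) by (auto simp: UP_def)
    then obtain w where "Some w \<in> ext_boundary G" by (metis not_None_eq)
    then show ?thesis using fp by blast
  qed
  have "closed E" by (simp add: E_def)
  define \<kappa> where "\<kappa> = c / (4 * DIM('a))"
  define K where "K = DIM('a) * (2 * DIM('a) / \<alpha>) ^ (DIM('a) - 1)
                + 2 * DIM('a) * (DIM('a) * (2 / \<kappa>) ^ (DIM('a) - 1))"
  have n: "1 \<le> real DIM('a)" using DIM_positive[where 'a='a] by linarith
  have "0 < \<kappa>" using c n by (simp add: \<kappa>_def)
  then have "0 < K" unfolding K_def using n \<open>0 < \<alpha>\<close> by (intro add_pos_pos mult_pos_pos zero_less_power divide_pos_pos) auto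
  define s where "s = (1 / (2 * K)) ^ DIM('a)"
  have "0 < s" using \<open>0 < K\<close> by (simp add: s_def)
  moreover have "ennreal s \<le> ball_cap \<alpha> G x" if "x \<in> G" for x
  proof -
    define d where "d = infdist x E"
    have "E \<inter> G = {}" using \<open>open G\<close> by (auto simp: E_def frontier_def interior_open)
    then have "0 < d"
      unfolding d_def using \<open>x \<in> G\<close> \<open>closed E\<close> \<open>E \<noteq> {}\<close> by (intro infdist_pos_not_in_closed) auto
    obtain a where a: "a \<in> E" "infdist x E = dist x a"
      using infdist_attains_inf[OF \<open>closed E\<close> \<open>E \<noteq> {}\<close>] by blast
    have dense: "\<exists>p'\<in>E. c * r < norm (p' - p) \<and> norm (p' - p) < r"
      if "p \<in> E" "0 < r" "r < d" for p r
    proof -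
      have "ereal r < ext_diameter (ext_boundary G) / 2"
      proof (cases "None \<in> ext_boundary G")
        case True
        then show ?thesis by (simp add: ext_diameter_def)
      next
        case False
        then have "bounded G" by (simp add: infinity_in_ext_boundary_iff)
        then have "2 * d \<le> diameter E"
          using twice_boundary_dist_le_diameter[OF \<open>open G\<close> _ \<open>x \<in> G\<close>] by (simp add: d_def E_def)
        then have "r < diameter E / 2" using that by linarith
        then show ?thesis using False by (simp add: ext_diameter_def fp)
      qed
      then have "{x \<in> E. c * r < norm (x - p) \<and> norm (x - p) < r} \<noteq> {}"
        using c(3) that unfolding UP_def fp by blast
      then show ?thesis by blast
    qed
    show ?thesis
      unfolding ball_cap_def cap_def boundary_dist_def fp
    proof (rule INF_greatest)
      fix u assume "u \<in> cap_admissible G (cball x (\<alpha> * infdist x E))"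
      then have u: "ACLn u" "\<And>x. 0 \<le> u x" "compact (closure {x. u x \<noteq> 0})"
          "closure {x. u x \<noteq> 0} \<subseteq> G" "\<And>y. y \<in> cball x (\<alpha> * d) \<Longrightarrow> 1 \<le> u y"
        by (auto simp: cap_admissible_def d_def)
      show "ennreal s \<le> (\<integral>\<^sup>+ x. ennreal (norm (grad u x) ^ DIM('a)) \<partial>lborel)"
      proof (cases "(\<integral>\<^sup>+ x. ennreal (norm (grad u x) ^ DIM('a)) \<partial>lborel) < \<infinity>")
        case True
        interpret finite_energy u
          using u True by unfold_locales (auto simp: ACLn_def intro: ACLn_measurable_partial_deriv)
        have zero: "u p = 0" if "p \<in> E" for p
        proof (rule ccontr)
          assume "u p \<noteq> 0"
          then have "p \<in> closure {x. u x \<noteq> 0}" using closure_subset[of "{x. u x \<noteq> 0}"] by auto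
          then show False using that u(4) \<open>E \<inter> G = {}\<close> by blast
        qed
        have "norm (x - a) = d" using a by (simp add: d_def dist_norm)
        then have "s \<le> energy UNIV"
          unfolding s_def
          by (intro energy_lower_bound[OF c(1,2) assms(3,4) \<open>0 < d\<close> dense zero u(3) a(1) _ u(5) \<kappa>_def K_def])
        then have "ennreal s \<le> ennreal (energy UNIV)" by (rule ennreal_leI)
        then show ?thesis unfolding ennreal_energy by simp
      next
        case False
        then show ?thesis by (simp add: not_less top_unique)
      qed
    qed
  qed
  ultimately show ?thesis by blast
qed

section \<open>Logarithmic cutoff functions\<close>

text \<open>
  A \<open>C\<^sup>1\<close> function \<open>u\<close> together with its partial derivatives \<open>g i\<close>.
\<close>

definition continuous_partials :: "('a::euclidean_space \<Rightarrow> real) \<Rightarrow> ('a \<Rightarrow> 'a \<Rightarrow> real) \<Rightarrow> bool" where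
  "continuous_partials u g \<longleftrightarrow> continuous_on UNIV u \<and>
     (\<forall>i\<in>Basis. continuous_on UNIV (g i) \<and>
        (\<forall>x. ((\<lambda>t. u (x + t *\<^sub>R i)) has_real_derivative g i x) (at 0)))"

lemma partial_deriv_continuous_partials:
  assumes "continuous_partials u g" "i \<in> Basis"
  shows "partial_deriv i u x = g i x"
  using assms unfolding continuous_partials_def partial_deriv_def by (auto intro: DERIV_imp_deriv)

lemma grad_continuous_partials:
  assumes "continuous_partials u g"
  shows "grad u x = (\<Sum>i\<in>Basis. g i x *\<^sub>R i)"
  unfolding grad_def using assms by (intro sum.cong) (auto simp: partial_deriv_continuous_partials)

lemma continuous_partials_diff:
  assumes "continuous_partials u g" "continuous_partials v h"
  shows "continuous_partials (\<lambda>x. u x - v x) (\<lambda>i x. g i x - h i x)"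
  using assms unfolding continuous_partials_def
  by (auto intro!: continuous_intros derivative_eq_intros)

lemma abs_continuous_of_bounded_deriv:
  assumes "\<And>t. t \<in> {a..b} \<Longrightarrow> (f has_real_derivative f' t) (at t)"
    and bound: "\<And>t. t \<in> {a..b} \<Longrightarrow> \<bar>f' t\<bar> \<le> B"
  shows "abs_continuous_on {a..b} f"
  unfolding abs_continuous_on_def
proof (intro allI impI)
  fix \<epsilon> :: real assume "0 < \<epsilon>"
  define M where "M = \<bar>B\<bar> + 1"
  have "0 < M" by (simp add: M_def)
  have lip: "\<bar>f q - f p\<bar> \<le> M * (q - p)" if "p \<in> {a..b}" "q \<in> {a..b}" "p < q" for p q
  proof -
    have "norm (f q - f p) \<le> M * norm (q - p)"
      using assms bound
      by (intro field_differentiable_bound[of "{a..b}" f f'])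
         (use that in \<open>force simp: M_def intro: has_field_derivative_at_within\<close>)+
    then show ?thesis using that by simp
  qed
  have "(\<Sum>(p, q)\<in>P. \<bar>f q - f p\<bar>) < \<epsilon>"
    if P: "\<forall>(p, q)\<in>P. p \<in> {a..b} \<and> q \<in> {a..b} \<and> p < q" "(\<Sum>(p, q)\<in>P. q - p) < \<epsilon> / M" for P
  proof -
    have "(\<Sum>(p, q)\<in>P. \<bar>f q - f p\<bar>) \<le> (\<Sum>(p, q)\<in>P. M * (q - p))"
      using P(1) lip by (intro sum_mono) auto
    also have "\<dots> = M * (\<Sum>(p, q)\<in>P. q - p)" by (simp add: sum_distrib_left case_prod_unfold)
    also have "\<dots> < \<epsilon>" using P(2) \<open>0 < M\<close> by (simp add: pos_less_divide_eq mult.commute)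
    finally show ?thesis .
  qed
  then show "\<exists>\<delta>>0. \<forall>P. finite P \<longrightarrow> (\<forall>(p, q)\<in>P. p \<in> {a..b} \<and> q \<in> {a..b} \<and> p < q) \<longrightarrow>
        disjoint_family_on (\<lambda>(p, q). {p<..<q}) P \<longrightarrow> (\<Sum>(p, q)\<in>P. q - p) < \<delta> \<longrightarrow>
        (\<Sum>(p, q)\<in>P. \<bar>f q - f p\<bar>) < \<epsilon>"
    using \<open>0 < M\<close> \<open>0 < \<epsilon>\<close> by (intro exI[of _ "\<epsilon> / M"]) simp
qed

lemma ACLn_continuous_partials:
  fixes u :: "'a::euclidean_space \<Rightarrow> real"
  assumes cp: "continuous_partials u g"
  shows "ACLn u"
  unfolding ACLn_def ACL_def
proof (intro conjI allI ballI impI)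
  show "continuous_on UNIV u" using cp by (simp add: continuous_partials_def)
next
  fix a b i :: 'a assume i: "i \<in> Basis"
  have gi: "continuous_on UNIV (g i)" using cp i by (simp add: continuous_partials_def)
  have ac: "abs_continuous_on {a \<bullet> i..b \<bullet> i} (\<lambda>t. u (line_point i y t))" for y
  proof -
    have "continuous_on {a \<bullet> i..b \<bullet> i} (\<lambda>t. g i (line_point i y t))"
      unfolding line_point_def by (intro continuous_on_compose2[OF gi]) (auto intro!: continuous_intros)
    then have "compact ((\<lambda>t. g i (line_point i y t)) ` {a \<bullet> i..b \<bullet> i})"
      by (rule compact_continuous_image) simp
    then have "bounded ((\<lambda>t. g i (line_point i y t)) ` {a \<bullet> i..b \<bullet> i})" by (rule compact_imp_bounded)
    then obtain B where B: "\<And>t. t \<in> {a \<bullet> i..b \<bullet> i} \<Longrightarrow> \<bar>g i (line_point i y t)\<bar> \<le> B"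
      unfolding bounded_real by blast
    show ?thesis
    proof (rule abs_continuous_of_bounded_deriv[OF _ B])
      fix t
      have "((\<lambda>s. u (line_point i y t + s *\<^sub>R i)) has_real_derivative g i (line_point i y t)) (at 0)"
        using cp i by (simp add: continuous_partials_def)
      moreover have "(\<lambda>s. u (line_point i y t + s *\<^sub>R i)) = (\<lambda>s. u (line_point i y (s + t)))"
        by (simp add: line_point_def algebra_simps)
      ultimately show "((\<lambda>t. u (line_point i y t)) has_real_derivative g i (line_point i y t)) (at t)"
        using DERIV_shift[of "\<lambda>t. u (line_point i y t)" "g i (line_point i y t)" 0 t] by simp
    qed
  qed
  show "AE y in Pi\<^sub>M (Basis - {i}) (\<lambda>_. lborel).
        (\<forall>j\<in>Basis - {i}. y j \<in> {a \<bullet> j..b \<bullet> j}) \<longrightarrow>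
        abs_continuous_on {a \<bullet> i..b \<bullet> i} (\<lambda>t. u (t *\<^sub>R i + (\<Sum>j\<in>Basis - {i}. y j *\<^sub>R j)))"
    using ac unfolding line_point_def by (intro AE_I2) simp
next
  fix i :: 'a and K :: "'a set" assume i: "i \<in> Basis" and "compact K"
  have gi: "continuous_on UNIV (g i)" using cp i by (simp add: continuous_partials_def)
  then have "continuous_on K (\<lambda>x. \<bar>g i x\<bar> ^ DIM('a))"
    by (intro continuous_intros) (auto intro: continuous_on_subset)
  then show "set_integrable lborel K (\<lambda>x. \<bar>partial_deriv i u x\<bar> ^ DIM('a))"
    unfolding partial_deriv_continuous_partials[OF cp i] set_integrable_def
    using \<open>compact K\<close> by (intro borel_integrable_compact)
qed

text \<open>
  A \<open>C\<^sup>1\<close> step from \<open>1\<close> to \<open>0\<close> over the interval from \<open>1\<close> to \<open>4\<close>: the quotient \<open>P / (P + Q)\<close> with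
  \<open>P\<close> and \<open>Q\<close> the squared positive parts of \<open>4 - t\<close> and \<open>t - 1\<close>. It will be applied to squared norms, for which the interval
  corresponds to one doubling of the norm.
\<close>

lemma smooth_step:
  obtains \<phi> \<phi>' :: "real \<Rightarrow> real" and M :: real
  where "\<And>t. (\<phi> has_real_derivative \<phi>' t) (at t)" "continuous_on UNIV \<phi>'"
    "\<And>t. 0 \<le> \<phi> t" "\<And>t. \<phi> t \<le> 1" "\<And>t. t \<le> 1 \<Longrightarrow> \<phi> t = 1" "\<And>t. 4 \<le> t \<Longrightarrow> \<phi> t = 0"
    "\<And>t. t \<le> 1 \<Longrightarrow> \<phi>' t = 0" "\<And>t. 4 \<le> t \<Longrightarrow> \<phi>' t = 0" "\<And>t. \<bar>\<phi>' t\<bar> \<le> M" "0 \<le> M"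
proof -
  define sq :: "real \<Rightarrow> real" where "sq t = (max 0 t)\<^sup>2" for t
  have sq: "(sq has_real_derivative 2 * max 0 t) (at t)" for t
  proof -
    consider "t < 0" | "t = 0" | "0 < t" by linarith
    then show ?thesis
    proof cases
      case 1
      have "((\<lambda>_. 0) has_real_derivative 2 * max 0 t) (at t)" using 1 by simp
      then show ?thesis
        by (rule has_field_derivative_transform_within_open[of _ _ _ "{..<0}"]) (use 1 in \<open>auto simp: sq_def\<close>)
    next
      case 2
      have "((\<lambda>h. (sq h - sq 0) / (h - 0)) \<longlongrightarrow> 0) (at 0)"
      proof (rule Lim_null_comparison)
        show "\<forall>\<^sub>F h in at 0. norm ((sq h - sq 0) / (h - 0)) \<le> \<bar>h\<bar>"
          by (intro always_eventually allI) (auto simp: sq_def max_def power2_eq_square)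
        show "((\<lambda>h. \<bar>h\<bar>) \<longlongrightarrow> (0::real)) (at 0)" by (intro tendsto_eq_intros) auto
      qed
      then show ?thesis using 2 by (simp add: has_field_derivative_iff)
    next
      case 3
      have "((\<lambda>t. t\<^sup>2) has_real_derivative 2 * max 0 t) (at t)"
        using 3 by (auto intro!: derivative_eq_intros)
      then show ?thesis
        by (rule has_field_derivative_transform_within_open[of _ _ _ "{0<..}"]) (use 3 in \<open>auto simp: sq_def\<close>)
    qed
  qed
  define \<phi> where "\<phi> t = sq (4 - t) / (sq (4 - t) + sq (t - 1))" for t
  define \<phi>' where "\<phi>' t = ((- (2 * max 0 (4 - t))) * (sq (4 - t) + sq (t - 1))
      - sq (4 - t) * (- (2 * max 0 (4 - t)) + 2 * max 0 (t - 1))) / ((sq (4 - t) + sq (t - 1)) * (sq (4 - t) + sq (t - 1)))" for t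
  have sq0: "0 \<le> sq t" for t by (simp add: sq_def)
  have pos: "0 < sq (4 - t) + sq (t - 1)" for t
    by (cases "t < 4") (auto simp: sq_def max_def intro: add_pos_nonneg add_nonneg_pos)
  have d1: "((\<lambda>t. sq (4 - t)) has_real_derivative - (2 * max 0 (4 - t))) (at t)" for t
  proof -
    have "((\<lambda>t. sq (4 - t)) has_real_derivative (2 * max 0 (4 - t)) * (- 1)) (at t)"
      by (rule DERIV_chain2[where f = sq, OF sq]) (auto intro!: derivative_eq_intros)
    then show ?thesis by simp
  qed
  have d2: "((\<lambda>t. sq (t - 1)) has_real_derivative 2 * max 0 (t - 1)) (at t)" for t
  proof -
    have "((\<lambda>t. sq (t - 1)) has_real_derivative (2 * max 0 (t - 1)) * 1) (at t)"
      by (rule DERIV_chain2[where f = sq, OF sq]) (auto intro!: derivative_eq_intros)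
    then show ?thesis by simp
  qed
  have der: "(\<phi> has_real_derivative \<phi>' t) (at t)" for t
    unfolding \<phi>_def[abs_def] \<phi>'_def using pos[of t]
    by (intro DERIV_divide d1 DERIV_add d2) auto
  have csq: "continuous_on UNIV sq"
    unfolding sq_def[abs_def] by (intro continuous_intros)
  have cont: "continuous_on UNIV \<phi>'"
    unfolding \<phi>'_def using pos
    by (intro continuous_intros continuous_on_compose2[OF csq]) (auto simp: less_imp_neq[symmetric])
  have low: "\<phi>' t = 0" if "t \<le> 1" for t using that by (simp add: \<phi>'_def sq_def)
  have high: "\<phi>' t = 0" if "4 \<le> t" for t using that by (simp add: \<phi>'_def sq_def)
  have "compact (\<phi>' ` {1..4})"
    by (intro compact_continuous_image continuous_on_subset[OF cont]) auto
  then have "bounded (\<phi>' ` {1..4})" by (rule compact_imp_bounded)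
  then obtain M where M: "\<And>t. t \<in> {1..4} \<Longrightarrow> \<bar>\<phi>' t\<bar> \<le> M"
    unfolding bounded_real by blast
  have "0 \<le> M" using M[of 1] by simp
  then have bd: "\<bar>\<phi>' t\<bar> \<le> M" for t
    using M[of t] low[of t] high[of t] by (cases "t \<in> {1..4}") auto
  show thesis
  proof (rule that[OF der cont])
    show "0 \<le> \<phi> t" for t unfolding \<phi>_def using sq0 by (intro divide_nonneg_nonneg add_nonneg_nonneg)
    show "\<phi> t \<le> 1" for t unfolding \<phi>_def using pos[of t] sq0[of "t - 1"] by (simp add: pos_divide_le_eq)
    show "\<phi> t = 1" if "t \<le> 1" for t unfolding \<phi>_def using pos[of t] that by (simp add: sq_def)
    show "\<phi> t = 0" if "4 \<le> t" for t unfolding \<phi>_def using that by (simp add: sq_def)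
  qed (use low high bd \<open>0 \<le> M\<close> in auto)
qed

lemma power_sum_at_most_one_nonzero:
  fixes f :: "'b \<Rightarrow> real"
  assumes "finite S" "0 < n" "\<And>k l. k \<in> S \<Longrightarrow> l \<in> S \<Longrightarrow> f k \<noteq> 0 \<Longrightarrow> f l \<noteq> 0 \<Longrightarrow> k = l"
  shows "(\<Sum>k\<in>S. f k) ^ n = (\<Sum>k\<in>S. f k ^ n)"
proof (cases "\<exists>k\<in>S. f k \<noteq> 0")
  case True
  then obtain k where k: "k \<in> S" "f k \<noteq> 0" by blast
  then have z: "f l = 0" if "l \<in> S - {k}" for l using assms(3)[of k l] that by auto
  then have "(\<Sum>l\<in>S. f l) = f k" "(\<Sum>l\<in>S. f l ^ n) = f k ^ n"
    using sum.remove[OF assms(1) k(1), of f] sum.remove[OF assms(1) k(1), of "\<lambda>l. f l ^ n"] assms(2)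
    by auto
  then show ?thesis by simp
qed (use assms in auto)

text \<open>
  The average of \<open>N\<close> rescaled steps, one for each dyadic scale between \<open>s\<close> and \<open>2\<^sup>N s\<close>. Every
  step has the same energy up to scaling, their gradients live on disjoint rings, and the factor \<open>1 / N\<close>
  enters with power \<open>n\<close>. The energy is therefore of order \<open>N / N\<^sup>n\<close>, which tends to \<open>0\<close> as \<open>n \<ge> 2\<close>.
\<close>

lemma logarithmic_cutoff:
  assumes dim: "2 \<le> DIM('a::euclidean_space)"
  obtains C :: real where "0 \<le> C"
    and "\<And>N (a :: 'a) s. 0 < N \<Longrightarrow> 0 < s \<Longrightarrow> \<exists>u g. continuous_partials u g \<and>
      (\<forall>x. 0 \<le> u x \<and> u x \<le> 1) \<and> (\<forall>x. norm (x - a) \<le> s \<longrightarrow> u x = 1) \<and>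
      (\<forall>x. 2 ^ N * s \<le> norm (x - a) \<longrightarrow> u x = 0) \<and>
      (\<integral>\<^sup>+x. ennreal (norm (grad u x) ^ DIM('a)) \<partial>lborel) \<le> ennreal (C / real N)"
proof -
  define n where "n = DIM('a)"
  obtain \<phi> \<phi>' :: "real \<Rightarrow> real" and M where \<phi>: "\<And>t. (\<phi> has_real_derivative \<phi>' t) (at t)" "continuous_on UNIV \<phi>'"
    "\<And>t. 0 \<le> \<phi> t" "\<And>t. \<phi> t \<le> 1" "\<And>t. t \<le> 1 \<Longrightarrow> \<phi> t = 1" "\<And>t. 4 \<le> t \<Longrightarrow> \<phi> t = 0"
    "\<And>t. t \<le> 1 \<Longrightarrow> \<phi>' t = 0" "\<And>t. 4 \<le> t \<Longrightarrow> \<phi>' t = 0" "\<And>t. \<bar>\<phi>' t\<bar> \<le> M" "0 \<le> M"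
    using smooth_step by metis
  have "continuous_on UNIV \<phi>"
    using \<phi>(1) by (meson DERIV_isCont continuous_at_imp_continuous_on)
  define C where "C = (16 * M) ^ n"
  have "0 \<le> C" using \<phi>(10) by (simp add: C_def)
  moreover have "\<exists>u g. continuous_partials u g \<and>
      (\<forall>x. 0 \<le> u x \<and> u x \<le> 1) \<and> (\<forall>x. norm (x - a) \<le> s \<longrightarrow> u x = 1) \<and>
      (\<forall>x. 2 ^ N * s \<le> norm (x - a) \<longrightarrow> u x = 0) \<and>
      (\<integral>\<^sup>+x. ennreal (norm (grad u x) ^ DIM('a)) \<partial>lborel) \<le> ennreal (C / real N)"
    if "0 < N" "0 < s" for N and a :: 'a and s
  proof -
    \<comment> \<open>The \<open>k\<close>-th step acts where the squared distance from \<open>a\<close> lies between \<open>b k\<close> and \<open>b (Suc k)\<close>.\<close>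
    define b where "b k = (2 ^ k * s)\<^sup>2" for k
    have b: "0 < b k" for k using \<open>0 < s\<close> by (simp add: b_def)
    have b_Suc: "b (Suc k) = 4 * b k" for k by (simp add: b_def power2_eq_square)
    have b_mono: "b k \<le> b l" if "k \<le> l" for k l
      unfolding b_def using that \<open>0 < s\<close> by (intro power_mono mult_right_mono power_increasing) auto
    define \<rho> where "\<rho> k x = (x - a) \<bullet> (x - a) / b k" for k and x :: 'a
    define u where "u x = (\<Sum>k<N. \<phi> (\<rho> k x)) / N" for x
    define w where "w k x = \<phi>' (\<rho> k x) * (2 / b k)" for k x
    define g where "g i x = (\<Sum>k<N. w k x * ((x - a) \<bullet> i)) / N" for i x
    have c\<rho>: "continuous_on UNIV (\<rho> k)" for k
      unfolding \<rho>_def using b[of k] by (intro continuous_intros) auto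
    have cp: "continuous_partials u g"
      unfolding continuous_partials_def
    proof (intro conjI ballI allI)
      show "continuous_on UNIV u"
        unfolding u_def using \<open>0 < N\<close>
        by (intro continuous_intros continuous_on_compose2[OF \<open>continuous_on UNIV \<phi>\<close> c\<rho>]) auto
      fix i :: 'a assume i: "i \<in> Basis"
      show "continuous_on UNIV (g i)"
        unfolding g_def w_def using \<open>0 < N\<close> b
        by (intro continuous_intros continuous_on_compose2[OF \<phi>(2) c\<rho>]) (auto simp: less_imp_neq[symmetric])
      fix x
      have d\<rho>: "((\<lambda>t. \<rho> k (x + t *\<^sub>R i)) has_real_derivative 2 * ((x - a) \<bullet> i) / b k) (at 0)" for k
      proof -
        have "\<rho> k (x + t *\<^sub>R i) = ((x - a) \<bullet> (x - a) + 2 * t * ((x - a) \<bullet> i) + t\<^sup>2) / b k" for t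
          unfolding \<rho>_def using i
          by (simp add: inner_diff_left inner_diff_right inner_add_left inner_add_right inner_commute power2_eq_square algebra_simps)
        then show ?thesis
          using b[of k] by (auto intro!: derivative_eq_intros)
      qed
      have "((\<lambda>t. \<phi> (\<rho> k (x + t *\<^sub>R i))) has_real_derivative \<phi>' (\<rho> k x) * (2 * ((x - a) \<bullet> i) / b k)) (at 0)" for k
        using \<phi>(1)[of "\<rho> k x"] by (intro DERIV_chain2[where f = \<phi>, OF _ d\<rho>]) simp
      then have "((\<lambda>t. (\<Sum>k<N. \<phi> (\<rho> k (x + t *\<^sub>R i))) / N) has_real_derivative
          (\<Sum>k<N. \<phi>' (\<rho> k x) * (2 * ((x - a) \<bullet> i) / b k)) / N) (at 0)"
        by (intro DERIV_cdivide DERIV_sum)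
      moreover have "(\<Sum>k<N. \<phi>' (\<rho> k x) * (2 * ((x - a) \<bullet> i) / b k)) / N = g i x"
        by (simp add: g_def w_def mult.assoc)
      ultimately show "((\<lambda>t. u (x + t *\<^sub>R i)) has_real_derivative g i x) (at 0)"
        unfolding u_def by simp
    qed
    have range: "0 \<le> u x \<and> u x \<le> 1" for x
    proof -
      have "(\<Sum>k<N. \<phi> (\<rho> k x)) \<le> (\<Sum>k<N. 1)" using \<phi>(4) by (intro sum_mono)
      then show ?thesis unfolding u_def using \<phi>(3) \<open>0 < N\<close> by (simp add: sum_nonneg)
    qed
    have inside: "u x = 1" if "norm (x - a) \<le> s" for x
    proof -
      have "\<rho> k x \<le> 1" for k
      proof -
        have "(x - a) \<bullet> (x - a) \<le> s\<^sup>2"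
          using that by (simp add: dot_square_norm power_mono)
        also have "s\<^sup>2 = b 0" by (simp add: b_def)
        also have "b 0 \<le> b k" by (rule b_mono) simp
        finally show ?thesis unfolding \<rho>_def using b[of k] by simp
      qed
      then show ?thesis using \<phi>(5) \<open>0 < N\<close> by (simp add: u_def)
    qed
    have outside: "u x = 0" if "2 ^ N * s \<le> norm (x - a)" for x
    proof -
      have "4 \<le> \<rho> k x" if "k < N" for k
      proof -
        have "4 * b k \<le> b N" using b_mono[of "Suc k" N] that by (simp add: b_Suc)
        also have "b N \<le> (x - a) \<bullet> (x - a)"
          unfolding b_def dot_square_norm using \<open>2 ^ N * s \<le> norm (x - a)\<close> \<open>0 < s\<close> by (intro power_mono) auto
        finally show ?thesis unfolding \<rho>_def using b[of k] by (simp add: pos_le_divide_eq)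
      qed
      then show ?thesis using \<phi>(6) by (simp add: u_def)
    qed
    define T where "T k x = \<bar>w k x\<bar> * norm (x - a)" for k x
    have T_nz: "b k < (x - a) \<bullet> (x - a) \<and> (x - a) \<bullet> (x - a) < b (Suc k)" if "T k x \<noteq> 0" for k x
    proof -
      have "\<phi>' (\<rho> k x) \<noteq> 0" using that by (auto simp: T_def w_def)
      then have "1 < \<rho> k x" "\<rho> k x < 4"
        using \<phi>(7)[of "\<rho> k x"] \<phi>(8)[of "\<rho> k x"] by (auto simp: not_le[symmetric])
      then show ?thesis unfolding \<rho>_def b_Suc using b[of k] by (simp add: pos_less_divide_eq pos_divide_less_eq)
    qed
    have T_le: "T k x \<le> 4 * M / (2 ^ k * s) * indicator (cball a (2 ^ Suc k * s)) x" for k x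
    proof (cases "T k x = 0")
      case True
      then show ?thesis using \<phi>(10) \<open>0 < s\<close> by (simp add: indicator_def)
    next
      case False
      have "(norm (x - a))\<^sup>2 < (2 ^ Suc k * s)\<^sup>2"
        using T_nz[OF False] by (simp only: b_def dot_square_norm)
      then have nx: "norm (x - a) \<le> 2 ^ Suc k * s"
        by (rule power2_le_imp_le[OF less_imp_le]) (use \<open>0 < s\<close> in simp)
      have "T k x \<le> (M * (2 / b k)) * (2 ^ Suc k * s)"
        unfolding T_def w_def abs_mult
        using nx \<phi>(9)[of "\<rho> k x"] \<phi>(10) b[of k] by (intro mult_mono) auto
      also have "\<dots> = 4 * M / (2 ^ k * s)"
        using \<open>0 < s\<close> by (simp add: b_def power2_eq_square)
      finally show ?thesis using nx by (simp add: indicator_def dist_norm norm_minus_commute)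
    qed
    have "norm (grad u x) \<le> (\<Sum>k<N. T k x) / N" for x
    proof -
      have "grad u x = (\<Sum>i\<in>Basis. ((\<Sum>k<N. w k x) / N) *\<^sub>R (((x - a) \<bullet> i) *\<^sub>R i))"
        unfolding grad_continuous_partials[OF cp]
        by (intro sum.cong) (auto simp: g_def sum_distrib_right)
      also have "\<dots> = ((\<Sum>k<N. w k x) / N) *\<^sub>R (\<Sum>i\<in>Basis. ((x - a) \<bullet> i) *\<^sub>R i)"
        by (simp add: scaleR_sum_right)
      also have "\<dots> = ((\<Sum>k<N. w k x) / N) *\<^sub>R (x - a)" by (simp add: euclidean_representation)
      finally have "norm (grad u x) = \<bar>\<Sum>k<N. w k x\<bar> * norm (x - a) / N" by simp
      also have "\<dots> \<le> (\<Sum>k<N. \<bar>w k x\<bar>) * norm (x - a) / N"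
        by (intro divide_right_mono mult_right_mono sum_abs) auto
      finally show ?thesis by (simp add: T_def sum_distrib_right)
    qed
    then have "norm (grad u x) ^ n \<le> ((\<Sum>k<N. T k x) / N) ^ n" for x by (intro power_mono) auto
    also have "((\<Sum>k<N. T k x) / N) ^ n = (\<Sum>k<N. T k x ^ n) / N ^ n" for x
    proof -
      have "k = l" if "T k x \<noteq> 0" "T l x \<noteq> 0" for k l
      proof (rule ccontr)
        assume "k \<noteq> l"
        then consider "Suc k \<le> l" | "Suc l \<le> k" by linarith
        then show False
          using T_nz[OF that(1)] T_nz[OF that(2)] b_mono[of "Suc k" l] b_mono[of "Suc l" k] by cases linarith+
      qed
      then show ?thesis
        by (simp add: power_divide power_sum_at_most_one_nonzero n_def)
    qed
    also have "(\<Sum>k<N. T k x ^ n) / N ^ n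
        \<le> (\<Sum>k<N. (4 * M / (2 ^ k * s)) ^ n / N ^ n * indicator (cball a (2 ^ Suc k * s)) x)" for x
      unfolding sum_divide_distrib
    proof (rule sum_mono)
      fix k
      have "T k x ^ n \<le> (4 * M / (2 ^ k * s) * indicator (cball a (2 ^ Suc k * s)) x) ^ n"
        by (intro power_mono T_le) (simp add: T_def)
      also have "\<dots> = (4 * M / (2 ^ k * s)) ^ n * indicator (cball a (2 ^ Suc k * s)) x"
        unfolding power_mult_distrib by (simp add: indicator_def n_def)
      finally have "T k x ^ n / N ^ n \<le> (4 * M / (2 ^ k * s)) ^ n * indicator (cball a (2 ^ Suc k * s)) x / N ^ n"
        by (rule divide_right_mono) simp
      then show "T k x ^ n / N ^ n \<le> (4 * M / (2 ^ k * s)) ^ n / N ^ n * indicator (cball a (2 ^ Suc k * s)) x" by simp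
    qed
    finally have pointwise: "norm (grad u x) ^ n
        \<le> (\<Sum>k<N. (4 * M / (2 ^ k * s)) ^ n / N ^ n * indicator (cball a (2 ^ Suc k * s)) x)" for x .
    define A where "A k = (4 * M / (2 ^ k * s)) ^ n / N ^ n" for k
    have A: "0 \<le> A k" for k using \<phi>(10) \<open>0 < s\<close> by (simp add: A_def)
    have ball: "emeasure lborel (cball a r) \<le> ennreal ((2 * r) ^ n)" if "0 < r" for r
    proof -
      have "cball a r \<subseteq> cbox (a - r *\<^sub>R One) (a + r *\<^sub>R One)"
      proof
        fix x assume "x \<in> cball a r"
        then have "\<bar>(x - a) \<bullet> j\<bar> \<le> r" if "j \<in> Basis" for j
          using Basis_le_norm[OF that, of "x - a"] by (simp add: dist_norm norm_minus_commute)
        then show "x \<in> cbox (a - r *\<^sub>R One) (a + r *\<^sub>R One)"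
          by (auto simp: cbox_def inner_diff_left inner_add_left abs_le_iff algebra_simps)
      qed
      then have "emeasure lborel (cball a r) \<le> emeasure lborel (cbox (a - r *\<^sub>R One) (a + r *\<^sub>R One))"
        by (rule emeasure_mono) simp
      also have "\<dots> = ennreal ((2 * r) ^ n)"
        using that by (simp add: emeasure_lborel_cbox inner_diff_left inner_add_left algebra_simps n_def)
      finally show ?thesis .
    qed
    have "(\<integral>\<^sup>+x. ennreal (norm (grad u x) ^ n) \<partial>lborel)
        \<le> (\<integral>\<^sup>+x. (\<Sum>k<N. ennreal (A k) * indicator (cball a (2 ^ Suc k * s)) x) \<partial>lborel)"
    proof (rule nn_integral_mono)
      fix x
      have "ennreal (norm (grad u x) ^ n) \<le> ennreal (\<Sum>k<N. A k * indicator (cball a (2 ^ Suc k * s)) x)"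
        using pointwise unfolding A_def by (rule ennreal_leI)
      also have "\<dots> = (\<Sum>k<N. ennreal (A k * indicator (cball a (2 ^ Suc k * s)) x))"
        using A by (intro sum_ennreal[symmetric]) simp
      also have "\<dots> = (\<Sum>k<N. ennreal (A k) * indicator (cball a (2 ^ Suc k * s)) x)"
        by (intro sum.cong) (auto simp: indicator_def)
      finally show "ennreal (norm (grad u x) ^ n) \<le> (\<Sum>k<N. ennreal (A k) * indicator (cball a (2 ^ Suc k * s)) x)" .
    qed
    also have "\<dots> = (\<Sum>k<N. ennreal (A k) * emeasure lborel (cball a (2 ^ Suc k * s)))"
      by (subst nn_integral_sum) (auto simp: nn_integral_cmult_indicator intro!: borel_measurable_times_ennreal borel_measurable_indicator)
    also have "\<dots> \<le> (\<Sum>k<N. ennreal (A k) * ennreal ((2 * (2 ^ Suc k * s)) ^ n))"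
      using \<open>0 < s\<close> by (intro sum_mono mult_left_mono ball) auto
    also have "\<dots> = (\<Sum>k<N. ennreal (C / N ^ n))"
    proof (rule sum.cong[OF refl])
      fix k
      have "A k * (2 * (2 ^ Suc k * s)) ^ n = ((4 * M / (2 ^ k * s)) * (2 * (2 ^ Suc k * s))) ^ n / N ^ n"
        unfolding A_def power_mult_distrib by simp
      also have "(4 * M / (2 ^ k * s)) * (2 * (2 ^ Suc k * s)) = 16 * M"
        using \<open>0 < s\<close> by simp
      finally show "ennreal (A k) * ennreal ((2 * (2 ^ Suc k * s)) ^ n) = ennreal (C / N ^ n)"
        using A by (simp add: ennreal_mult'[symmetric] C_def)
    qed
    also have "\<dots> = ennreal (\<Sum>k<N. C / N ^ n)"
      using \<open>0 \<le> C\<close> by (intro sum_ennreal) simp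
    also have "\<dots> \<le> ennreal (C / N)"
    proof (rule ennreal_leI)
      have "real N ^ 2 \<le> real N ^ n" using dim \<open>0 < N\<close> by (intro power_increasing) (auto simp: n_def)
      then have "C / N ^ n \<le> C / N ^ 2" using \<open>0 \<le> C\<close> \<open>0 < N\<close> by (intro divide_left_mono) auto
      then have "N * (C / N ^ n) \<le> N * (C / N ^ 2)" by (rule mult_left_mono) simp
      also have "\<dots> = C / N" using \<open>0 < N\<close> by (simp add: power2_eq_square)
      finally show "(\<Sum>k<N. C / N ^ n) \<le> C / N" by simp
    qed
    finally show ?thesis using cp range inside outside unfolding n_def by blast
  qed
  ultimately show thesis by (rule that)
qed

section \<open>A lower bound gives a uniformly perfect boundary\<close>

text \<open>
  The crude factor \<open>2\<^bsup>n\<^esup>\<close> is harmless, as both energies on the right will be arbitrarily small.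
\<close>

lemma energy_diff_le:
  fixes u v :: "'a::euclidean_space \<Rightarrow> real"
  assumes u: "continuous_partials u g" and v: "continuous_partials v h"
  shows "(\<integral>\<^sup>+x. ennreal (norm (grad (\<lambda>x. u x - v x) x) ^ DIM('a)) \<partial>lborel)
     \<le> ennreal (2 ^ DIM('a)) * ((\<integral>\<^sup>+x. ennreal (norm (grad u x) ^ DIM('a)) \<partial>lborel)
         + (\<integral>\<^sup>+x. ennreal (norm (grad v x) ^ DIM('a)) \<partial>lborel))"
proof -
  define n where "n = DIM('a)"
  have cont: "continuous_on UNIV (grad u)" if "continuous_partials u g" for u g
    using that unfolding grad_continuous_partials[OF that, abs_def] continuous_partials_def
    by (intro continuous_intros) auto
  have [measurable]: "grad u \<in> borel_measurable borel" "grad v \<in> borel_measurable borel"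
    using cont[OF u] cont[OF v] by (auto intro: borel_measurable_continuous_onI)
  have "(\<integral>\<^sup>+x. ennreal (norm (grad (\<lambda>x. u x - v x) x) ^ n) \<partial>lborel)
      \<le> (\<integral>\<^sup>+x. ennreal (2 ^ n) * (ennreal (norm (grad u x) ^ n) + ennreal (norm (grad v x) ^ n)) \<partial>lborel)"
  proof (rule nn_integral_mono)
    fix x
    have "grad (\<lambda>x. u x - v x) x = grad u x - grad v x"
      unfolding grad_continuous_partials[OF u] grad_continuous_partials[OF v]
        grad_continuous_partials[OF continuous_partials_diff[OF u v]]
      by (simp add: scaleR_diff_left sum_subtractf)
    then have "norm (grad (\<lambda>x. u x - v x) x) \<le> norm (grad u x) + norm (grad v x)"
      by (simp add: norm_triangle_ineq4)
    also have "\<dots> \<le> 2 * max (norm (grad u x)) (norm (grad v x))" by simp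
    finally have "norm (grad (\<lambda>x. u x - v x) x) ^ n \<le> (2 * max (norm (grad u x)) (norm (grad v x))) ^ n"
      by (rule power_mono) simp
    also have "\<dots> \<le> 2 ^ n * (norm (grad u x) ^ n + norm (grad v x) ^ n)"
      unfolding power_mult_distrib by (intro mult_left_mono) (auto simp: max_def)
    finally have "ennreal (norm (grad (\<lambda>x. u x - v x) x) ^ n)
        \<le> ennreal (2 ^ n * (norm (grad u x) ^ n + norm (grad v x) ^ n))" by (rule ennreal_leI)
    also have "\<dots> = ennreal (2 ^ n) * (ennreal (norm (grad u x) ^ n) + ennreal (norm (grad v x) ^ n))"
      by (simp add: ennreal_mult' ennreal_plus)
    finally show "ennreal (norm (grad (\<lambda>x. u x - v x) x) ^ n)
        \<le> ennreal (2 ^ n) * (ennreal (norm (grad u x) ^ n) + ennreal (norm (grad v x) ^ n))" .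
  qed
  also have "\<dots> = ennreal (2 ^ n) * ((\<integral>\<^sup>+x. ennreal (norm (grad u x) ^ n) \<partial>lborel)
         + (\<integral>\<^sup>+x. ennreal (norm (grad v x) ^ n) \<partial>lborel))"
    by (subst nn_integral_cmult, measurable, subst nn_integral_add) auto
  finally show ?thesis unfolding n_def .
qed

text \<open>
  The connected set \<open>G\<close> has points on both sides of the ring, hence in it; the ring is connected
  (in dimension at least \<open>2\<close>) and cannot leave \<open>G\<close> without meeting the boundary.
\<close>

lemma ring_subset_of_empty_boundary_ring:
  fixes G :: "'a::euclidean_space set"
  assumes dim: "2 \<le> DIM('a)" and "connected G" "a \<in> frontier G" "\<not> G \<subseteq> cball a r" "0 < q" "q < r"
    and empty: "{x \<in> frontier G. q < norm (x - a) \<and> norm (x - a) < r} = {}"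
  shows "{x. q < norm (x - a) \<and> norm (x - a) < r} \<subseteq> G"
proof -
  let ?A = "{x. q < norm (x - a) \<and> norm (x - a) < r}"
  obtain t where t: "q < t" "t < r" using \<open>q < r\<close> dense by blast
  have "a \<in> closure G" using assms(3) by (simp add: frontier_def)
  then obtain y where y: "y \<in> G" "dist y a < q" using \<open>0 < q\<close> closure_approachable by blast
  obtain z where z: "z \<in> G" "r < dist a z" using assms(4) by (auto simp: subset_iff not_le)
  have "connected ((\<lambda>x. norm (x - a)) ` G)"
    using \<open>connected G\<close> by (intro connected_continuous_image continuous_intros)
  moreover have "norm (y - a) \<in> (\<lambda>x. norm (x - a)) ` G" "norm (z - a) \<in> (\<lambda>x. norm (x - a)) ` G"
    using y z by auto
  moreover have "norm (y - a) \<le> t" "t \<le> norm (z - a)"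
    using y z t by (auto simp: dist_norm norm_minus_commute)
  ultimately have "t \<in> (\<lambda>x. norm (x - a)) ` G"
    by (meson connectedD_interval)
  then have "?A \<inter> G \<noteq> {}" using t by auto
  moreover have "connected ?A" using connected_annulus(1)[OF dim] .
  moreover have "?A \<inter> frontier G = {}" using empty by blast
  ultimately show ?thesis using connected_Int_frontier[of ?A G] by blast
qed

text \<open>
  For small \<open>\<kappa>\<close>, the constant \<open>c = \<kappa>\<^sup>2\<close> works. In an empty ring \<open>c r < |y - a| < r\<close> the
  competitor is \<open>u - v\<close>: the cutoff \<open>u\<close> decreases from \<open>1\<close> to \<open>0\<close> outside the ball around a point at
  distance \<open>\<kappa> r\<close> from \<open>a\<close>, and \<open>v\<close> does so between that ball and the inner boundary of the ring.
  The two cutoffs use \<open>N\<close> dyadic scales each.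
\<close>

theorem uniformly_perfect_of_ball_cap:
  fixes G :: "'a::euclidean_space set"
  assumes dim: "2 \<le> DIM('a)" and "open G" "connected G" "G \<noteq> {}" "0 < \<alpha>" "\<alpha> < 1" "0 < s"
    and cap: "\<And>x. x \<in> G \<Longrightarrow> ennreal s \<le> ball_cap \<alpha> G x"
  shows "uniformly_perfect (ext_boundary G)"
proof -
  define n where "n = DIM('a)"
  define E where "E = frontier G"
  note fp = finite_points_ext_boundary[of G, folded E_def]
  obtain C :: real where "0 \<le> C" and cutoff: "\<And>N (a :: 'a) s. 0 < N \<Longrightarrow> 0 < s \<Longrightarrow> \<exists>u g. continuous_partials u g \<and>
      (\<forall>x. 0 \<le> u x \<and> u x \<le> 1) \<and> (\<forall>x. norm (x - a) \<le> s \<longrightarrow> u x = 1) \<and>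
      (\<forall>x. 2 ^ N * s \<le> norm (x - a) \<longrightarrow> u x = 0) \<and>
      (\<integral>\<^sup>+x. ennreal (norm (grad u x) ^ DIM('a)) \<partial>lborel) \<le> ennreal (C / real N)"
    using logarithmic_cutoff[OF dim] by blast
  obtain N :: nat where N: "2 ^ n * (2 * C) / s < N" using reals_Archimedean2 by blast
  moreover have "0 \<le> 2 ^ n * (2 * C) / s" using \<open>0 \<le> C\<close> \<open>0 < s\<close> by simp
  ultimately have "0 < real N" by linarith
  then have "0 < N" by simp
  have small: "2 ^ n * (2 * C / N) < s"
    using N \<open>0 < real N\<close> \<open>0 < s\<close> by (simp add: pos_divide_less_eq mult.commute)
  have "C / N \<le> 2 ^ n * (2 * C / N)"
    using mult_mono[of 1 "2 ^ n" "C / N" "2 * C / N"] \<open>0 \<le> C\<close> by simp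
  then have small1: "C / N < s" using small by simp

  have "E \<noteq> {}"
  proof
    \<comment> \<open>Without finite boundary points \<open>G\<close> is the whole space and \<open>boundary_dist\<close> is the default value \<open>0\<close>, so
      the capacity is that of a point, which the cutoff shows to be arbitrarily small.\<close>
    assume "E = {}"
    then have "G = UNIV" using frontier_eq_empty[of G] \<open>G \<noteq> {}\<close> by (simp add: E_def)
    obtain u :: "'a \<Rightarrow> real" and g where u: "continuous_partials u g" "\<forall>x. 0 \<le> u x \<and> u x \<le> 1"
      "\<forall>x. norm (x - 0) \<le> 1 \<longrightarrow> u x = 1" "\<forall>x. 2 ^ N * 1 \<le> norm (x - 0) \<longrightarrow> u x = 0"
      "(\<integral>\<^sup>+x. ennreal (norm (grad u x) ^ DIM('a)) \<partial>lborel) \<le> ennreal (C / real N)"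
      using cutoff[OF \<open>0 < N\<close>, of 1 0] by auto
    have "{x. u x \<noteq> 0} \<subseteq> cball 0 (2 ^ N)" using u(4) by (force simp: not_le)
    then have "bounded {x. u x \<noteq> 0}" by (rule bounded_subset[OF bounded_cball])
    then have "u \<in> cap_admissible G (cball 0 (\<alpha> * boundary_dist G 0))"
      unfolding cap_admissible_def boundary_dist_def fp \<open>E = {}\<close>
      using u \<open>G = UNIV\<close> ACLn_continuous_partials[OF u(1)] by (auto simp: infdist_def)
    then have "ball_cap \<alpha> G 0 \<le> (\<integral>\<^sup>+x. ennreal (norm (grad u x) ^ DIM('a)) \<partial>lborel)"
      unfolding ball_cap_def cap_def by (rule INF_lower)
    then have "ennreal s \<le> ennreal (C / N)" using cap[of 0] \<open>G = UNIV\<close> u(5) by (meson UNIV_I order_trans)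
    then show False using small1 \<open>0 \<le> C\<close> by (simp add: ennreal_le_iff)
  qed

  \<comment> \<open>So small that \<open>N\<close> doublings lead from \<open>2 * (\<kappa> * r)\<close> to a radius below \<open>r / 2\<close> and from
    \<open>2 * (c * r)\<close> to a radius below \<open>(1 - \<alpha>) * (\<kappa> * r)\<close>, inside which the ball around \<open>x\<close> has no point.\<close>
  define \<kappa> where "\<kappa> = (1 - \<alpha>) / 2 ^ (N + 2)"
  have pow: "(1::real) \<le> 2 ^ N" by simp
  have \<kappa>: "0 < \<kappa>" "2 ^ N * (2 * \<kappa>) \<le> (1 - \<alpha>) / 2"
    using assms(6) by (auto simp: \<kappa>_def power_add)
  have "\<kappa> \<le> 2 ^ N * \<kappa>" using pow \<kappa>(1) mult_right_mono[of 1 "2 ^ N" \<kappa>] by simp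
  moreover have "2 * (2 ^ N * \<kappa>) \<le> (1 - \<alpha>) / 2" using \<kappa>(2) by simp
  ultimately have \<kappa>1: "\<kappa> < 1 / 4" using \<open>0 < \<alpha>\<close> by argo
  define c where "c = \<kappa> * \<kappa>"
  have "\<kappa> * \<kappa> < \<kappa> * 1" using \<kappa>(1) \<kappa>1 by (intro mult_strict_left_mono) auto
  then have c: "0 < c" "c < \<kappa>" using \<kappa> by (auto simp: c_def)

  have "UP c (ext_boundary G)"
    unfolding UP_def fp
  proof (intro conjI ballI allI impI)
    show "compactin ext_space (ext_boundary G)" by (rule compactin_ext_boundary)
    show "\<exists>x\<in>ext_boundary G. \<exists>y\<in>ext_boundary G. x \<noteq> y"
    proof (cases "bounded G")
      case True
      obtain x where "x \<in> G" using \<open>G \<noteq> {}\<close> by blast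
      then have "x \<notin> E" using \<open>open G\<close> by (simp add: E_def frontier_def interior_open)
      then have "0 < infdist x E"
        using \<open>E \<noteq> {}\<close> by (intro infdist_pos_not_in_closed) (auto simp: E_def)
      then have diam: "0 < diameter E"
        using twice_boundary_dist_le_diameter[OF \<open>open G\<close> True \<open>x \<in> G\<close>] by (simp add: E_def)
      obtain y where "y \<in> E" using \<open>E \<noteq> {}\<close> by blast
      have "E \<noteq> {y}" using diam by auto
      then obtain z where "z \<in> E" "z \<noteq> y" using \<open>y \<in> E\<close> by blast
      then show ?thesis using \<open>y \<in> E\<close> fp by (intro bexI[of _ "Some y"] bexI[of _ "Some z"]) auto
    next
      case False
      then have "None \<in> ext_boundary G" by (simp add: infinity_in_ext_boundary_iff)
      moreover obtain y where "y \<in> E" using \<open>E \<noteq> {}\<close> by blast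
      ultimately show ?thesis using fp by (intro bexI[of _ None] bexI[of _ "Some y"]) auto
    qed
    fix a r assume a: "a \<in> E" and "0 < r" and r: "ereal r < ext_diameter (ext_boundary G) / 2"
    show "{x \<in> E. c * r < norm (x - a) \<and> norm (x - a) < r} \<noteq> {}"
    proof
      assume empty: "{x \<in> E. c * r < norm (x - a) \<and> norm (x - a) < r} = {}"
      have "\<not> G \<subseteq> cball a r"
      proof
        assume sub: "G \<subseteq> cball a r"
        then have "bounded G" by (rule bounded_subset[OF bounded_cball])
        then have "r < diameter E / 2"
          using r by (simp add: ext_diameter_def fp infinity_in_ext_boundary_iff)
        have "closure G \<subseteq> cball a r" using sub by (simp add: closure_minimal)
        then have "E \<subseteq> cball a r" by (auto simp: E_def frontier_def)
        then have "diameter E \<le> diameter (cball a r)" by (intro diameter_subset) auto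
        then show False using \<open>r < diameter E / 2\<close> \<open>0 < r\<close> by simp
      qed
      moreover have "0 < c * r" "c * r < r" using c \<kappa>1 \<open>0 < r\<close> by auto
      ultimately have ring: "{x. c * r < norm (x - a) \<and> norm (x - a) < r} \<subseteq> G"
        using ring_subset_of_empty_boundary_ring[OF dim \<open>connected G\<close> a[unfolded E_def]] empty
        by (simp add: E_def)
      obtain e :: 'a where e: "e \<in> Basis" using nonempty_Basis by blast
      define x where "x = a + (\<kappa> * r) *\<^sub>R e"
      have xa: "norm (x - a) = \<kappa> * r" using e \<kappa> \<open>0 < r\<close> by (simp add: x_def)
      have scales: "c * r < \<kappa> * r" "\<kappa> * r < r / 4" "2 ^ N * (2 * (\<kappa> * r)) \<le> (1 - \<alpha>) / 2 * r"
        using c \<kappa>1 \<open>0 < r\<close> mult_right_mono[OF \<kappa>(2), of r] by (auto simp: mult_ac)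
      have "x \<in> G" using ring xa scales \<open>0 < r\<close> by (intro subsetD[OF ring]) simp
      define d where "d = infdist x E"
      have "0 \<le> d" "d \<le> \<kappa> * r"
        using infdist_le[OF a, of x] xa by (auto simp: d_def infdist_nonneg dist_norm)
      have ball: "(1 - \<alpha>) * (\<kappa> * r) \<le> norm (y - a) \<and> norm (y - a) \<le> 2 * (\<kappa> * r)"
        if "y \<in> cball x (\<alpha> * d)" for y
      proof -
        have "\<alpha> * d \<le> \<alpha> * (\<kappa> * r)" using \<open>d \<le> \<kappa> * r\<close> \<open>0 < \<alpha>\<close> by simp
        then have yx: "norm (y - x) \<le> \<alpha> * (\<kappa> * r)"
          using that by (simp add: dist_norm norm_minus_commute)
        have "\<alpha> * (\<kappa> * r) \<le> 1 * (\<kappa> * r)" using \<open>\<alpha> < 1\<close> \<kappa> \<open>0 < r\<close> by (intro mult_right_mono) auto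
        moreover have "norm (y - a) \<le> norm (y - x) + norm (x - a)"
          using norm_triangle_ineq[of "y - x" "x - a"] by simp
        moreover have "norm (x - a) \<le> norm (y - x) + norm (y - a)"
          using norm_triangle_ineq4[of "y - a" "y - x"] by simp
        ultimately show ?thesis using yx xa by (simp add: algebra_simps)
      qed
      obtain u g where u: "continuous_partials u g" "\<forall>x. 0 \<le> u x \<and> u x \<le> 1"
        "\<forall>x. norm (x - a) \<le> 2 * (\<kappa> * r) \<longrightarrow> u x = 1" "\<forall>x. 2 ^ N * (2 * (\<kappa> * r)) \<le> norm (x - a) \<longrightarrow> u x = 0"
        "(\<integral>\<^sup>+x. ennreal (norm (grad u x) ^ DIM('a)) \<partial>lborel) \<le> ennreal (C / real N)"
        using cutoff[OF \<open>0 < N\<close>, of "2 * (\<kappa> * r)" a] \<kappa> \<open>0 < r\<close> by auto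
      obtain v h where v: "continuous_partials v h" "\<forall>x. 0 \<le> v x \<and> v x \<le> 1"
        "\<forall>x. norm (x - a) \<le> 2 * (c * r) \<longrightarrow> v x = 1" "\<forall>x. 2 ^ N * (2 * (c * r)) \<le> norm (x - a) \<longrightarrow> v x = 0"
        "(\<integral>\<^sup>+x. ennreal (norm (grad v x) ^ DIM('a)) \<partial>lborel) \<le> ennreal (C / real N)"
        using cutoff[OF \<open>0 < N\<close>, of "2 * (c * r)" a] c \<open>0 < r\<close> by auto
      define \<psi> where "\<psi> x = u x - v x" for x
      have cp: "continuous_partials \<psi> (\<lambda>i x. g i x - h i x)"
        unfolding \<psi>_def[abs_def] by (rule continuous_partials_diff[OF u(1) v(1)])
      have v_scale: "2 ^ N * (2 * (c * r)) \<le> (1 - \<alpha>) / 2 * (\<kappa> * r)"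
        using mult_right_mono[OF \<kappa>(2), of "\<kappa> * r"] \<kappa>(1) \<open>0 < r\<close> by (simp add: c_def mult_ac)
      have v_scale': "2 ^ N * (2 * (c * r)) < (1 - \<alpha>) * (\<kappa> * r)"
        "2 ^ N * (2 * (c * r)) \<le> 2 * (\<kappa> * r)"
      proof -
        have "0 < (1 - \<alpha>) * (\<kappa> * r)" using \<open>\<alpha> < 1\<close> \<kappa> \<open>0 < r\<close> by simp
        then show "2 ^ N * (2 * (c * r)) < (1 - \<alpha>) * (\<kappa> * r)" using v_scale by simp
        also have "\<dots> \<le> 2 * (\<kappa> * r)" using \<open>0 < \<alpha>\<close> \<kappa> \<open>0 < r\<close> by (intro mult_right_mono) auto
        finally show "2 ^ N * (2 * (c * r)) \<le> 2 * (\<kappa> * r)" by simp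
      qed
      have nonneg: "0 \<le> \<psi> y" for y
      proof (cases "norm (y - a) \<le> 2 * (\<kappa> * r)")
        case True
        then show ?thesis using u(3) v(2) by (simp add: \<psi>_def)
      next
        case False
        then have "v y = 0" using v(4) v_scale'(2) by simp
        then show ?thesis using u(2) by (simp add: \<psi>_def)
      qed
      have supp: "{y. \<psi> y \<noteq> 0} \<subseteq> {y. 2 * (c * r) \<le> norm (y - a) \<and> norm (y - a) \<le> r / 2}"
      proof (intro subsetI CollectI conjI; rule ccontr)
        fix y assume y: "y \<in> {y. \<psi> y \<noteq> 0}"
        {
          assume "\<not> 2 * (c * r) \<le> norm (y - a)"
          moreover from this have "norm (y - a) \<le> 2 * (\<kappa> * r)" using scales(1) by linarith
          ultimately show False using u(3) v(3) y by (simp add: \<psi>_def)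
        next
          assume far: "\<not> norm (y - a) \<le> r / 2"
          have "(1 - \<alpha>) / 2 * r \<le> 1 / 2 * r" using \<open>0 < \<alpha>\<close> \<open>0 < r\<close> by (intro mult_right_mono) auto
          then have "2 ^ N * (2 * (\<kappa> * r)) \<le> norm (y - a)" using scales(3) far by linarith
          moreover have "2 ^ N * (2 * (c * r)) \<le> norm (y - a)"
            using v_scale'(2) scales(2) far by linarith
          ultimately show False using u(4) v(4) y by (simp add: \<psi>_def)
        }
      qed
      have "closed {y. 2 * (c * r) \<le> norm (y - a) \<and> norm (y - a) \<le> r / 2}"
        by (intro closed_Collect_conj closed_Collect_le continuous_intros)
      then have cl: "closure {y. \<psi> y \<noteq> 0} \<subseteq> {y. 2 * (c * r) \<le> norm (y - a) \<and> norm (y - a) \<le> r / 2}"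
        using supp by (rule closure_minimal[rotated])
      also have "\<dots> \<subseteq> {x. c * r < norm (x - a) \<and> norm (x - a) < r}"
        using \<open>0 < c * r\<close> \<open>0 < r\<close> by auto
      also note ring
      finally have clG: "closure {y. \<psi> y \<noteq> 0} \<subseteq> G" .
      have "closure {y. \<psi> y \<noteq> 0} \<subseteq> cball a r"
        using cl \<open>0 < r\<close> by (force simp: dist_norm norm_minus_commute)
      then have compact: "compact (closure {y. \<psi> y \<noteq> 0})"
        by (meson bounded_cball bounded_subset closed_closure compact_eq_bounded_closed)
      have "1 \<le> \<psi> y" if "y \<in> cball x (\<alpha> * d)" for y
        using ball[OF that] u(3) v(4) v_scale'(1) by (simp add: \<psi>_def)
      then have "\<psi> \<in> cap_admissible G (cball x (\<alpha> * boundary_dist G x))"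
        unfolding cap_admissible_def boundary_dist_def fp
        using nonneg compact clG ACLn_continuous_partials[OF cp] by (simp add: d_def)
      then have "ball_cap \<alpha> G x \<le> (\<integral>\<^sup>+x. ennreal (norm (grad \<psi> x) ^ DIM('a)) \<partial>lborel)"
        unfolding ball_cap_def cap_def by (rule INF_lower)
      also have "\<dots> \<le> ennreal (2 ^ n) * ((\<integral>\<^sup>+x. ennreal (norm (grad u x) ^ DIM('a)) \<partial>lborel)
         + (\<integral>\<^sup>+x. ennreal (norm (grad v x) ^ DIM('a)) \<partial>lborel))"
        unfolding \<psi>_def[abs_def] n_def by (rule energy_diff_le[OF u(1) v(1)])
      also have "\<dots> \<le> ennreal (2 ^ n) * (ennreal (C / N) + ennreal (C / N))"
        using u(5) v(5) by (intro mult_left_mono add_mono) auto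
      also have "\<dots> = ennreal (2 ^ n * (2 * C / N))"
        using \<open>0 \<le> C\<close> by (simp add: ennreal_mult'[symmetric] ennreal_plus[symmetric] del: ennreal_plus)
      also have "\<dots> < ennreal s" using small \<open>0 < s\<close> by (simp add: ennreal_lessI)
      finally show False using cap[OF \<open>x \<in> G\<close>] by simp
    qed
  qed
  then show ?thesis using c \<kappa>1 unfolding uniformly_perfect_def by (intro exI[of _ c]) auto
qed

theorem theorem1p3:
  fixes G :: "(real ^ 'n) set" and \<alpha> :: real
  assumes "CARD('n) \<ge> 2"
    and "open G" and "connected G" and "G \<noteq> {}"
    and "ext_cap_positive (ext_boundary G)"
    and "0 < \<alpha>" and "\<alpha> < 1"
  shows "uniformly_perfect (ext_boundary G) \<longleftrightarrow>
    (\<exists>s::real. s > 0 \<and> (\<forall>x\<in>G. ball_cap \<alpha> G x \<ge> ennreal s))"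
proof
  assume "uniformly_perfect (ext_boundary G)"
  then show "\<exists>s>0. \<forall>x\<in>G. ball_cap \<alpha> G x \<ge> ennreal s"
    using ball_cap_lower_bound[of G \<alpha>] assms by simp
next
  assume "\<exists>s>0. \<forall>x\<in>G. ball_cap \<alpha> G x \<ge> ennreal s"
  then obtain s where "0 < s" "\<And>x. x \<in> G \<Longrightarrow> ennreal s \<le> ball_cap \<alpha> G x" by blast
  moreover have "2 \<le> DIM(real ^ 'n)" using assms(1) by simp
  ultimately show "uniformly_perfect (ext_boundary G)"
    using uniformly_perfect_of_ball_cap[of G \<alpha> s] assms by blast
qed

end
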